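(* Let $A\in \mathrm{GL}_4(\mathbb{Z})$ be the matrix $$A=\begin{pmatrix}0&0&0&-1\\1&0&0&2\\0&1&0&0\\0&0&1&2\end{pmatrix},$$ i.e. the companion matrix of $P(X)=X^4-2X^3-2X+1$. Put $H:=\ker\big(A^2+(\sqrt3-1)A+I_4\big)$ and $E:=\ker\big(A^2-(\sqrt3+1)A+I_4\big)$, so that $H$ is a plane and $\mathbb{R}^4=H\oplus E$. Let $\Gamma$ be the group of diffeomorphisms of $\tilde M:=\mathbb{R}^4\times\mathbb{R}$ generated by the translations $(x,t)\mapsto(x+n,t)$, $n\in\mathbb{Z}^4$, and by the map $(x,t)\mapsto(Ax,t+1)$. Then there exists a positive definite quadratic form on $H$ invariant under $A|_H$. Let $q$ be such a form and let $\tilde g:=(q\oplus 0_E)+dt^2$ be the corresponding non-negative definite metric on $\tilde M=(H\oplus E)\times\mathbb{R}$, where $t$ is the coordinate on the last factor. Then: 1. $\Gamma$ acts freely, properly discontinuously and cocompactly on $\tilde M$ and preserves $\tilde g$, so that $M:=\tilde M/\Gamma$ is a closed $5$-dimensional manifold and $\tilde g$ descends to a metric $g$ on $M$; the metric $g$ is non-negative definite, flat and of constant rank $3$. 2. $M$ is not finitely covered by a fiber bundle over the $3$-torus $T^3$; that is, there is no (non-empty) finite-sheeted covering $\bar M\to M$ such that $\bar M$ is diffeomorphic to the total space of a fiber bundle over $T^3=\mathbb{R}^3/\mathbb{Z}^3$. In particular, the following assertion is false: "every closed manifold carrying a flat non-negative definite (possibly degenerate) metric of constant rank $m$ is finitely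 covered by a manifold diffeomorphic to a fiber bundle over an $m$-dimensional torus."
   Context: Manifolds and bundles are smooth. A closed manifold is a compact manifold without boundary. A (possibly degenerate) non-negative definite metric on a manifold is a smooth symmetric $(0,2)$-tensor field $g$ with $g(v,v)\ge 0$ for all tangent vectors $v$; its rank at a point is the rank of the corresponding symmetric bilinear form on the tangent space. Such a metric is called flat if around every point there exist local coordinates in which $g$ is given by a constant matrix. The notation $q\oplus 0_E$ denotes the quadratic form on $\mathbb{R}^4=H\oplus E$ sending $h+e$ (with $h\in H$, $e\in E$) to $q(h)$, regarded as a constant (translation-invariant) symmetric $(0,2)$-tensor on $\mathbb{R}^4$ and pulled back to $\tilde M=\mathbb{R}^4\times\mathbb{R}$. *)

theory Defs
  imports
    "HOL-Analysis.Analysis"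
    "HOL-Library.Function_Algebras"
    "HOL-Algebra.Bij"
    "HOL-Algebra.Generated_Groups"
begin

section \<open>Smooth functions on open subsets of Euclidean space\<close>

text \<open>
  Euclidean \<open>n\<close>-space is the library's \<^term>\<open>Euclidean_space n\<close>, whose points are the sequences
  \<open>x :: nat \<Rightarrow> real\<close> with \<open>x i = 0\<close> for \<open>i \<ge> n\<close>. The dimension is thus a natural number that can be
  quantified over. Coordinates are numbered from \<open>0\<close>.
\<close>

definition partial_deriv :: "nat \<Rightarrow> ((nat \<Rightarrow> real) \<Rightarrow> real) \<Rightarrow> (nat \<Rightarrow> real) \<Rightarrow> real"
  where "partial_deriv i F x = deriv (\<lambda>t. F (x(i := t))) (x i)"

primrec Ck_on :: "nat \<Rightarrow> nat \<Rightarrow> (nat \<Rightarrow> real) set \<Rightarrow> ((nat \<Rightarrow> real) \<Rightarrow> real) \<Rightarrow> bool" where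
  "Ck_on 0 n U F \<longleftrightarrow> continuous_map (subtopology (Euclidean_space n) U) euclideanreal F"
| "Ck_on (Suc k) n U F \<longleftrightarrow>
     continuous_map (subtopology (Euclidean_space n) U) euclideanreal F \<and>
     (\<forall>i<n. (\<forall>x\<in>U. (\<lambda>t. F (x(i := t))) differentiable (at (x i))) \<and>
            Ck_on k n U (partial_deriv i F))"

definition smooth_fun_on :: "nat \<Rightarrow> (nat \<Rightarrow> real) set \<Rightarrow> ((nat \<Rightarrow> real) \<Rightarrow> real) \<Rightarrow> bool"
  where "smooth_fun_on n U F \<longleftrightarrow> (\<forall>k. Ck_on k n U F)"


section \<open>Smooth manifolds (without boundary) and smooth maps\<close>

type_synonym 'a chart = "'a set \<times> ('a \<Rightarrow> nat \<Rightarrow> real)"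

record 'a mfd =
  mdim :: nat
  mtop :: "'a topology"
  atlas :: "'a chart set"

abbreviation mcarrier :: "'a mfd \<Rightarrow> 'a set"
  where "mcarrier M \<equiv> topspace (mtop M)"

definition is_chart :: "nat \<Rightarrow> 'a topology \<Rightarrow> 'a chart \<Rightarrow> bool"
  where "is_chart n X c \<longleftrightarrow>
    openin X (fst c) \<and> openin (Euclidean_space n) (snd c ` fst c) \<and>
    homeomorphic_map (subtopology X (fst c))
      (subtopology (Euclidean_space n) (snd c ` fst c)) (snd c)"

definition local_rep ::
    "'a chart \<Rightarrow> 'b chart \<Rightarrow> ('a \<Rightarrow> 'b) \<Rightarrow> (nat \<Rightarrow> real) \<Rightarrow> nat \<Rightarrow> real"
  where "local_rep c d f y = snd d (f (inv_into (fst c) (snd c) y))"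

definition smooth_in_charts ::
    "nat \<Rightarrow> nat \<Rightarrow> 'a chart \<Rightarrow> 'b chart \<Rightarrow> ('a \<Rightarrow> 'b) \<Rightarrow> bool"
  where "smooth_in_charts m n c d f \<longleftrightarrow>
    (\<forall>k<n. smooth_fun_on m (snd c ` {x \<in> fst c. f x \<in> fst d}) (\<lambda>y. local_rep c d f y k))"

text \<open>The atlas is not required to be maximal; the maximal atlas is \<open>charts\<close> below.\<close>

definition smooth_manifold :: "'a mfd \<Rightarrow> bool"
  where "smooth_manifold M \<longleftrightarrow>
    Hausdorff_space (mtop M) \<and> second_countable (mtop M) \<and>
    (\<forall>c\<in>atlas M. is_chart (mdim M) (mtop M) c) \<and>
    (\<Union>c\<in>atlas M. fst c) = mcarrier M \<and>
    (\<forall>c\<in>atlas M. \<forall>d\<in>atlas M. smooth_in_charts (mdim M) (mdim M) c d (\<lambda>x. x))"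

definition charts :: "'a mfd \<Rightarrow> 'a chart set"
  where "charts M = {c. is_chart (mdim M) (mtop M) c \<and>
    (\<forall>d\<in>atlas M. smooth_in_charts (mdim M) (mdim M) c d (\<lambda>x. x) \<and>
                  smooth_in_charts (mdim M) (mdim M) d c (\<lambda>x. x))}"

definition closed_manifold :: "'a mfd \<Rightarrow> bool"
  where "closed_manifold M \<longleftrightarrow> smooth_manifold M \<and> compact_space (mtop M)"

definition smooth_map :: "'a mfd \<Rightarrow> 'b mfd \<Rightarrow> ('a \<Rightarrow> 'b) \<Rightarrow> bool"
  where "smooth_map M N f \<longleftrightarrow>
    continuous_map (mtop M) (mtop N) f \<and>
    (\<forall>c\<in>atlas M. \<forall>d\<in>atlas N. smooth_in_charts (mdim M) (mdim N) c d f)"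

definition diffeomorphism :: "'a mfd \<Rightarrow> 'b mfd \<Rightarrow> ('a \<Rightarrow> 'b) \<Rightarrow> bool"
  where "diffeomorphism M N f \<longleftrightarrow>
    smooth_map M N f \<and>
    (\<exists>f'. smooth_map N M f' \<and> (\<forall>x\<in>mcarrier M. f' (f x) = x) \<and> (\<forall>y\<in>mcarrier N. f (f' y) = y))"

definition open_submfd :: "'a mfd \<Rightarrow> 'a set \<Rightarrow> 'a mfd"
  where "open_submfd M U =
    \<lparr>mdim = mdim M, mtop = subtopology (mtop M) U, atlas = (\<lambda>c. (fst c \<inter> U, snd c)) ` atlas M\<rparr>"

definition prod_chart :: "nat \<Rightarrow> 'a chart \<Rightarrow> 'b chart \<Rightarrow> ('a \<times> 'b) chart"
  where "prod_chart m c d =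
    (fst c \<times> fst d, \<lambda>p i. if i < m then snd c (fst p) i else snd d (snd p) (i - m))"

definition prod_mfd :: "'a mfd \<Rightarrow> 'b mfd \<Rightarrow> ('a \<times> 'b) mfd"
  where "prod_mfd M N =
    \<lparr>mdim = mdim M + mdim N, mtop = prod_topology (mtop M) (mtop N),
     atlas = {prod_chart (mdim M) c d |c d. c \<in> atlas M \<and> d \<in> atlas N}\<rparr>"


section \<open>Coverings and fibre bundles\<close>

text \<open>As in \<^const>\<open>covering_space\<close>, but smooth and not assumed surjective.\<close>

definition smooth_covering :: "'a mfd \<Rightarrow> 'b mfd \<Rightarrow> ('a \<Rightarrow> 'b) \<Rightarrow> bool"
  where "smooth_covering M' M p \<longleftrightarrow>
    smooth_map M' M p \<and>
    (\<forall>x\<in>mcarrier M. \<exists>U. openin (mtop M) U \<and> x \<in> U \<and>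
       (\<exists>\<V>. \<Union>\<V> = {y \<in> mcarrier M'. p y \<in> U} \<and> pairwise disjnt \<V> \<and>
            (\<forall>V\<in>\<V>. openin (mtop M') V \<and>
                     diffeomorphism (open_submfd M' V) (open_submfd M U) p)))"

definition finite_covering :: "'a mfd \<Rightarrow> 'b mfd \<Rightarrow> ('a \<Rightarrow> 'b) \<Rightarrow> bool"
  where "finite_covering M' M p \<longleftrightarrow>
    smooth_covering M' M p \<and> (\<forall>x\<in>mcarrier M. finite {y \<in> mcarrier M'. p y = x})"

definition fiber_bundle :: "'e mfd \<Rightarrow> 'b mfd \<Rightarrow> 'f mfd \<Rightarrow> ('e \<Rightarrow> 'b) \<Rightarrow> bool"
  where "fiber_bundle N B F \<pi> \<longleftrightarrow>
    smooth_manifold N \<and> smooth_manifold B \<and> smooth_manifold F \<and> smooth_map N B \<pi> \<and>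
    (\<forall>b\<in>mcarrier B. \<exists>U. openin (mtop B) U \<and> b \<in> U \<and>
       (\<exists>\<Phi>. diffeomorphism (open_submfd N {y \<in> mcarrier N. \<pi> y \<in> U})
                            (prod_mfd (open_submfd B U) F) \<Phi> \<and>
             (\<forall>y\<in>mcarrier N. \<pi> y \<in> U \<longrightarrow> fst (\<Phi> y) = \<pi> y)))"


section \<open>Group actions and quotients\<close>

definition orb :: "('a \<Rightarrow> 'a) set \<Rightarrow> 'a \<Rightarrow> 'a set"
  where "orb G x = (\<lambda>\<gamma>. \<gamma> x) ` G"

definition acts_freely :: "'a topology \<Rightarrow> ('a \<Rightarrow> 'a) set \<Rightarrow> bool"
  where "acts_freely X G \<longleftrightarrow>
    (\<forall>\<gamma>\<in>G. \<forall>x\<in>topspace X. \<gamma> x = x \<longrightarrow> (\<forall>y\<in>topspace X. \<gamma> y = y))"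

definition properly_discontinuous :: "'a topology \<Rightarrow> ('a \<Rightarrow> 'a) set \<Rightarrow> bool"
  where "properly_discontinuous X G \<longleftrightarrow>
    (\<forall>K. compactin X K \<longrightarrow> finite {\<gamma> \<in> G. \<gamma> ` K \<inter> K \<noteq> {}})"

definition cocompact :: "'a topology \<Rightarrow> ('a \<Rightarrow> 'a) set \<Rightarrow> bool"
  where "cocompact X G \<longleftrightarrow> (\<exists>K. compactin X K \<and> (\<Union>\<gamma>\<in>G. \<gamma> ` K) = topspace X)"

text \<open>
  The quotient carries the quotient topology; its charts are the charts of \<open>X\<close>, restricted to open
  sets that the projection maps injectively and composed with the local inverse of the projection.
\<close>

definition quotient_mfd :: "'a mfd \<Rightarrow> ('a \<Rightarrow> 'a) set \<Rightarrow> 'a set mfd"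
  where "quotient_mfd X G =
    \<lparr>mdim = mdim X,
     mtop = topology (\<lambda>W. W \<subseteq> orb G ` mcarrier X \<and> openin (mtop X) {x \<in> mcarrier X. orb G x \<in> W}),
     atlas = {(orb G ` V, \<lambda>w. snd c (inv_into V (orb G) w)) |c V.
                c \<in> atlas X \<and> openin (mtop X) V \<and> V \<subseteq> fst c \<and> inj_on (orb G) V}\<rparr>"

definition euclidean_mfd :: "nat \<Rightarrow> (nat \<Rightarrow> real) mfd"
  where "euclidean_mfd m =
    \<lparr>mdim = m, mtop = Euclidean_space m, atlas = {(topspace (Euclidean_space m), \<lambda>x. x)}\<rparr>"

definition torus :: "nat \<Rightarrow> (nat \<Rightarrow> real) set mfd"
  where "torus m = quotient_mfd (euclidean_mfd m)
    {(\<lambda>x i. x i + n i) |n. (\<forall>i. n i \<in> \<int>) \<and> (\<forall>i\<ge>m. n i = 0)}"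


section \<open>Possibly degenerate metrics\<close>

text \<open>
  A \<open>(0,2)\<close>-tensor field is given by its matrix of components \<open>g c x i j\<close> at each point \<open>x\<close> of the
  domain of each chart \<open>c\<close> of the atlas, subject to the usual transformation law, i.e. it is its own
  pullback under the identity. Values of \<open>g\<close> outside this range are irrelevant.
\<close>

type_synonym 'a tensor2 = "'a chart \<Rightarrow> 'a \<Rightarrow> nat \<Rightarrow> nat \<Rightarrow> real"

definition pullback_comp ::
    "nat \<Rightarrow> 'a chart \<Rightarrow> 'b chart \<Rightarrow> ('a \<Rightarrow> 'b) \<Rightarrow> 'b tensor2 \<Rightarrow> 'a \<Rightarrow> nat \<Rightarrow> nat \<Rightarrow> real"
  where "pullback_comp n c d f g x i j =
    (\<Sum>k<n. \<Sum>l<n. partial_deriv i (\<lambda>y. local_rep c d f y k) (snd c x) *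
                   partial_deriv j (\<lambda>y. local_rep c d f y l) (snd c x) * g d (f x) k l)"

text \<open>\<open>h\<close> is the pullback of \<open>g\<close> under the smooth map \<open>f : M \<rightarrow> N\<close>.\<close>

definition is_pullback :: "'a mfd \<Rightarrow> 'b mfd \<Rightarrow> ('a \<Rightarrow> 'b) \<Rightarrow> 'b tensor2 \<Rightarrow> 'a tensor2 \<Rightarrow> bool"
  where "is_pullback M N f g h \<longleftrightarrow>
    (\<forall>c\<in>atlas M. \<forall>d\<in>atlas N. \<forall>x\<in>fst c. f x \<in> fst d \<longrightarrow>
       (\<forall>i<mdim M. \<forall>j<mdim M. h c x i j = pullback_comp (mdim N) c d f g x i j))"

definition sym_tensor :: "'a mfd \<Rightarrow> 'a tensor2 \<Rightarrow> bool"
  where "sym_tensor M g \<longleftrightarrow>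
    is_pullback M M (\<lambda>x. x) g g \<and>
    (\<forall>c\<in>atlas M. \<forall>i<mdim M. \<forall>j<mdim M.
       (\<forall>x\<in>fst c. g c x i j = g c x j i) \<and>
       smooth_fun_on (mdim M) (snd c ` fst c) (\<lambda>y. g c (inv_into (fst c) (snd c) y) i j))"

definition nonneg_tensor :: "'a mfd \<Rightarrow> 'a tensor2 \<Rightarrow> bool"
  where "nonneg_tensor M g \<longleftrightarrow>
    (\<forall>c\<in>atlas M. \<forall>x\<in>fst c. \<forall>v::nat \<Rightarrow> real.
       0 \<le> (\<Sum>i<mdim M. \<Sum>j<mdim M. g c x i j * v i * v j))"

definition nonneg_metric :: "'a mfd \<Rightarrow> 'a tensor2 \<Rightarrow> bool"
  where "nonneg_metric M g \<longleftrightarrow> sym_tensor M g \<and> nonneg_tensor M g"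

text \<open>The rank of an \<open>n \<times> n\<close> matrix, as the dimension of the space spanned by its rows.\<close>

definition mat_rank :: "nat \<Rightarrow> (nat \<Rightarrow> nat \<Rightarrow> real) \<Rightarrow> nat"
  where "mat_rank n B =
    vector_space.dim (\<lambda>(a::real) (v::nat \<Rightarrow> real) j. a * v j)
      ((\<lambda>i j. if j < n then B i j else 0) ` {..<n})"

definition constant_rank :: "'a mfd \<Rightarrow> 'a tensor2 \<Rightarrow> nat \<Rightarrow> bool"
  where "constant_rank M g r \<longleftrightarrow>
    (\<forall>c\<in>atlas M. \<forall>x\<in>fst c. mat_rank (mdim M) (g c x) = r)"

text \<open>
  The components of \<open>g\<close> in the local coordinates \<open>c\<close>, which need not belong to the atlas, are obtained
  from those in the charts \<open>d\<close> of the atlas.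
\<close>

definition flat_metric :: "'a mfd \<Rightarrow> 'a tensor2 \<Rightarrow> bool"
  where "flat_metric M g \<longleftrightarrow>
    (\<forall>p\<in>mcarrier M. \<exists>c\<in>charts M. p \<in> fst c \<and>
       (\<exists>K::nat \<Rightarrow> nat \<Rightarrow> real. \<forall>d\<in>atlas M. \<forall>x\<in>fst c \<inter> fst d. \<forall>i<mdim M. \<forall>j<mdim M.
          pullback_comp (mdim M) c d (\<lambda>x. x) g x i j = K i j))"


section \<open>The example\<close>

definition matAZ :: "int^4^4"
  where "matAZ = vector [vector [0, 0, 0, -1],
                        vector [1, 0, 0,  2],
                        vector [0, 1, 0,  0],
                        vector [0, 0, 1,  2]]"

definition matA :: "real^4^4"
  where "matA = map_matrix of_int matAZ"

text \<open>
  The index type \<open>4\<close> consists of \<open>1, 2, 3, 4\<close> (where \<open>4 = 0\<close>), hence the \<open>of_nat (Suc i)\<close> with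
  \<open>i < 4\<close> here and below.
\<close>

definition is_companion_matrix :: "int^4^4 \<Rightarrow> int poly \<Rightarrow> bool"
  where "is_companion_matrix B P \<longleftrightarrow>
    (\<forall>i<4. \<forall>j<4. B $ of_nat (Suc i) $ of_nat (Suc j) =
       (if j = 3 then - coeff P i else if i = Suc j then 1 else 0))"

definition planeH :: "(real^4) set"
  where "planeH = {x. (matA ** matA + (sqrt 3 - 1) *\<^sub>R matA + mat 1) *v x = 0}"

definition planeE :: "(real^4) set"
  where "planeE = {x. (matA ** matA - (sqrt 3 + 1) *\<^sub>R matA + mat 1) *v x = 0}"

definition coords :: "(real^4) \<times> real \<Rightarrow> nat \<Rightarrow> real"
  where "coords p i = (if i < 4 then fst p $ of_nat (Suc i) else if i = 4 then snd p else 0)"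

definition coord_vector :: "nat \<Rightarrow> (real^4) \<times> real"
  where "coord_vector i = (if i < 4 then (axis (of_nat (Suc i)) 1, 0) else (0, 1))"

definition Mt :: "((real^4) \<times> real) mfd"
  where "Mt = \<lparr>mdim = 5, mtop = euclidean, atlas = {(UNIV, coords)}\<rparr>"

definition \<Gamma> :: "((real^4) \<times> real \<Rightarrow> (real^4) \<times> real) set"
  where "\<Gamma> = generate (BijGroup UNIV)
    ({(\<lambda>(x, t). (x + n, t)) |n. \<forall>i. n $ i \<in> \<int>} \<union> {\<lambda>(x, t). (matA *v x, t + 1)})"

definition Mquot :: "((real^4) \<times> real) set mfd"
  where "Mquot = quotient_mfd Mt \<Gamma>"

text \<open>A symmetric bilinear form on a subspace is the restriction of one on the whole space.\<close>

definition quadratic_form_on :: "(real^4) set \<Rightarrow> (real^4 \<Rightarrow> real) \<Rightarrow> bool"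
  where "quadratic_form_on S q \<longleftrightarrow>
    (\<exists>b. bilinear b \<and> (\<forall>x y. b x y = b y x) \<and> (\<forall>h\<in>S. q h = b h h))"

definition invariant_form :: "(real^4 \<Rightarrow> real) \<Rightarrow> bool"
  where "invariant_form q \<longleftrightarrow>
    quadratic_form_on planeH q \<and> (\<forall>h\<in>planeH. h \<noteq> 0 \<longrightarrow> 0 < q h) \<and>
    (\<forall>h\<in>planeH. q (matA *v h) = q h)"

definition form_oplus_zero :: "(real^4 \<Rightarrow> real) \<Rightarrow> real^4 \<Rightarrow> real"
  where "form_oplus_zero q x = q (THE h. h \<in> planeH \<and> x - h \<in> planeE)"

definition gt_form :: "(real^4 \<Rightarrow> real) \<Rightarrow> (real^4) \<times> real \<Rightarrow> real"
  where "gt_form q v = form_oplus_zero q (fst v) + (snd v)\<^sup>2"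

text \<open>Components (by polarisation) of the translation-invariant tensor in the global chart of \<open>Mt\<close>.\<close>

definition gt :: "(real^4 \<Rightarrow> real) \<Rightarrow> ((real^4) \<times> real) tensor2"
  where "gt q c x i j =
    (gt_form q (coord_vector i + coord_vector j)
      - gt_form q (coord_vector i) - gt_form q (coord_vector j)) / 2"

end

theory Submission
  imports Defs
begin

text \<open>
  Elements of \<open>\<Gamma>\<close> are the affine maps \<open>(x, t) \<mapsto> (A\<^sup>k x + n, t + k)\<close> with \<open>n\<close> integral, so all transition
  maps of the quotient are locally affine with linear parts preserving the constant form; this gives
  the manifold structure and the flat metric of rank \<open>3\<close>.

  Suppose that a finite covering of the quotient fibres over the \<open>3\<close>-torus. The projection of
  \<open>\<real>\<^sup>5\<close> lifts to the covering, and composing the lift with the bundle projection gives an open map from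
  \<open>\<real>\<^sup>5\<close> to the torus, whose coordinates have real-valued angle functions \<open>\<phi>\<^sub>0\<close>, \<open>\<phi>\<^sub>1\<close>, \<open>\<phi>\<^sub>2\<close>.
  Since fibres are finite, the composite is invariant under a lattice \<open>m \<int>\<^sup>4\<close> and a power \<open>A\<^sup>K\<close> of the
  monodromy. The periods of \<open>\<phi>\<^sub>i\<close> along the lattice form an integral functional invariant under \<open>A\<^sup>K\<close>. The
  polynomial \<open>X\<^sup>4 - 2 X\<^sup>3 - 2 X + 1\<close> has two positive real roots different from \<open>1\<close> and its
  factorisation involves \<open>sqrt 3\<close>, so this functional is zero. Hence only the period along \<open>A\<^sup>K\<close> remains,
  and some non-trivial combination of \<open>\<phi>\<^sub>0\<close> and \<open>\<phi>\<^sub>1\<close> is invariant under a cocompact group. It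
  attains a maximum, which contradicts openness.
\<close>

section \<open>Lifting maps through coverings\<close>

text \<open>The obstruction is arithmetic. On \<open>planeH\<close> the matrix has a conjugate pair
  of eigenvalues on the unit circle, so it preserves a definite form there; together with the
  direction of \<open>t\<close> this gives rank 3. The pair is Galois conjugate, under sqrt 3 -> -
  sqrt 3, to the real pair on \<open>planeE\<close>, so it contains no root of unity: the matrix
  rotates \<open>planeH\<close> with infinite order, and no non-zero power of it fixes a non-zero
  integral functional. A finite covering therefore cannot untwist the monodromy, and periods survive
  in one direction only, whereas a torus of dimension at least 2 would need two independent ones.

  Lifts to the covering take the place of fundamental groups, and simple connectivity of Euclidean
  space is used through the convexity of boxes. A bundle enters through the openness of its
  projection, a covering through its sheets and the finiteness of its fibres, so the contradiction
  itself is topological.\<close>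

definition covers :: "'a topology \<Rightarrow> 'b topology \<Rightarrow> ('a \<Rightarrow> 'b) \<Rightarrow> bool"
  where "covers X Y p \<longleftrightarrow>
    continuous_map X Y p \<and>
    (\<forall>x\<in>topspace Y. \<exists>U. openin Y U \<and> x \<in> U \<and>
       (\<exists>\<V>. \<Union>\<V> = {y \<in> topspace X. p y \<in> U} \<and> pairwise disjnt \<V> \<and>
            (\<forall>V\<in>\<V>. openin X V \<and>
                     homeomorphic_map (subtopology X V) (subtopology Y U) p)))"

lemma covers_sheets:
  assumes "covers X Y p" and "x \<in> topspace Y"
  obtains U \<V> where "openin Y U" "x \<in> U" "\<Union>\<V> = {y \<in> topspace X. p y \<in> U}" "pairwise disjnt \<V>"
    "\<forall>V\<in>\<V>. openin X V \<and> homeomorphic_map (subtopology X V) (subtopology Y U) p"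
proof -
  have "\<forall>x\<in>topspace Y. \<exists>U. openin Y U \<and> x \<in> U \<and>
       (\<exists>\<V>. \<Union>\<V> = {y \<in> topspace X. p y \<in> U} \<and> pairwise disjnt \<V> \<and>
            (\<forall>V\<in>\<V>. openin X V \<and> homeomorphic_map (subtopology X V) (subtopology Y U) p))"
    using assms(1) unfolding covers_def by (rule conjunct2)
  from bspec[OF this assms(2)] show ?thesis
    by (elim exE conjE) (rule that)
qed

lemma inj_on_sheet:
  assumes "openin X V" and "homeomorphic_map (subtopology X V) (subtopology Y U) p"
  shows "inj_on p V"
proof -
  have "topspace (subtopology X V) = V" using openin_subset[OF assms(1)] by (simp add: Int_absorb1)
  then show ?thesis using homeomorphic_imp_injective_map[OF assms(2)] by simp
qed

text \<open>The truth value of \<open>s1 z = s2 z\<close> is locally constant, hence constant on a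
  connected set. Near \<open>a\<close> both lifts stay in fixed sheets: in a common sheet
  injectivity of \<open>p\<close> makes them equal throughout, and in different sheets they differ
  throughout. Disjointness of the sheets takes the place of a Hausdorff condition on
  \<open>X\<close>.\<close>

lemma covers_lift_unique:
  fixes S :: "'z::topological_space set"
  assumes cov: "covers X Y p" and S: "connected S"
    and s1: "continuous_map (top_of_set S) X s1" and s2: "continuous_map (top_of_set S) X s2"
    and eq: "\<And>z. z \<in> S \<Longrightarrow> p (s1 z) = p (s2 z)"
    and z0: "z0 \<in> S" "s1 z0 = s2 z0" and z: "z \<in> S"
  shows "s1 z = s2 z"
proof -
  have "\<forall>a\<in>S. \<forall>\<^sub>F b in at a within S. (s1 a = s2 a) = (s1 b = s2 b)"
  proof
    fix a assume a: "a \<in> S"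
    have ps: "continuous_map X Y p" using cov by (simp add: covers_def)
    have s1a: "s1 a \<in> topspace X" and s2a: "s2 a \<in> topspace X"
      using a s1 s2 by (auto simp: continuous_map_def)
    then have "p (s1 a) \<in> topspace Y" using ps by (auto simp: continuous_map_def)
    then obtain U \<V> where U: "openin Y U" "p (s1 a) \<in> U" "\<Union>\<V> = {y \<in> topspace X. p y \<in> U}"
       "pairwise disjnt \<V>"
       "\<forall>V\<in>\<V>. openin X V \<and> homeomorphic_map (subtopology X V) (subtopology Y U) p"
      by (rule covers_sheets[OF cov])
    obtain V1 where V1: "V1 \<in> \<V>" "s1 a \<in> V1" using U s1a by blast
    obtain V2 where V2: "V2 \<in> \<V>" "s2 a \<in> V2" using U s2a eq[OF a] by (metis (mono_tags, lifting) UnionE mem_Collect_eq)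
    have inj: "inj_on p V" if "V \<in> \<V>" for V using U(5) that inj_on_sheet by metis
    let ?T = "{z \<in> S. s1 z \<in> V1} \<inter> {z \<in> S. s2 z \<in> V2}"
    have "openin (top_of_set S) {z \<in> S. s1 z \<in> V1}" "openin (top_of_set S) {z \<in> S. s2 z \<in> V2}"
      using openin_continuous_map_preimage[OF s1, of V1] openin_continuous_map_preimage[OF s2, of V2] 
        U(5) V1 V2 by auto
    then have "openin (top_of_set S) ?T" by blast
    then obtain T where T: "open T" "?T = S \<inter> T" by (auto simp: openin_open)
    have "a \<in> T" using T a V1 V2 by blast
    moreover have "(s1 a = s2 a) = (s1 b = s2 b)" if "b \<in> T" "b \<in> S" for b
    proof -
      have b: "s1 b \<in> V1" "s2 b \<in> V2" using that T by blast+
      show ?thesis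
      proof (cases "V1 = V2")
        case True
        then show ?thesis using inj[OF V1(1)] V1 V2 b eq[OF a] eq[OF \<open>b \<in> S\<close>] by (metis inj_onD)
      next
        case False
        then have "V1 \<inter> V2 = {}" using U(4) V1(1) V2(1) by (meson disjnt_def pairwiseD)
        then show ?thesis using b V1 V2 by auto
      qed
    qed
    ultimately show "\<forall>\<^sub>F b in at a within S. (s1 a = s2 a) = (s1 b = s2 b)"
      using T(1) by (auto simp: eventually_at_topological)
  qed
  from connected_local_const[OF S z0(1) z this] z0(2) show ?thesis by simp
qed

text \<open>Both the base point \<open>z0\<close> and the point \<open>y0\<close> above it range
  over everything possible. This is what makes gluing work: a lift on one piece can be continued
  into the next piece from whatever value it has reached on the overlap.\<close>

definition liftable :: "'a topology \<Rightarrow> ('a \<Rightarrow> 'b) \<Rightarrow> ('z::topological_space \<Rightarrow> 'b) \<Rightarrow> 'z set \<Rightarrow> bool"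
  where "liftable X p h S \<longleftrightarrow>
    (\<forall>z0\<in>S. \<forall>y0\<in>topspace X. p y0 = h z0 \<longrightarrow>
       (\<exists>s. continuous_map (top_of_set S) X s \<and> (\<forall>z\<in>S. p (s z) = h z) \<and> s z0 = y0))"

lemma liftable_subset:
  assumes "liftable X p h S" and "T \<subseteq> S"
  shows "liftable X p h T"
  unfolding liftable_def
proof (intro ballI impI)
  fix z0 y0 assume "z0 \<in> T" "y0 \<in> topspace X" "p y0 = h z0"
  then obtain s where "continuous_map (top_of_set S) X s" "\<forall>z\<in>S. p (s z) = h z" "s z0 = y0"
    using assms unfolding liftable_def by blast
  then show "\<exists>s. continuous_map (top_of_set T) X s \<and> (\<forall>z\<in>T. p (s z) = h z) \<and> s z0 = y0"
    using assms(2) continuous_map_from_subtopology_mono by blast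
qed

text \<open>The lift on \<open>S\<close> prescribes the starting value of a lift on \<open>T\<close>
  at a point of the overlap; uniqueness on the connected overlap makes the two agree there, and
  closedness of the pieces makes the glued map continuous.\<close>

lemma liftable_Un_aux:
  assumes cov: "covers X Y p" and ST: "closed S" "closed T" "connected (S \<inter> T)" "S \<inter> T \<noteq> {}"
    and S: "liftable X p h S" and T: "liftable X p h T"
    and z0: "z0 \<in> S" "y0 \<in> topspace X" "p y0 = h z0"
  shows "\<exists>s. continuous_map (top_of_set (S \<union> T)) X s \<and> (\<forall>z\<in>S \<union> T. p (s z) = h z) \<and> s z0 = y0"
proof -
  obtain s where s: "continuous_map (top_of_set S) X s" "\<forall>z\<in>S. p (s z) = h z" "s z0 = y0"
    using S z0 unfolding liftable_def by blast
  obtain w where w: "w \<in> S" "w \<in> T" using ST by blast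
  have "s w \<in> topspace X" using s w by (auto simp: continuous_map_def)
  then obtain s' where s': "continuous_map (top_of_set T) X s'" "\<forall>z\<in>T. p (s' z) = h z" "s' w = s w"
    using T w s(2) unfolding liftable_def by metis
  have "continuous_map (top_of_set (S \<inter> T)) X s" "continuous_map (top_of_set (S \<inter> T)) X s'"
    by (rule continuous_map_from_subtopology_mono[OF s(1)], simp)
       (rule continuous_map_from_subtopology_mono[OF s'(1)], simp)
  then have agree: "s z = s' z" if "z \<in> S \<inter> T" for z
    by (rule covers_lift_unique[OF cov ST(3), where ?z0.0 = w]) (use s s' w that in auto)
  define r where "r z = (if z \<in> S then s z else s' z)" for z
  have rS: "r z = s z" if "z \<in> S" for z using that by (simp add: r_def)
  have rT: "r z = s' z" if "z \<in> T" for z using that agree by (auto simp: r_def)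
  have "continuous_map (top_of_set (S \<union> T)) X r"
    unfolding continuous_map_closedin
  proof (intro conjI allI impI)
    show "r \<in> topspace (top_of_set (S \<union> T)) \<rightarrow> topspace X" using s(1) s'(1) rS rT 
      by (auto simp: continuous_map_def)
  next
    fix C assume C: "closedin X C"
    have "closedin (top_of_set S) {z \<in> S. s z \<in> C}" "closedin (top_of_set T) {z \<in> T. s' z \<in> C}"
      using closedin_continuous_map_preimage[OF s(1) C] closedin_continuous_map_preimage[OF s'(1) C] by auto
    then have "closed {z \<in> S. s z \<in> C}" "closed {z \<in> T. s' z \<in> C}"
      using ST closedin_closed_trans by blast+
    then have "closed ({z \<in> S. s z \<in> C} \<union> {z \<in> T. s' z \<in> C})" by blast
    moreover have "{z \<in> S. s z \<in> C} \<union> {z \<in> T. s' z \<in> C} = {z \<in> S \<union> T. r z \<in> C}"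
      using rS rT by auto
    ultimately show "closedin (top_of_set (S \<union> T)) {z \<in> topspace (top_of_set (S \<union> T)). r z \<in> C}"
      by (auto intro!: closed_subset)
  qed
  moreover have "\<forall>z\<in>S \<union> T. p (r z) = h z" using rS rT s s' by auto
  moreover have "r z0 = y0" using rS z0 s by auto
  ultimately show ?thesis by blast
qed

lemma liftable_Un:
  assumes "covers X Y p" and "closed S" "closed T" "connected (S \<inter> T)" "S \<inter> T \<noteq> {}"
    and "liftable X p h S" and "liftable X p h T"
  shows "liftable X p h (S \<union> T)"
  unfolding liftable_def
proof (intro ballI impI)
  fix z0 y0 assume z0: "z0 \<in> S \<union> T" "y0 \<in> topspace X" "p y0 = h z0"
  show "\<exists>s. continuous_map (top_of_set (S \<union> T)) X s \<and> (\<forall>z\<in>S \<union> T. p (s z) = h z) \<and> s z0 = y0"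
  proof (cases "z0 \<in> S")
    case True
    then show ?thesis using liftable_Un_aux[OF assms True z0(2,3)] by simp
  next
    case False
    then have "z0 \<in> T" using z0 by blast
    from liftable_Un_aux[OF assms(1,3,2) _ _ assms(7,6) this z0(2,3)] assms(4,5)
    show ?thesis by (simp add: Int_commute Un_commute)
  qed
qed

text \<open>The lift is \<open>h\<close> followed by the inverse of \<open>p\<close> on the sheet
  that contains the prescribed point.\<close>

lemma liftable_evenly_covered:
  assumes h: "continuous_map (top_of_set S) Y h" "h ` S \<subseteq> U"
    and U: "openin Y U" "\<Union>\<V> = {y \<in> topspace X. p y \<in> U}"
    and V: "\<forall>V\<in>\<V>. openin X V \<and> homeomorphic_map (subtopology X V) (subtopology Y U) p"
  shows "liftable X p h S"
  unfolding liftable_def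
proof (intro ballI impI)
  fix z0 y0 assume z0: "z0 \<in> S" "y0 \<in> topspace X" "p y0 = h z0"
  then have "y0 \<in> \<Union>\<V>" using U h by auto
  then obtain V where W: "V \<in> \<V>" "y0 \<in> V" by blast
  have oV: "openin X V" and hV: "homeomorphic_map (subtopology X V) (subtopology Y U) p" using V W by auto
  have VX: "V \<subseteq> topspace X" and UY: "U \<subseteq> topspace Y" using oV U by (simp_all add: openin_subset)
  obtain j where j: "homeomorphic_maps (subtopology X V) (subtopology Y U) p j"
    using hV homeomorphic_map_maps by blast
  have cj: "continuous_map (subtopology Y U) (subtopology X V) j" 
    and pj: "\<And>u. u \<in> U \<Longrightarrow> p (j u) = u" and jp: "\<And>v. v \<in> V \<Longrightarrow> j (p v) = v"
    using j UY VX by (auto simp: homeomorphic_maps_def)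
  have "continuous_map (top_of_set S) (subtopology Y U) h" 
    using h by (auto simp: continuous_map_in_subtopology)
  then have "continuous_map (top_of_set S) X (j \<circ> h)"
    using cj continuous_map_compose continuous_map_in_subtopology by metis
  then show "\<exists>s. continuous_map (top_of_set S) X s \<and> (\<forall>z\<in>S. p (s z) = h z) \<and> s z0 = y0"
    using pj h(2) jp[OF W(2)] z0 by (intro exI[of _ "j \<circ> h"]) auto
qed

text \<open>
  The disjunct \<open>interior I = {}\<close> makes liftability operative, so that it passes from the boxes of a
  sufficiently fine tagged division to the whole box.
\<close>

lemma liftable_operative:
  fixes h :: "'z::euclidean_space \<Rightarrow> 'b"
  assumes cov: "covers X Y p"
  shows "operative (\<and>) True (\<lambda>I. interior I = {} \<or> liftable X p h I)"
proof (intro operative.intro operative_axioms.intro comm_monoid_set_and)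
  fix a b :: 'z assume "box a b = {}"
  then show "(interior (cbox a b) = {} \<or> liftable X p h (cbox a b)) = True" 
    by (simp add: interior_cbox)
next
  fix a b k :: 'z and c :: real assume k: "k \<in> Basis"
  let ?B = "cbox a b" let ?L = "?B \<inter> {x. x \<bullet> k \<le> c}" let ?R = "?B \<inter> {x. x \<bullet> k \<ge> c}"
  let ?g = "\<lambda>I. interior I = {} \<or> liftable X p h I"
  have LR: "?L \<union> ?R = ?B" by auto
  have cl: "closed ?L" "closed ?R"
    by (auto intro!: closed_Int closed_halfspace_component_le closed_halfspace_component_ge)
  have ci: "closure (interior ?B) = ?B" if "interior ?B \<noteq> {}"
    using that convex_closure_interior[of ?B] by simp
  \<comment> \<open>A half without interior satisfies the predicate for trivial reasons, so the
    other half must then be the whole box. Otherwise a point strictly beyond the cutting hyperplane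
    would be, by \<open>ci\<close>, a limit of interior points of the box, and some of these would
    be interior to the thin half.\<close>
  have Lempty: "?R = ?B" if i: "interior ?B \<noteq> {}" "interior ?L = {}"
  proof (rule ccontr)
    assume "?R \<noteq> ?B"
    then obtain z where z: "z \<in> ?B" "z \<bullet> k < c" by force
    have "open {x. x \<bullet> k < c}" by (simp add: open_halfspace_component_lt)
    moreover have "z \<in> closure (interior ?B)" using ci i z by simp
    ultimately have "{x. x \<bullet> k < c} \<inter> interior ?B \<noteq> {}"
      using z(2) by (metis (mono_tags, lifting) disjoint_iff mem_Collect_eq open_Int_closure_eq_empty)
    moreover have "{x. x \<bullet> k < c} \<inter> interior ?B \<subseteq> interior ?L"
      using interior_subset[of ?B] by (intro interior_maximal) (auto simp: open_halfspace_component_lt open_Int)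
    ultimately show False using i by blast
  qed
  have Rempty: "?L = ?B" if i: "interior ?B \<noteq> {}" "interior ?R = {}"
  proof (rule ccontr)
    assume "?L \<noteq> ?B"
    then obtain z where z: "z \<in> ?B" "z \<bullet> k > c" by force
    have "open {x. x \<bullet> k > c}" by (simp add: open_halfspace_component_gt)
    moreover have "z \<in> closure (interior ?B)" using ci i z by simp
    ultimately have "{x. x \<bullet> k > c} \<inter> interior ?B \<noteq> {}"
      using z(2) by (metis (mono_tags, lifting) disjoint_iff mem_Collect_eq open_Int_closure_eq_empty)
    moreover have "{x. x \<bullet> k > c} \<inter> interior ?B \<subseteq> interior ?R"
      using interior_subset[of ?B] by (intro interior_maximal) (auto simp: open_halfspace_component_gt open_Int)
    ultimately show False using i by blast
  qed
  show "?g ?B = (?g ?L \<and> ?g ?R)"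
  proof (cases "interior ?B = {}")
    case True
    then have "interior ?L = {}" "interior ?R = {}" by (simp_all add: interior_Int)
    with True show ?thesis by simp
  next
    case False
    show ?thesis
    proof
      assume "?g ?B"
      then have "liftable X p h ?B" using False by simp
      then show "?g ?L \<and> ?g ?R" using liftable_subset by blast
    next
      assume g: "?g ?L \<and> ?g ?R"
      show "?g ?B"
      proof (cases "interior ?L = {} \<or> interior ?R = {}")
        case True
        then show ?thesis using Lempty Rempty False g by metis
      next
        case i: False
        then have lift: "liftable X p h ?L" "liftable X p h ?R" using g by auto
        obtain x y where "x \<in> ?L" "y \<in> ?R" using i interior_subset by blast
        \<comment> \<open>The intermediate value theorem makes the slice between the two halves
          non-empty. Being convex, it is also connected, as gluing requires.\<close>
        then have "\<exists>z\<in>?B. k \<bullet> z = c"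
          by (intro connected_ivt_hyperplane[of ?B x y]) (auto simp: inner_commute intro: convex_connected)
        then have "?L \<inter> ?R \<noteq> {}" by (auto simp: inner_commute)
        moreover have "connected (?L \<inter> ?R)"
          by (intro convex_connected convex_Int convex_box)
             (auto simp: convex_halfspace_le convex_halfspace_ge inner_commute[of _ k])
        ultimately show ?thesis using liftable_Un[OF cov cl _ _ lift] LR by simp
      qed
    qed
  qed
qed

text \<open>A Lebesgue number argument in gauge form: the preimages of evenly covered sets are open
  sets on which lifting is possible, one around each point, so they form a gauge, and compactness of
  the box is contained in the existence of a fine tagged division.\<close>

lemma liftable_cbox:
  fixes h :: "'z::euclidean_space \<Rightarrow> 'b"
  assumes cov: "covers X Y p" and h: "continuous_map euclidean Y h"
    and ne: "box a b \<noteq> {}"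
  shows "liftable X p h (cbox a b)"
proof -
  let ?g = "\<lambda>I. interior I = {} \<or> liftable X p h I"
  have "\<exists>T. open T \<and> z \<in> T \<and> liftable X p h T" for z
  proof -
    have "h z \<in> topspace Y" using h by (auto simp: continuous_map_def)
    then obtain U \<V> where U: "openin Y U" "h z \<in> U" "\<Union>\<V> = {y \<in> topspace X. p y \<in> U}"
       "pairwise disjnt \<V>"
       "\<forall>V\<in>\<V>. openin X V \<and> homeomorphic_map (subtopology X V) (subtopology Y U) p"
      by (rule covers_sheets[OF cov])
    have "open {z. h z \<in> U}" using openin_continuous_map_preimage[OF h U(1)] by simp
    moreover have "liftable X p h {z. h z \<in> U}"
      using U h by (intro liftable_evenly_covered[OF _ _ U(1,3,5)]) (auto intro: continuous_map_from_subtopology)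
    ultimately show ?thesis using U by blast
  qed
  then obtain T where T: "\<And>z. open (T z)" "\<And>z. z \<in> T z" "\<And>z. liftable X p h (T z)" by metis
  then have "gauge T" by (simp add: gauge_def)
  then obtain d where d: "d tagged_division_of cbox a b" "T fine d" using fine_division_exists by blast
  have "?g l" if "(x, l) \<in> d" for x l
    using that d(2) T(3) liftable_subset unfolding fine_def by blast
  then have all: "\<forall>y\<in>d. case y of (x, l) \<Rightarrow> ?g l" by blast
  have fold: "comm_monoid_set.F (\<and>) True P A" if "finite A" "\<forall>y\<in>A. P y" for P and A :: "('z \<times> 'z set) set"
    using that by (induction A) (auto simp: comm_monoid_set.empty[OF comm_monoid_set_and] comm_monoid_set.insert[OF comm_monoid_set_and])
  have "comm_monoid_set.F (\<and>) True (\<lambda>(_, l). ?g l) d"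
    using fold[OF tagged_division_of_finite[OF d(1)] all] .
  then have "?g (cbox a b)" using operative.tagged_division[OF liftable_operative[OF cov] d(1)] by metis
  then show ?thesis using ne by (simp add: interior_cbox)
qed

text \<open>Lifts on an increasing sequence of boxes that exhausts the space agree where they
  overlap, since all of them take the value \<open>y0\<close> at the origin.\<close>

theorem covers_lift:
  fixes h :: "'z::euclidean_space \<Rightarrow> 'b"
  assumes cov: "covers X Y p" and h: "continuous_map euclidean Y h"
    and y0: "y0 \<in> topspace X" "p y0 = h 0"
  obtains s where "continuous_map euclidean X s" "\<And>z. p (s z) = h z" "s 0 = y0"
proof -
  define B where "B n = cbox (- (real (Suc n)) *\<^sub>R (One::'z)) (real (Suc n) *\<^sub>R One)" for n
  have zB: "0 \<in> B n" for n by (auto simp: B_def mem_box)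
  have "liftable X p h (B n)" for n
    unfolding B_def by (rule liftable_cbox[OF cov h]) (auto simp: box_ne_empty)
  then have "\<exists>s. continuous_map (top_of_set (B n)) X s \<and> (\<forall>z\<in>B n. p (s z) = h z) \<and> s 0 = y0" for n
    using y0 zB unfolding liftable_def by blast
  then obtain s where s: "\<And>n. continuous_map (top_of_set (B n)) X (s n)" 
      "\<And>n z. z \<in> B n \<Longrightarrow> p (s n z) = h z" "\<And>n. s n 0 = y0"
    by metis
  have mono: "B m \<subseteq> B n" if "m \<le> n" for m n
    using that unfolding B_def by (intro subset_box_imp) (simp add: inner_Basis)
  have agree1: "s m z = s n z" if "z \<in> B m" "m \<le> n" for m n z
  proof (rule covers_lift_unique[OF cov, of "B m" "s m" "s n" 0])
    show "connected (B m)" by (simp add: B_def convex_connected)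
    show "continuous_map (top_of_set (B m)) X (s n)"
      by (rule continuous_map_from_subtopology_mono[OF s(1) mono[OF that(2)]])
    show "p (s m w) = p (s n w)" if "w \<in> B m" for w
      using s(2) mono[OF \<open>m \<le> n\<close>] that by (metis subsetD)
  qed (use s(1) s(3) zB that(1) in simp_all)
  have agree: "s m z = s n z" if "z \<in> B m" "z \<in> B n" for m n z
    using agree1 that by (metis linear)
  define k where "k z = nat \<lceil>norm z\<rceil>" for z :: 'z
  have inB: "z \<in> B n" if "norm z \<le> real (Suc n)" for z n
  proof -
    have "\<bar>z \<bullet> i\<bar> \<le> real (Suc n)" if "i \<in> Basis" for i
      using Basis_le_norm[OF that, of z] \<open>norm z \<le> real (Suc n)\<close> by linarith
    then show ?thesis unfolding B_def mem_box by (force simp: abs_le_iff)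
  qed
  have kB: "z \<in> B (k z)" for z using inB[of z "k z"] unfolding k_def by linarith
  define r where "r z = s (k z) z" for z
  have rs: "r z = s n z" if "z \<in> B n" for z n unfolding r_def by (rule agree[OF kB that])
  have "continuous_map euclidean X r"
    unfolding continuous_map_def
  proof (intro conjI allI impI)
    show "r \<in> topspace euclidean \<rightarrow> topspace X"
      using s(1) kB by (fastforce simp: continuous_map_def r_def)
    fix U assume U: "openin X U"
    have "\<exists>T. open T \<and> z \<in> T \<and> T \<subseteq> {z. r z \<in> U}" if "r z \<in> U" for z
    proof -
      let ?n = "k z"
      have "openin (top_of_set (B ?n)) {w \<in> B ?n. s ?n w \<in> U}"
        using openin_continuous_map_preimage[OF s(1) U] by simp
      then obtain T where T: "open T" "{w \<in> B ?n. s ?n w \<in> U} = B ?n \<inter> T" by (auto simp: openin_open)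
      \<comment> \<open>The half side \<open>Suc n\<close> of \<open>B n\<close> leaves room around
        \<open>z\<close>: a whole ball about the origin containing \<open>z\<close> lies in
        \<open>B (k z)\<close>, and there \<open>r\<close> coincides with the single continuous map
        \<open>s (k z)\<close>, although \<open>k\<close> itself jumps.\<close>
      have z: "z \<in> ball 0 (real (Suc ?n))" unfolding k_def by simp linarith
      have "ball 0 (real (Suc ?n)) \<subseteq> B ?n" using inB by auto
      have "r w \<in> U" if "w \<in> B ?n \<inter> T" for w
        using that rs[of w] unfolding T(2)[symmetric] by (metis (lifting) mem_Collect_eq)
      then have "ball 0 (real (Suc ?n)) \<inter> T \<subseteq> {z. r z \<in> U}"
        using \<open>ball 0 (real (Suc ?n)) \<subseteq> B ?n\<close> by blast
      moreover have "z \<in> B ?n \<inter> T" unfolding T(2)[symmetric] using that kB by (simp add: r_def)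
      then have "z \<in> T" by blast
      ultimately show ?thesis using z T(1) by (metis IntI open_Int open_ball)
    qed
    then have "open {z. r z \<in> U}" by (subst open_subopen) auto
    then show "openin euclidean {z \<in> topspace euclidean. r z \<in> U}" by simp
  qed
  moreover have "p (r z) = h z" for z using s(2)[OF kB] by (simp add: r_def)
  moreover have "r 0 = y0" by (simp add: r_def s)
  ultimately show ?thesis using that by blast
qed

lemma covers_lift_open_map:
  fixes h :: "'z::topological_space \<Rightarrow> 'b"
  assumes cov: "covers X Y p" and h: "open_map euclidean Y h"
    and s: "continuous_map euclidean X s" "\<And>z. p (s z) = h z"
  shows "open_map euclidean X s"
  unfolding open_map_def
proof (intro allI impI)
  fix O' :: "'z set" assume "openin euclidean O'"
  then have O': "open O'" by simp
  have cp: "continuous_map X Y p" using cov by (simp add: covers_def)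
  show "openin X (s ` O')"
  proof (subst openin_subopen, intro ballI)
    fix y assume "y \<in> s ` O'"
    then obtain z where z: "z \<in> O'" "y = s z" by blast
    have y: "y \<in> topspace X" using continuous_map_funspace[OF s(1)] z by auto
    then have "p y \<in> topspace Y" using continuous_map_funspace[OF cp] by blast
    then obtain U \<V> where U: "openin Y U" "p y \<in> U" "\<Union>\<V> = {y \<in> topspace X. p y \<in> U}"
       "pairwise disjnt \<V>"
       "\<forall>V\<in>\<V>. openin X V \<and> homeomorphic_map (subtopology X V) (subtopology Y U) p"
      by (rule covers_sheets[OF cov])
    obtain V where V: "V \<in> \<V>" "y \<in> V" using U(2,3) y by blast
    have oV: "openin X V" using U V by blast
    have inj: "inj_on p V" using U(5) V(1) inj_on_sheet by metis
    define W where "W = O' \<inter> {w. s w \<in> V}"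
    have "open {w. s w \<in> V}" using openin_continuous_map_preimage[OF s(1) oV] by simp
    then have "open W" using O' unfolding W_def by (rule open_Int[rotated])
    then have "openin Y (h ` W)" using h by (simp add: open_map_def)
    then have "openin X (V \<inter> {x \<in> topspace X. p x \<in> h ` W})"
      by (intro openin_Int oV openin_continuous_map_preimage[OF cp])
    moreover have "y \<in> V \<inter> {x \<in> topspace X. p x \<in> h ` W}" using V(2) y z s(2)[of z] by (auto simp: W_def intro!: image_eqI[of _ _ z])
    moreover have "V \<inter> {x \<in> topspace X. p x \<in> h ` W} \<subseteq> s ` O'"
    proof
      fix x assume x: "x \<in> V \<inter> {x \<in> topspace X. p x \<in> h ` W}"
      then obtain w where w: "w \<in> W" "p x = h w" by blast
      then have "p (s w) = p x" "s w \<in> V" using s(2) by (auto simp: W_def)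
      then have "s w = x" using inj_onD[OF inj] x by blast
      then show "x \<in> s ` O'" using w by (auto simp: W_def)
    qed
    ultimately show "\<exists>T. openin X T \<and> y \<in> T \<and> T \<subseteq> s ` O'" by blast
  qed
qed

section \<open>The matrix and its invariant planes\<close>

lemma vector_4:
  "(vector [a, b, c, d] :: 'a::zero^4) $ 1 = a"
  "(vector [a, b, c, d] :: 'a::zero^4) $ 2 = b"
  "(vector [a, b, c, d] :: 'a::zero^4) $ 3 = c"
  "(vector [a, b, c, d] :: 'a::zero^4) $ 4 = d"
  by (simp_all add: vector_def)

definition matAZ_inv :: "int^4^4"
  where "matAZ_inv = vector [vector [2, 1, 0, 0],
                            vector [0, 0, 1, 0],
                            vector [2, 0, 0, 1],
                            vector [-1, 0, 0, 0]]"

lemma invertible_matAZ: "invertible matAZ"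
  unfolding invertible_def
  by (rule exI[of _ matAZ_inv])
     (simp add: vec_eq_iff forall_4 matrix_matrix_mult_def mat_def sum_4 matAZ_def matAZ_inv_def vector_4)

lemma is_companion_matAZ: "is_companion_matrix matAZ [:1, -2, 0, -2, 1:]"
proof -
  have *: "(\<forall>i<4. P i) \<longleftrightarrow> P 0 \<and> P 1 \<and> P 2 \<and> P (3::nat)" for P
    by (auto simp: numeral_eq_Suc less_Suc_eq)
  show ?thesis
    unfolding is_companion_matrix_def * by (simp add: matAZ_def vector_4 numeral_eq_Suc)
qed

lemma matA_nth:
  "(matA *v x) $ 1 = - x $ 4"
  "(matA *v x) $ 2 = x $ 1 + 2 * x $ 4"
  "(matA *v x) $ 3 = x $ 2"
  "(matA *v x) $ 4 = x $ 3 + 2 * x $ 4"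
  by (simp_all add: matA_def map_matrix_def matAZ_def matrix_vector_mult_def sum_4 vector_4)

lemmas vec4_eq_iff = vec_eq_iff[where 'b = 4, unfolded forall_4]

text \<open>The action of \<open>matAZ_inv\<close> on real vectors. Its integer coefficients are
  what makes negative powers preserve the lattice.\<close>

definition Ainv :: "real^4 \<Rightarrow> real^4"
  where "Ainv x = vector [x $ 2 + 2 * x $ 1, x $ 3, x $ 4 + 2 * x $ 1, - x $ 1]"

lemma A_Ainv [simp]: "matA *v Ainv x = x" and Ainv_A [simp]: "Ainv (matA *v x) = x"
  by (simp_all add: vec4_eq_iff matA_nth Ainv_def vector_4)

lemma linear_Ainv: "linear Ainv"
  by (rule linearI) (simp_all add: Ainv_def vec4_eq_iff vector_4 algebra_simps)

text \<open>The kernel is a plane, so two of the four component equations carry all the information: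
  the first gives \<open>x $ 3\<close> and the fourth then gives \<open>x $ 2\<close>, in terms of
  \<open>x $ 1\<close> and \<open>x $ 4\<close>.\<close>

lemma planeH_iff: "x \<in> planeH \<longleftrightarrow> x $ 2 = x $ 4 - (sqrt 3 + 1) * x $ 1 \<and> x $ 3 = x $ 1 - (sqrt 3 + 1) * x $ 4"
  (is "_ \<longleftrightarrow> ?R")
proof -
  have s: "sqrt 3 * sqrt 3 = 3" "sqrt 3 * (sqrt 3 * y) = 3 * y" for y by (simp_all flip: mult.assoc)
  have "x \<in> planeH \<longleftrightarrow> matA *v (matA *v x) + (sqrt 3 - 1) *\<^sub>R (matA *v x) + x = 0"
    by (simp add: planeH_def matrix_vector_mult_add_rdistrib flip: matrix_vector_mul_assoc scaleR_matrix_vector_assoc)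
  also have "\<dots> \<longleftrightarrow> ?R" (is "?L \<longleftrightarrow> _")
  proof
    assume L: ?L
    have 1: "x $ 3 = x $ 1 - (sqrt 3 + 1) * x $ 4" 
      using arg_cong[OF L, of "\<lambda>v. v $ 1"] by (simp add: matA_nth algebra_simps)
    have "x $ 2 = - (sqrt 3 + 1) * x $ 3 - (2 * sqrt 3 + 3) * x $ 4"
      using arg_cong[OF L, of "\<lambda>v. v $ 4"] by (simp add: matA_nth algebra_simps)
    then show ?R using 1 by (simp add: algebra_simps s)
  next
    assume ?R
    then have e: "x $ 2 = x $ 4 - (sqrt 3 + 1) * x $ 1" "x $ 3 = x $ 1 - (sqrt 3 + 1) * x $ 4" by auto
    show ?L by (simp add: vec4_eq_iff matA_nth e) (simp add: algebra_simps s)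
  qed
  finally show ?thesis .
qed

text \<open>Replacing \<open>sqrt 3\<close> by \<open>- sqrt 3\<close> exchanges the two quadratic
  factors, so this is the Galois conjugate of \<open>planeH_iff\<close>.\<close>

lemma planeE_iff: "x \<in> planeE \<longleftrightarrow> x $ 2 = x $ 4 - (1 - sqrt 3) * x $ 1 \<and> x $ 3 = x $ 1 - (1 - sqrt 3) * x $ 4"
  (is "_ \<longleftrightarrow> ?R")
proof -
  have s: "sqrt 3 * sqrt 3 = 3" "sqrt 3 * (sqrt 3 * y) = 3 * y" for y by (simp_all flip: mult.assoc)
  have "x \<in> planeE \<longleftrightarrow> matA *v (matA *v x) - (sqrt 3 + 1) *\<^sub>R (matA *v x) + x = 0"
    by (simp add: planeE_def matrix_vector_mult_add_rdistrib matrix_vector_mult_diff_rdistrib flip: matrix_vector_mul_assoc scaleR_matrix_vector_assoc)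
  also have "\<dots> \<longleftrightarrow> ?R" (is "?L \<longleftrightarrow> _")
  proof
    assume L: ?L
    have 1: "x $ 3 = x $ 1 - (1 - sqrt 3) * x $ 4" 
      using arg_cong[OF L, of "\<lambda>v. v $ 1"] by (simp add: matA_nth algebra_simps)
    have "x $ 2 = - (1 - sqrt 3) * x $ 3 - (3 - 2 * sqrt 3) * x $ 4"
      using arg_cong[OF L, of "\<lambda>v. v $ 4"] by (simp add: matA_nth algebra_simps)
    then show ?R using 1 by (simp add: algebra_simps s)
  next
    assume ?R
    then have e: "x $ 2 = x $ 4 - (1 - sqrt 3) * x $ 1" "x $ 3 = x $ 1 - (1 - sqrt 3) * x $ 4" by auto
    show ?L by (simp add: vec4_eq_iff matA_nth e) (simp add: algebra_simps s)
  qed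
  finally show ?thesis .
qed

lemma subspace_planeH: "subspace planeH" and subspace_planeE: "subspace planeE"
  unfolding planeH_def planeE_def by (rule linear_subspace_kernel[OF matrix_vector_mul_linear])+

definition hvec :: "real \<Rightarrow> real \<Rightarrow> real^4"
  where "hvec a b = vector [a, b - (sqrt 3 + 1) * a, a - (sqrt 3 + 1) * b, b]"

lemma planeH_eq: "x \<in> planeH \<longleftrightarrow> x = hvec (x $ 1) (x $ 4)"
  by (simp add: planeH_iff hvec_def vec4_eq_iff vector_4)

lemma hvec_in_planeH [simp]: "hvec a b \<in> planeH"
  by (simp add: planeH_iff hvec_def vector_4)

lemma dim_planeH: "dim planeH = 2"
proof -
  let ?B = "{hvec 1 0, hvec 0 1}"
  have ne: "hvec 1 0 \<noteq> hvec 0 1" by (simp add: hvec_def vec4_eq_iff vector_4)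
  have lin: "x = a *\<^sub>R hvec 1 0 + b *\<^sub>R hvec 0 1" if "x = hvec a b" for x a b
    using that by (simp add: hvec_def vec4_eq_iff vector_4 algebra_simps)
  have "independent ?B"
  proof (rule independent_insertI)
    show "hvec 1 0 \<notin> span {hvec 0 1}"
      by (auto simp: span_singleton hvec_def vec4_eq_iff vector_4)
    show "independent {hvec 0 1}" by (simp add: hvec_def vec4_eq_iff vector_4)
  qed
  moreover have "planeH \<subseteq> span ?B"
  proof
    fix x assume "x \<in> planeH"
    then have "x = (x $ 1) *\<^sub>R hvec 1 0 + (x $ 4) *\<^sub>R hvec 0 1" by (intro lin) (simp only: planeH_eq)
    also have "\<dots> \<in> span ?B" by (intro span_add span_scale span_base) auto
    finally show "x \<in> span ?B" .
  qed
  ultimately show ?thesis using ne dim_unique[of ?B planeH 2] by simp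
qed

lemma planeH_inter_planeE: "planeH \<inter> planeE = {0}"
proof -
  have "x = 0" if "x \<in> planeH" "x \<in> planeE" for x
  proof -
    have "sqrt 3 * x $ 1 = 0" "sqrt 3 * x $ 4 = 0"
      using that unfolding planeH_iff planeE_iff by (auto simp: algebra_simps)
    then show ?thesis using that unfolding planeH_iff by (simp add: vec4_eq_iff)
  qed
  moreover have "0 \<in> planeH" "0 \<in> planeE" by (simp_all add: planeH_iff planeE_iff)
  ultimately show ?thesis by auto
qed

text \<open>
  The two linear forms that vanish on \<open>planeE\<close> take the values \<open>2 * sqrt 3 * a\<close> and \<open>2 * sqrt 3 * b\<close> at
  \<open>hvec a b\<close>.
\<close>

definition projH :: "real^4 \<Rightarrow> real^4"
  where "projH x = hvec (((x $ 4 - (1 - sqrt 3) * x $ 1) - x $ 2) / (2 * sqrt 3)) (((x $ 1 - (1 - sqrt 3) * x $ 4) - x $ 3) / (2 * sqrt 3))"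

lemma projH_in_planeH [simp]: "projH x \<in> planeH"
  by (simp add: projH_def)

lemma minus_projH_in_planeE [simp]: "x - projH x \<in> planeE"
proof -
  have s: "sqrt 3 * sqrt 3 = 3" "sqrt 3 * (sqrt 3 * y) = 3 * y" for y by (simp_all flip: mult.assoc)
  show ?thesis
    by (simp add: planeE_iff projH_def hvec_def vector_4 field_simps s)
qed

text \<open>The difference of two candidates lies in both planes. Linearity of \<open>projH\<close>
  and its commuting with the matrix are drawn from this characterisation, which spares computations
  with the explicit formula.\<close>

lemma projH_unique:
  assumes "h \<in> planeH" "x - h \<in> planeE"
  shows "h = projH x"
proof -
  have "(x - projH x) - (x - h) \<in> planeE"
    by (intro subspace_diff[OF subspace_planeE] assms minus_projH_in_planeE)
  moreover have "h - projH x \<in> planeH"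
    by (intro subspace_diff[OF subspace_planeH] assms projH_in_planeH)
  ultimately have "h - projH x \<in> planeH \<inter> planeE" by simp
  then show ?thesis using planeH_inter_planeE by simp
qed

lemma planeH_plus_planeE: "{h + e |h e. h \<in> planeH \<and> e \<in> planeE} = UNIV"
proof -
  have "\<exists>h e. x = h + e \<and> h \<in> planeH \<and> e \<in> planeE" for x
    by (rule exI[of _ "projH x"], rule exI[of _ "x - projH x"]) simp
  then show ?thesis by auto
qed

lemma linear_projH: "linear projH"
proof (rule linearI)
  show "projH (x + y) = projH x + projH y" for x y
  proof (rule projH_unique[symmetric])
    have "(x - projH x) + (y - projH y) \<in> planeE" by (intro subspace_add[OF subspace_planeE] minus_projH_in_planeE)
    then show "x + y - (projH x + projH y) \<in> planeE" by (simp add: algebra_simps)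
  qed (intro subspace_add[OF subspace_planeH] projH_in_planeH)
  show "projH (c *\<^sub>R x) = c *\<^sub>R projH x" for c x
  proof (rule projH_unique[symmetric])
    have "c *\<^sub>R (x - projH x) \<in> planeE" by (intro subspace_scale[OF subspace_planeE] minus_projH_in_planeE)
    then show "c *\<^sub>R x - c *\<^sub>R projH x \<in> planeE" by (simp add: algebra_simps)
  qed (intro subspace_scale[OF subspace_planeH] projH_in_planeH)
qed

lemma form_oplus_zero_eq: "form_oplus_zero q x = q (projH x)"
proof -
  have "(THE h. h \<in> planeH \<and> x - h \<in> planeE) = projH x"
    by (rule the_equality) (auto intro: projH_unique)
  then show ?thesis by (simp add: form_oplus_zero_def)
qed

lemma A_planeH: "h \<in> planeH \<Longrightarrow> matA *v h \<in> planeH" and A_planeE: "e \<in> planeE \<Longrightarrow> matA *v e \<in> planeE"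
proof -
  have s: "sqrt 3 * sqrt 3 = 3" "sqrt 3 * (sqrt 3 * y) = 3 * y" for y by (simp_all flip: mult.assoc)
  show "matA *v h \<in> planeH" if "h \<in> planeH"
  proof -
    have e: "h $ 2 = h $ 4 - (sqrt 3 + 1) * h $ 1" "h $ 3 = h $ 1 - (sqrt 3 + 1) * h $ 4"
      using that by (auto simp: planeH_iff)
    show ?thesis unfolding planeH_iff matA_nth e by (simp add: algebra_simps s)
  qed
  show "matA *v e \<in> planeE" if "e \<in> planeE"
  proof -
    have e: "e $ 2 = e $ 4 - (1 - sqrt 3) * e $ 1" "e $ 3 = e $ 1 - (1 - sqrt 3) * e $ 4"
      using that by (auto simp: planeE_iff)
    show ?thesis unfolding planeE_iff matA_nth e by (simp add: algebra_simps s)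
  qed
qed

lemma projH_A: "projH (matA *v x) = matA *v projH x"
proof (rule projH_unique[symmetric])
  have "matA *v (x - projH x) \<in> planeE" by (intro A_planeE minus_projH_in_planeE)
  then show "matA *v x - matA *v projH x \<in> planeE" by (simp add: matrix_vector_mult_diff_distrib)
qed (intro A_planeH projH_in_planeH)

lemma ex_invariant_form: "\<exists>q. invariant_form q"
proof -
  \<comment> \<open>In the coordinates \<open>(x $ 1, x $ 4)\<close> of \<open>planeH\<close> the matrix acts as \<open>(u, v) \<mapsto> (- v, u - c * v)\<close>,
    which preserves \<open>u\<^sup>2 - c * u * v + v\<^sup>2\<close>.\<close>
  define c where "c = sqrt 3 - 1"
  define b where "b x y = x $ 1 * y $ 1 - c / 2 * (x $ 1 * y $ 4 + x $ 4 * y $ 1) + x $ 4 * y $ 4" for x y :: "real^4"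
  define q where "q x = b x x" for x
  have c: "0 < c" "c < 2" using real_sqrt_less_mono[of 1 3] real_sqrt_less_mono[of 3 9] by (auto simp: c_def)
  have cc: "c * c = 2 - 2 * c" by (simp add: c_def algebra_simps)
  have "bilinear b" unfolding bilinear_def b_def by (auto intro!: linearI simp: field_simps)
  then have "quadratic_form_on planeH q"
    unfolding quadratic_form_on_def q_def by (intro exI[of _ b]) (auto simp: b_def algebra_simps)
  moreover have "0 < q h" if "h \<in> planeH" "h \<noteq> 0" for h
  proof -
    \<comment> \<open>Completing the square. Positivity of the remaining coefficient is the
      condition \<open>c < 2\<close> (as \<open>c > 0\<close>), which says that the eigenvalues on
      \<open>planeH\<close> are not real.\<close>
    have q: "q h = (h $ 1 - c / 2 * h $ 4)\<^sup>2 + (1 - c\<^sup>2 / 4) * (h $ 4)\<^sup>2"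
      by (simp add: q_def b_def power2_eq_square algebra_simps)
    have c2: "1 - c\<^sup>2 / 4 > 0" using c power_strict_mono[of c 2 2] by simp
    show ?thesis
    proof (cases "h $ 4 = 0")
      case True
      then have "h $ 1 \<noteq> 0" using that by (auto simp: planeH_iff vec4_eq_iff)
      then show ?thesis using q True by simp
    next
      case False
      then have "(1 - c\<^sup>2 / 4) * (h $ 4)\<^sup>2 > 0" using c2 by simp
      then show ?thesis using q zero_le_power2[of "h $ 1 - c / 2 * h $ 4"] by linarith
    qed
  qed
  moreover have "q (matA *v h) = q h" if "h \<in> planeH" for h
  proof -
    have "h $ 3 = h $ 1 - (c + 2) * h $ 4" using that by (simp add: planeH_iff c_def)
    then have "(matA *v h) $ 4 = h $ 1 - c * h $ 4" by (simp add: matA_nth algebra_simps)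
    then show ?thesis unfolding q_def b_def matA_nth(1) by (simp only:) (simp add: field_simps)
  qed
  ultimately show ?thesis unfolding invariant_form_def by blast
qed

section \<open>The group and its quotient\<close>

definition Zlat :: "(real^4) set"
  where "Zlat = {n. \<forall>i. n $ i \<in> \<int>}"

lemma Zlat_simps [simp]:
  "0 \<in> Zlat" "n \<in> Zlat \<Longrightarrow> - n \<in> Zlat"
  "m \<in> Zlat \<Longrightarrow> n \<in> Zlat \<Longrightarrow> m + n \<in> Zlat"
  "m \<in> Zlat \<Longrightarrow> n \<in> Zlat \<Longrightarrow> m - n \<in> Zlat"
  by (auto simp: Zlat_def)

text \<open>Powers with an integer exponent, as plain functions, so that the exponent can be
  identified with the shift in the \<open>t\<close>-direction.\<close>

definition Apow :: "int \<Rightarrow> real^4 \<Rightarrow> real^4"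
  where "Apow k = (if 0 \<le> k then ((*v) matA) ^^ nat k else Ainv ^^ nat (- k))"

lemma Apow_0 [simp]: "Apow 0 x = x"
  by (simp add: Apow_def)

lemma Apow_succ: "Apow (k + 1) x = matA *v Apow k x"
proof (cases "0 \<le> k")
  case True
  then have "nat (k + 1) = Suc (nat k)" by simp
  then show ?thesis using True by (simp add: Apow_def)
next
  case False
  then have "nat (- k) = Suc (nat (- (k + 1)))" by simp
  then show ?thesis using False by (cases "k = -1") (auto simp: Apow_def)
qed

lemma Apow_pred: "Apow (k - 1) x = Ainv (Apow k x)"
  using Apow_succ[of "k - 1" x] by simp

lemma Apow_1 [simp]: "Apow 1 x = matA *v x"
  using Apow_succ[of 0 x] by simp

lemma Apow_add: "Apow (k + l) x = Apow k (Apow l x)"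
proof (induction k rule: int_induct[of _ 0])
  case (step1 i)
  then show ?case using Apow_succ[of "i + l" x] by (simp add: Apow_succ add.assoc add.commute[of 1])
next
  case (step2 i)
  then show ?case using Apow_pred[of "i + l" x] by (simp add: Apow_pred algebra_simps)
qed simp

lemma Apow_minus [simp]: "Apow k (Apow (- k) x) = x" "Apow (- k) (Apow k x) = x"
  using Apow_add[of k "- k" x] Apow_add[of "- k" k x] by simp_all

lemma linear_Apow: "linear (Apow k)"
proof (induction k rule: int_induct[of _ 0])
  case base
  then show ?case by (simp add: linear_iff)
next
  case (step1 i)
  then show ?case using linear_compose[OF step1(2) matrix_vector_mul_linear[of matA]]
    by (simp add: Apow_succ[abs_def] comp_def)
next
  case (step2 i)
  then show ?case using linear_compose[OF step2(2) linear_Ainv]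
    by (simp add: Apow_pred[abs_def] comp_def)
qed

lemma Apow_Zlat: "n \<in> Zlat \<Longrightarrow> Apow k n \<in> Zlat"
proof (induction k rule: int_induct[of _ 0])
  case (step1 i)
  then show ?case by (simp add: Apow_succ Zlat_def forall_4 matA_nth)
next
  case (step2 i)
  then show ?case by (simp add: Apow_pred Zlat_def forall_4 Ainv_def vector_4)
qed simp

text \<open>The normal form of a group element: a power of the monodromy followed by a translation
  of the \<real>-vector part. \<open>act_act\<close> is the multiplication of the semidirect product
  of the translations by the integers.\<close>

definition act :: "int \<Rightarrow> real^4 \<Rightarrow> (real^4) \<times> real \<Rightarrow> (real^4) \<times> real"
  where "act k n p = (Apow k (fst p) + n, snd p + real_of_int k)"

lemma act_0 [simp]: "act 0 0 p = p"
  by (simp add: act_def)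

lemma act_act: "act k n (act l m p) = act (k + l) (n + Apow k m) p"
  by (simp add: act_def Apow_add linear_add[OF linear_Apow])

lemma act_inverse: "act k n (act (- k) (- Apow (- k) n) p) = p" "act (- k) (- Apow (- k) n) (act k n p) = p"
  by (simp_all add: act_def linear_add[OF linear_Apow] linear_diff[OF linear_Apow])

lemma act_Bij: "act k n \<in> Bij UNIV"
  unfolding Bij_def by (auto intro!: bij_betw_byWitness[where f' = "act (- k) (- Apow (- k) n)"] simp: act_inverse extensional_def)

lemma BijGroup_UNIV:
  "f \<in> Bij UNIV \<Longrightarrow> g \<in> Bij UNIV \<Longrightarrow> f \<otimes>\<^bsub>BijGroup UNIV\<^esub> g = f \<circ> g"
  "f \<in> Bij UNIV \<Longrightarrow> inv\<^bsub>BijGroup UNIV\<^esub> f = inv_into UNIV f"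
  by (simp add: BijGroup_def compose_def fun_eq_iff) (simp add: inv_BijGroup restrict_def)

lemma inv_act: "inv_into UNIV (act k n) = act (- k) (- Apow (- k) n)"
  by (rule inv_equality) (simp_all add: act_inverse)

text \<open>The maps in normal form contain the generators and are closed under composition and
  inverses. Conversely, \<open>act k n\<close> is the translation \<open>act 0 n\<close> after a
  power of the monodromy generator, hence a product of generators and their inverses.\<close>

lemma \<Gamma>_eq: "\<Gamma> = {act k n |k n. n \<in> Zlat}"
proof -
  let ?G = "BijGroup (UNIV :: ((real^4) \<times> real) set)" let ?S = "{act k n |k n. n \<in> Zlat}"
  interpret group ?G by (rule group_BijGroup)
  define gens where "gens = {(\<lambda>(x, t). (x + n, t)) |n. \<forall>i. n $ i \<in> \<int>} \<union> {\<lambda>(x :: real^4, t :: real). (matA *v x, t + 1)}"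
  have t: "(\<lambda>(x, t). (x + n, t)) = act 0 n" for n by (auto simp: act_def fun_eq_iff)
  have s: "(\<lambda>(x :: real^4, t :: real). (matA *v x, t + 1)) = act 1 0" by (auto simp: act_def fun_eq_iff)
  have gens: "gens = {act 0 n |n. n \<in> Zlat} \<union> {act 1 0}"
    unfolding gens_def s t by (simp add: Zlat_def)
  have G: "\<Gamma> = generate ?G gens" unfolding \<Gamma>_def gens_def ..
  have carr: "carrier ?G = Bij UNIV" by (simp add: BijGroup_def)
  have sub: "subgroup ?S ?G"
  proof (rule subgroupI)
    show "?S \<subseteq> carrier ?G" using act_Bij carr by auto
    show "?S \<noteq> {}" using Zlat_simps(1) by blast
    fix a assume "a \<in> ?S"
    then obtain k n where a: "a = act k n" "n \<in> Zlat" by blast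
    then show "inv\<^bsub>?G\<^esub> a \<in> ?S" by (simp add: BijGroup_UNIV act_Bij inv_act) (use a Apow_Zlat in \<open>blast intro: Zlat_simps(2)\<close>)
    fix b assume "b \<in> ?S"
    then obtain l m where b: "b = act l m" "m \<in> Zlat" by blast
    have "a \<circ> b = act (k + l) (n + Apow k m)" by (simp add: fun_eq_iff a b act_act)
    then show "a \<otimes>\<^bsub>?G\<^esub> b \<in> ?S" using a b
      by (simp add: BijGroup_UNIV act_Bij) (blast intro: Zlat_simps(3) Apow_Zlat)
  qed
  have "gens \<subseteq> carrier ?G" using gens act_Bij carr by auto
  then have sg: "subgroup \<Gamma> ?G" unfolding G by (rule generate_is_subgroup)
  have "\<Gamma> \<subseteq> ?S" unfolding G
    by (rule generate_subgroup_incl[OF _ sub]) (use gens Zlat_simps(1) in blast)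
  moreover have "?S \<subseteq> \<Gamma>"
  proof
    have mult: "f \<circ> g \<in> \<Gamma>" if "f \<in> \<Gamma>" "g \<in> \<Gamma>" for f g
      using subgroup.m_closed[OF sg that] subgroup.mem_carrier[OF sg] that by (simp add: BijGroup_UNIV carr)
    have inc: "g \<in> \<Gamma>" if "g \<in> gens" for g using that unfolding G by (rule generate.incl)
    have 1: "act 1 0 \<in> \<Gamma>" using inc gens by blast
    have m1: "act (- 1) 0 \<in> \<Gamma>" using subgroup.m_inv_closed[OF sg 1] 
      by (simp add: BijGroup_UNIV act_Bij inv_act linear_0[OF linear_Apow])
    have k: "act k 0 \<in> \<Gamma>" for k
    proof (induction k rule: int_induct[of _ 0])
      case base
      then show ?case using inc gens Zlat_simps(1) by blast
    next
      case (step1 i)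
      have "act (i + 1) 0 = act 1 0 \<circ> act i 0" by (simp add: fun_eq_iff act_act add.commute)
      then show ?case using mult[OF 1 step1(2)] by (simp only:)
    next
      case (step2 i)
      have "act (i - 1) 0 = act (- 1) 0 \<circ> act i 0" by (simp add: fun_eq_iff act_act linear_0[OF linear_Apow])
      then show ?case using mult[OF m1 step2(2)] by (simp only:)
    qed
    fix g assume "g \<in> ?S"
    then obtain k' n where g: "g = act k' n" "n \<in> Zlat" by blast
    have "g = act 0 n \<circ> act k' 0" by (simp add: g fun_eq_iff act_act)
    moreover have "act 0 n \<in> \<Gamma>" using inc gens g by blast
    ultimately show "g \<in> \<Gamma>" using mult k by (simp only:)
  qed
  ultimately show ?thesis by (rule equalityI)
qed

lemma act_in_\<Gamma>: "n \<in> Zlat \<Longrightarrow> act k n \<in> \<Gamma>"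
  by (auto simp: \<Gamma>_eq)

lemma \<Gamma>_cases:
  assumes "\<gamma> \<in> \<Gamma>"
  obtains k n where "\<gamma> = act k n" "n \<in> Zlat"
  using assms by (auto simp: \<Gamma>_eq)

lemma \<Gamma>_id: "(\<lambda>p. p) \<in> \<Gamma>"
  using act_in_\<Gamma>[of 0 0] by (simp add: act_def[abs_def])

lemma \<Gamma>_comp: "\<gamma> \<in> \<Gamma> \<Longrightarrow> \<delta> \<in> \<Gamma> \<Longrightarrow> (\<lambda>p. \<gamma> (\<delta> p)) \<in> \<Gamma>"
  by (auto elim!: \<Gamma>_cases simp: act_act intro!: act_in_\<Gamma> Zlat_simps(3) Apow_Zlat)

lemma \<Gamma>_inverse:
  assumes "\<gamma> \<in> \<Gamma>"
  obtains \<delta> where "\<delta> \<in> \<Gamma>" "\<And>p. \<gamma> (\<delta> p) = p" "\<And>p. \<delta> (\<gamma> p) = p"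
proof -
  obtain k n where "\<gamma> = act k n" "n \<in> Zlat" using assms by (rule \<Gamma>_cases)
  then show ?thesis using that[of "act (- k) (- Apow (- k) n)"]
    by (simp add: act_inverse act_in_\<Gamma> Apow_Zlat)
qed

lemma continuous_on_act: "continuous_on S (act k n)"
proof -
  have "continuous_on UNIV (Apow k)"
    using linear_Apow linear_conv_bounded_linear linear_continuous_on by blast
  then have "continuous_on S (\<lambda>p. Apow k (fst p))"
    by (rule continuous_on_compose2) (auto intro: continuous_intros)
  then show ?thesis unfolding act_def[abs_def] by (intro continuous_intros)
qed

lemma continuous_on_\<Gamma>: "\<gamma> \<in> \<Gamma> \<Longrightarrow> continuous_on S \<gamma>"
  by (auto elim!: \<Gamma>_cases intro: continuous_on_act)

lemma open_vimage_\<Gamma>: "\<gamma> \<in> \<Gamma> \<Longrightarrow> open V \<Longrightarrow> open {p. \<gamma> p \<in> V}"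
  using open_vimage[OF _ continuous_on_\<Gamma>] by (auto simp: vimage_def)

lemma orb_\<Gamma>: "\<gamma> \<in> \<Gamma> \<Longrightarrow> orb \<Gamma> (\<gamma> p) = orb \<Gamma> p"
proof -
  assume g: "\<gamma> \<in> \<Gamma>"
  then obtain \<delta> where d: "\<delta> \<in> \<Gamma>" "\<And>p. \<delta> (\<gamma> p) = p" using \<Gamma>_inverse by metis
  have "\<exists>\<sigma>'\<in>\<Gamma>. \<sigma> p = \<sigma>' (\<gamma> p)" if "\<sigma> \<in> \<Gamma>" for \<sigma>
    using \<Gamma>_comp[OF that d(1)] d(2) by (intro bexI[of _ "\<lambda>p. \<sigma> (\<delta> p)"]) simp_all
  moreover have "\<exists>\<sigma>'\<in>\<Gamma>. \<sigma> (\<gamma> p) = \<sigma>' p" if "\<sigma> \<in> \<Gamma>" for \<sigma>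
    using \<Gamma>_comp[OF that g] by (intro bexI[of _ "\<lambda>p. \<sigma> (\<gamma> p)"]) simp_all
  ultimately show ?thesis unfolding orb_def by (intro equalityI subsetI) (simp add: image_iff; metis)+
qed

lemma orb_eqD: "orb \<Gamma> p = orb \<Gamma> p' \<Longrightarrow> \<exists>\<gamma>\<in>\<Gamma>. p' = \<gamma> p"
proof -
  assume eq: "orb \<Gamma> p = orb \<Gamma> p'"
  have "p' \<in> orb \<Gamma> p'" unfolding orb_def using \<Gamma>_id by (rule rev_image_eqI) simp
  then show ?thesis unfolding eq[symmetric] by (auto simp: orb_def)
qed

lemma Zlat_eq_0:
  assumes "n \<in> Zlat" "norm n < 1"
  shows "n = 0"
proof -
  have "n $ i = 0" for i
  proof -
    have "\<bar>n $ i\<bar> < 1" using component_le_norm_cart[of n i] assms by linarith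
    moreover have "n $ i \<in> \<int>" using assms by (simp add: Zlat_def)
    ultimately show ?thesis by (simp add: Ints_nonzero_abs_less1)
  qed
  then show ?thesis by (simp add: vec_eq_iff)
qed

text \<open>A uniform form of discreteness: a displacement below 1 forces first the integer
  \<open>k\<close> and then the lattice vector to vanish. It yields freeness, and injectivity of the
  projection on all balls of radius 1/2.\<close>

lemma \<Gamma>_small_displacement:
  assumes "\<gamma> \<in> \<Gamma>" "dist p (\<gamma> p) < 1"
  shows "\<gamma> = (\<lambda>p. p)"
proof -
  obtain k n where g: "\<gamma> = act k n" "n \<in> Zlat" using assms(1) by (rule \<Gamma>_cases)
  have "dist (snd p) (snd (\<gamma> p)) < 1" using assms dist_snd_le[of p "\<gamma> p"] by linarith
  then have "\<bar>real_of_int k\<bar> < 1" by (simp add: g act_def dist_real_def)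
  then have k: "k = 0" by linarith
  have "dist (fst p) (fst (\<gamma> p)) < 1" using assms dist_fst_le[of p "\<gamma> p"] by linarith
  then have "norm n < 1" by (simp add: g act_def k dist_norm)
  then have "n = 0" using Zlat_eq_0 g by blast
  then show ?thesis using g k by (simp add: act_def[abs_def])
qed

lemma \<Gamma>_free: "\<gamma> \<in> \<Gamma> \<Longrightarrow> \<gamma> p = p \<Longrightarrow> \<gamma> = (\<lambda>p. p)"
  by (rule \<Gamma>_small_displacement[of _ p]) simp_all

lemma acts_freely_\<Gamma>: "acts_freely (mtop Mt) \<Gamma>"
  unfolding acts_freely_def using \<Gamma>_free by blast

lemma finite_Zlat_ball: "finite {n \<in> Zlat. norm n \<le> c}"
proof -
  define Z where "Z = real_of_int ` {- \<lceil>c\<rceil>..\<lceil>c\<rceil>}"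
  have Z: "n $ i \<in> Z" if n: "n \<in> Zlat" "norm n \<le> c" for n i
  proof -
    obtain m where m: "n $ i = of_int m" using n by (auto simp: Zlat_def elim: Ints_cases)
    have "\<bar>n $ i\<bar> \<le> c" using component_le_norm_cart[of n i] n by linarith
    then have "- \<lceil>c\<rceil> \<le> m" "m \<le> \<lceil>c\<rceil>" unfolding m by linarith+
    then show ?thesis unfolding Z_def m by simp
  qed
  have "{n \<in> Zlat. norm n \<le> c} \<subseteq> (\<lambda>(a, b, c, d). vector [a, b, c, d]) ` (Z \<times> Z \<times> Z \<times> Z)"
  proof
    fix n assume "n \<in> {n \<in> Zlat. norm n \<le> c}"
    then have "n $ i \<in> Z" for i using Z by simp
    moreover have "n = (\<lambda>(a, b, c, d). vector [a, b, c, d]) (n $ 1, n $ 2, n $ 3, n $ 4)"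
      by (simp add: vec4_eq_iff vector_4)
    ultimately show "n \<in> (\<lambda>(a, b, c, d). vector [a, b, c, d]) ` (Z \<times> Z \<times> Z \<times> Z)" by blast
  qed
  moreover have "finite Z" by (simp add: Z_def)
  ultimately show ?thesis by (meson finite_SigmaI finite_imageI finite_subset)
qed

text \<open>The \<open>t\<close>-coordinate bounds \<open>k\<close> by twice the radius of
  \<open>K\<close>, and for each such \<open>k\<close> the operator norm of the power bounds the
  lattice vector.\<close>

lemma finite_\<Gamma>_compact:
  assumes "compact K"
  shows "finite {\<gamma> \<in> \<Gamma>. \<gamma> ` K \<inter> K \<noteq> {}}"
proof -
  obtain R where R: "\<And>p. p \<in> K \<Longrightarrow> norm p \<le> R"
    using compact_imp_bounded[OF assms] by (auto simp: bounded_iff)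
  define N where "N k = {n \<in> Zlat. norm n \<le> R + onorm (Apow k) * R}" for k
  have "{\<gamma> \<in> \<Gamma>. \<gamma> ` K \<inter> K \<noteq> {}} \<subseteq> (\<Union>k\<in>{- \<lceil>2 * R\<rceil>..\<lceil>2 * R\<rceil>}. act k ` N k)"
  proof
    fix \<gamma> assume "\<gamma> \<in> {\<gamma> \<in> \<Gamma>. \<gamma> ` K \<inter> K \<noteq> {}}"
    then obtain p where p: "\<gamma> \<in> \<Gamma>" "p \<in> K" "\<gamma> p \<in> K" by blast
    obtain k n where g: "\<gamma> = act k n" "n \<in> Zlat" using p(1) by (rule \<Gamma>_cases)
    have "\<bar>snd p\<bar> \<le> R" "\<bar>snd (\<gamma> p)\<bar> \<le> R" "norm (fst p) \<le> R" "norm (fst (\<gamma> p)) \<le> R"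
      using R[OF p(2)] R[OF p(3)] norm_snd_le[of "snd p" "fst p"] norm_snd_le[of "snd (\<gamma> p)" "fst (\<gamma> p)"]
        norm_fst_le[of "fst p" "snd p"] norm_fst_le[of "fst (\<gamma> p)" "snd (\<gamma> p)"] by simp_all
    note b = this
    have "- \<lceil>2 * R\<rceil> \<le> k" "k \<le> \<lceil>2 * R\<rceil>" using b(1,2) unfolding g act_def snd_conv by linarith+
    moreover have "norm n \<le> R + onorm (Apow k) * R"
    proof -
      have bl: "bounded_linear (Apow k)" using linear_Apow linear_conv_bounded_linear by blast
      have "n = fst (\<gamma> p) - Apow k (fst p)" by (simp add: g act_def)
      then have "norm n \<le> norm (fst (\<gamma> p)) + norm (Apow k (fst p))" using norm_triangle_ineq4 by metis
      also have "norm (Apow k (fst p)) \<le> onorm (Apow k) * norm (fst p)" by (rule onorm[OF bl])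
      also have "\<dots> \<le> onorm (Apow k) * R" by (rule mult_left_mono[OF b(3) onorm_pos_le[OF bl]])
      finally show ?thesis using b(4) by simp
    qed
    ultimately show "\<gamma> \<in> (\<Union>k\<in>{- \<lceil>2 * R\<rceil>..\<lceil>2 * R\<rceil>}. act k ` N k)" using g by (auto simp: N_def)
  qed
  moreover have "finite \<dots>" unfolding N_def by (auto intro: finite_Zlat_ball)
  ultimately show ?thesis by (rule finite_subset)
qed

lemma properly_discontinuous_\<Gamma>: "properly_discontinuous (mtop Mt) \<Gamma>"
  unfolding properly_discontinuous_def using finite_\<Gamma>_compact by (simp add: Mt_def)

definition fundK :: "((real^4) \<times> real) set"
  where "fundK = cbox 0 1 \<times> {0..1}"

lemma compact_fundK: "compact fundK"
  unfolding fundK_def by (intro compact_Times compact_cbox compact_Icc)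

text \<open>The coordinate \<open>t\<close> has to be reduced before the others, because the shift
  that does so also applies a power of the matrix, whereas the lattice translation used afterwards
  leaves \<open>t\<close> alone.\<close>

lemma \<Gamma>_fundK: "\<exists>\<gamma>\<in>\<Gamma>. \<exists>p'\<in>fundK. p = \<gamma> p'"
proof -
  define k where "k = \<lfloor>snd p\<rfloor>"
  define y where "y = Apow (- k) (fst p)"
  define m :: "real^4" where "m = (\<chi> i. of_int \<lfloor>y $ i\<rfloor>)"
  have m: "m \<in> Zlat" by (simp add: m_def Zlat_def)
  have "y - m \<in> cbox 0 1" by (simp add: mem_box_cart m_def) linarith
  moreover have "snd p - k \<in> {0..1}" unfolding k_def by simp linarith
  ultimately have "(y - m, snd p - k) \<in> fundK" by (simp add: fundK_def)
  moreover have "p = act k (Apow k m) (y - m, snd p - k)"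
    by (simp add: act_def y_def linear_diff[OF linear_Apow])
  ultimately show ?thesis using act_in_\<Gamma>[OF Apow_Zlat[OF m]] by blast
qed

lemma cocompact_\<Gamma>: "cocompact (mtop Mt) \<Gamma>"
  unfolding cocompact_def
proof (intro exI conjI)
  show "compactin (mtop Mt) fundK" by (simp add: Mt_def compact_fundK)
  show "(\<Union>\<gamma>\<in>\<Gamma>. \<gamma> ` fundK) = mcarrier Mt" using \<Gamma>_fundK by (fastforce simp: Mt_def)
qed

section \<open>The topology of the orbit space\<close>

lemma openin_quotient_mfd:
  "openin (mtop (quotient_mfd X G)) W \<longleftrightarrow>
     W \<subseteq> orb G ` mcarrier X \<and> openin (mtop X) {x \<in> mcarrier X. orb G x \<in> W}"
proof -
  let ?P = "\<lambda>W. W \<subseteq> orb G ` mcarrier X \<and> openin (mtop X) {x \<in> mcarrier X. orb G x \<in> W}"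
  \<comment> \<open>The abstraction function \<open>topology\<close> gives back the family of open
    sets only after this check.\<close>
  have "istopology ?P"
    unfolding istopology_def
  proof (intro conjI allI impI)
    fix S T assume "?P S" "?P T"
    moreover have "{x \<in> mcarrier X. orb G x \<in> S \<inter> T} = 
      {x \<in> mcarrier X. orb G x \<in> S} \<inter> {x \<in> mcarrier X. orb G x \<in> T}" by auto
    ultimately show "S \<inter> T \<subseteq> orb G ` mcarrier X" "openin (mtop X) {x \<in> mcarrier X. orb G x \<in> S \<inter> T}" 
      by (auto simp: openin_Int)
  next
    fix K assume K: "\<forall>S\<in>K. ?P S"
    then show "\<Union>K \<subseteq> orb G ` mcarrier X" by blast
    have "{x \<in> mcarrier X. orb G x \<in> \<Union>K} = (\<Union>S\<in>K. {x \<in> mcarrier X. orb G x \<in> S})" by auto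
    then show "openin (mtop X) {x \<in> mcarrier X. orb G x \<in> \<Union>K}" using K by auto
  qed
  then show ?thesis by (simp add: quotient_mfd_def topology_inverse')
qed

lemma topspace_quotient_mfd: "mcarrier (quotient_mfd X G) = orb G ` mcarrier X"
proof
  show "mcarrier (quotient_mfd X G) \<subseteq> orb G ` mcarrier X"
    using openin_topspace[of "mtop (quotient_mfd X G)"] unfolding openin_quotient_mfd by blast
  have "{x \<in> mcarrier X. orb G x \<in> orb G ` mcarrier X} = mcarrier X" by auto
  then have "openin (mtop (quotient_mfd X G)) (orb G ` mcarrier X)" by (simp add: openin_quotient_mfd)
  then show "orb G ` mcarrier X \<subseteq> mcarrier (quotient_mfd X G)" by (rule openin_subset)
qed

lemma continuous_map_orb: "continuous_map (mtop X) (mtop (quotient_mfd X G)) (orb G)"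
  by (auto simp: continuous_map_def topspace_quotient_mfd openin_quotient_mfd)

lemma topspace_Mt [simp]: "mcarrier Mt = UNIV" by (simp add: Mt_def)

lemma topspace_Mquot: "mcarrier Mquot = range (orb \<Gamma>)"
  by (simp add: Mquot_def topspace_quotient_mfd)

lemma openin_Mquot: "openin (mtop Mquot) W \<longleftrightarrow> W \<subseteq> range (orb \<Gamma>) \<and> open {p. orb \<Gamma> p \<in> W}"
  by (simp add: Mquot_def openin_quotient_mfd Mt_def)

lemma continuous_map_orb_\<Gamma>: "continuous_map euclidean (mtop Mquot) (orb \<Gamma>)"
  using continuous_map_orb[of Mt \<Gamma>] by (simp add: Mquot_def Mt_def)

text \<open>The saturation of \<open>V\<close> is the union of its preimages under the group
  elements, all of them homeomorphisms.\<close>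

lemma openin_orb_image: "open V \<Longrightarrow> openin (mtop Mquot) (orb \<Gamma> ` V)"
proof -
  assume V: "open V"
  have "{p. orb \<Gamma> p \<in> orb \<Gamma> ` V} = (\<Union>\<gamma>\<in>\<Gamma>. {p. \<gamma> p \<in> V})"
    using orb_\<Gamma> by (auto dest!: orb_eqD) (metis imageI)
  then show ?thesis using V by (auto simp: openin_Mquot intro!: open_vimage_\<Gamma>)
qed

lemma open_map_orb_\<Gamma>: "open_map euclidean (mtop Mquot) (orb \<Gamma>)"
  by (simp add: open_map_def openin_orb_image)

text \<open>Distinct orbits must be separated from all translates at once. Inside unit balls about
  \<open>x\<close> and \<open>y\<close> proper discontinuity leaves a finite set \<open>F\<close> of
  relevant group elements; for each of them \<gamma> x and \<open>y\<close> are separated, and the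
  finitely many neighbourhoods are intersected.\<close>

lemma Hausdorff_Mquot: "Hausdorff_space (mtop Mquot)"
  unfolding Hausdorff_space_def
proof (intro allI impI)
  fix u v assume "u \<in> mcarrier Mquot \<and> v \<in> mcarrier Mquot \<and> u \<noteq> v"
  then obtain x y where xy: "u = orb \<Gamma> x" "v = orb \<Gamma> y" "orb \<Gamma> x \<noteq> orb \<Gamma> y" unfolding topspace_Mquot by blast
  define K where "K = cball x 1 \<union> cball y 1"
  define F where "F = {\<gamma> \<in> \<Gamma>. \<gamma> ` K \<inter> K \<noteq> {}}"
  have fin: "finite F" unfolding F_def K_def by (intro finite_\<Gamma>_compact) auto
  have "\<exists>P Q. open P \<and> open Q \<and> \<gamma> x \<in> P \<and> y \<in> Q \<and> P \<inter> Q = {}" if "\<gamma> \<in> \<Gamma>" for \<gamma>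
  proof -
    have "\<gamma> x \<noteq> y" using orb_\<Gamma>[OF that, of x] xy by auto
    then show ?thesis by (rule hausdorff)
  qed
  then obtain P Q where PQ: "\<And>\<gamma>. \<gamma> \<in> \<Gamma> \<Longrightarrow> open (P \<gamma>) \<and> open (Q \<gamma>) \<and> \<gamma> x \<in> P \<gamma> \<and> y \<in> Q \<gamma> \<and> P \<gamma> \<inter> Q \<gamma> = {}"
    by metis
  define A where "A = ball x 1 \<inter> (\<Inter>\<gamma>\<in>F. {p. \<gamma> p \<in> P \<gamma>})"
  define B where "B = ball y 1 \<inter> (\<Inter>\<gamma>\<in>F. Q \<gamma>)"
  have A: "open A" "x \<in> A"
    unfolding A_def using fin PQ by (auto intro!: open_INT open_vimage_\<Gamma> simp: F_def)
  have B: "open B" "y \<in> B"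
    unfolding B_def using fin PQ by (auto intro!: open_INT simp: F_def)
  have "orb \<Gamma> ` A \<inter> orb \<Gamma> ` B = {}"
  proof (rule ccontr)
    assume "orb \<Gamma> ` A \<inter> orb \<Gamma> ` B \<noteq> {}"
    then obtain a b where ab: "a \<in> A" "b \<in> B" "orb \<Gamma> a = orb \<Gamma> b" by auto
    then obtain \<gamma> where g: "\<gamma> \<in> \<Gamma>" "b = \<gamma> a" using orb_eqD by blast
    have "a \<in> K" "b \<in> K" using ab by (auto simp: A_def B_def K_def)
    then have "\<gamma> \<in> F" using g by (auto simp: F_def)
    then have "\<gamma> a \<in> P \<gamma>" "b \<in> Q \<gamma>" using ab by (auto simp: A_def B_def)
    then show False using PQ[OF g(1)] g(2) by auto
  qed
  then show "\<exists>U V. openin (mtop Mquot) U \<and> openin (mtop Mquot) V \<and> u \<in> U \<and> v \<in> V \<and> disjnt U V"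
    using A B xy openin_orb_image by (intro exI[of _ "orb \<Gamma> ` A"] exI[of _ "orb \<Gamma> ` B"]) (auto simp: disjnt_def)
qed

lemma second_countable_euclidean: "second_countable (euclidean :: 'a::second_countable_topology topology)"
proof -
  obtain B :: "'a set set" where B: "countable B" "topological_basis B" using ex_countable_basis by auto
  have "\<exists>U\<in>B. x \<in> U \<and> U \<subseteq> V" if "open V" "x \<in> V" for x V
    using topological_basisE[OF B(2) that] by metis
  then show ?thesis unfolding second_countable_def using B topological_basis_open by (intro exI[of _ B]) auto
qed

lemma second_countable_Mquot: "second_countable (mtop Mquot)"
  using second_countable_open_map_image[OF continuous_map_orb_\<Gamma> open_map_orb_\<Gamma> _ second_countable_euclidean]
  by (simp add: topspace_Mquot)

lemma compact_Mquot: "compact_space (mtop Mquot)"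
proof -
  have "orb \<Gamma> ` fundK = range (orb \<Gamma>)"
  proof -
    have "orb \<Gamma> p \<in> orb \<Gamma> ` fundK" for p using \<Gamma>_fundK[of p] orb_\<Gamma> by force
    then show ?thesis by blast
  qed
  then show ?thesis using image_compactin[of euclidean fundK, OF _ continuous_map_orb_\<Gamma>] compact_fundK
    by (simp add: compact_space_def topspace_Mquot)
qed

section \<open>Locally affine functions are smooth\<close>

lemma continuous_map_Euclidean_space_proj: "continuous_map (Euclidean_space n) euclideanreal (\<lambda>x. x i)"
  unfolding Euclidean_space_def
  by (rule continuous_map_from_subtopology) (rule continuous_map_product_projection, simp)

lemma continuous_map_affine:
  "continuous_map (Euclidean_space n) euclideanreal (\<lambda>y. c + (\<Sum>i<n. a i * y i))"
  by (intro continuous_intros continuous_map_Euclidean_space_proj) auto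

lemma continuous_map_fun_upd:
  assumes "x \<in> topspace (Euclidean_space n)" "i < n"
  shows "continuous_map euclideanreal (Euclidean_space n) (\<lambda>t. x(i := t))"
proof -
  have "(\<lambda>t. x(i := t)) = (\<lambda>t j. if j < n then (x(i := t)) j else 0)"
    using assms by (auto simp: fun_eq_iff topspace_Euclidean_space)
  moreover have "continuous_map euclideanreal (Euclidean_space n) (\<lambda>t j. if j < n then (x(i := t)) j else 0)"
    unfolding continuous_map_componentwise_Euclidean_space by (auto simp: continuous_map_iff_continuous2)
  ultimately show ?thesis by simp
qed

text \<open>The coefficients may vary from point to point, since a transition map of the quotient
  can be given by different group elements on different pieces of an overlap.\<close>

definition affine_near :: "nat \<Rightarrow> (nat \<Rightarrow> real) set \<Rightarrow> ((nat \<Rightarrow> real) \<Rightarrow> real) \<Rightarrow> bool"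
  where "affine_near n U F \<longleftrightarrow>
    (\<forall>x\<in>U. \<exists>W c a. openin (Euclidean_space n) W \<and> x \<in> W \<and> W \<subseteq> U \<and>
       (\<forall>y\<in>W. F y = c + (\<Sum>i<n. a i * y i)))"

lemma affine_has_partial_deriv:
  assumes W: "openin (Euclidean_space n) W" "x \<in> W" and F: "\<And>y. y \<in> W \<Longrightarrow> F y = c + (\<Sum>i<n. a i * y i)"
    and i: "i < n"
  shows "((\<lambda>t. F (x(i := t))) has_real_derivative a i) (at (x i))"
proof -
  have x: "x \<in> topspace (Euclidean_space n)" using W openin_subset by blast
  \<comment> \<open>The derivative is taken along a coordinate line, so \<open>F\<close> has to be
    affine for all parameters \<open>t\<close> near \<open>x i\<close>; this is where openness of
    \<open>W\<close> enters.\<close>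
  have op: "open {t. x(i := t) \<in> W}"
    using openin_continuous_map_preimage[OF continuous_map_fun_upd[OF x i] W(1)] by simp
  have "((\<lambda>t. a j * (x(i := t)) j) has_real_derivative (if j = i then a i else 0)) (at (x i))" for j
    by (cases "j = i") (auto intro!: derivative_eq_intros)
  then have "((\<lambda>t. c + (\<Sum>j<n. a j * (x(i := t)) j)) has_real_derivative 0 + (\<Sum>j<n. if j = i then a i else 0)) (at (x i))"
    by (intro DERIV_add DERIV_const DERIV_sum)
  then have "((\<lambda>t. c + (\<Sum>j<n. a j * (x(i := t)) j)) has_real_derivative a i) (at (x i))"
    using i by simp
  then show ?thesis
    by (rule has_field_derivative_transform_within_open[OF _ op]) (use W F in auto)
qed

lemma affine_partial_deriv:
  assumes "openin (Euclidean_space n) W" "x \<in> W" and "\<And>y. y \<in> W \<Longrightarrow> F y = c + (\<Sum>i<n. a i * y i)"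
    and "i < n"
  shows "partial_deriv i F x = a i"
  unfolding partial_deriv_def by (rule DERIV_imp_deriv) (rule affine_has_partial_deriv[OF assms])

lemma affine_near_continuous:
  assumes "affine_near n U F"
  shows "continuous_map (subtopology (Euclidean_space n) U) euclideanreal F"
  unfolding continuous_map_def
proof (intro conjI allI impI)
  show "F \<in> topspace (subtopology (Euclidean_space n) U) \<rightarrow> topspace euclideanreal" by simp
  fix V :: "real set" assume "openin euclideanreal V"
  then have V: "open V" by simp
  have "\<exists>T. openin (Euclidean_space n) T \<and> x \<in> T \<and> T \<subseteq> {x \<in> U. F x \<in> V}" if x: "x \<in> U" "F x \<in> V" for x
  proof -
    obtain W c a where W: "openin (Euclidean_space n) W" "x \<in> W" "W \<subseteq> U" 
      "\<And>y. y \<in> W \<Longrightarrow> F y = c + (\<Sum>i<n. a i * y i)"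
      using assms x(1) unfolding affine_near_def by meson
    let ?G = "\<lambda>y. c + (\<Sum>i<n. a i * y i)"
    have "openin (Euclidean_space n) {y \<in> topspace (Euclidean_space n). ?G y \<in> V}"
      by (rule openin_continuous_map_preimage[OF continuous_map_affine]) (simp add: V)
    then have "openin (Euclidean_space n) (W \<inter> {y \<in> topspace (Euclidean_space n). ?G y \<in> V})"
      using W by blast
    moreover have "x \<in> W \<inter> {y \<in> topspace (Euclidean_space n). ?G y \<in> V}"
      using W(2) W(4)[OF W(2)] x(2) openin_subset[OF W(1)] by auto
    moreover have "W \<inter> {y \<in> topspace (Euclidean_space n). ?G y \<in> V} \<subseteq> {x \<in> U. F x \<in> V}"
      using W(3,4) by auto
    ultimately show ?thesis by blast
  qed
  then have op: "openin (Euclidean_space n) {x \<in> U. F x \<in> V}" by (subst openin_subopen) blast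
  have "topspace (subtopology (Euclidean_space n) U) = U"
    using assms openin_subset unfolding affine_near_def by (fastforce simp: topspace_subtopology)
  moreover have "openin (subtopology (Euclidean_space n) U) {x \<in> U. F x \<in> V}"
    unfolding openin_subtopology by (rule exI[of _ "{x \<in> U. F x \<in> V}"]) (use op in blast)
  ultimately show "openin (subtopology (Euclidean_space n) U) {x \<in> topspace (subtopology (Euclidean_space n) U). F x \<in> V}"
    by simp
qed

text \<open>Partial derivatives of a locally affine function are locally constant, hence locally
  affine again, so the class reproduces itself under the recursion of \<open>Ck_on\<close>.\<close>

lemma affine_near_Ck: "affine_near n U F \<Longrightarrow> Ck_on k n U F"
proof (induction k arbitrary: F)
  case 0
  then show ?case by (simp add: affine_near_continuous)
next
  case (Suc k)
  have "(\<forall>x\<in>U. (\<lambda>t. F (x(i := t))) differentiable (at (x i))) \<and> Ck_on k n U (partial_deriv i F)" if i: "i < n" for i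
  proof
    show "\<forall>x\<in>U. (\<lambda>t. F (x(i := t))) differentiable (at (x i))"
    proof
      fix x assume "x \<in> U"
      then obtain W c a where W: "openin (Euclidean_space n) W" "x \<in> W" 
        "\<And>y. y \<in> W \<Longrightarrow> F y = c + (\<Sum>i<n. a i * y i)"
        using Suc.prems unfolding affine_near_def by meson
      show "(\<lambda>t. F (x(i := t))) differentiable (at (x i))"
        using affine_has_partial_deriv[OF W i] real_differentiable_def by blast
    qed
    have "affine_near n U (partial_deriv i F)"
      unfolding affine_near_def
    proof
      fix x assume "x \<in> U"
      then obtain W c a where W: "openin (Euclidean_space n) W" "x \<in> W" "W \<subseteq> U" 
        "\<And>y. y \<in> W \<Longrightarrow> F y = c + (\<Sum>i<n. a i * y i)"
        using Suc.prems unfolding affine_near_def by meson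
      have "\<forall>y\<in>W. partial_deriv i F y = a i + (\<Sum>i<n. 0 * y i)"
        using affine_partial_deriv[OF W(1) _ W(4) i] by simp
      then show "\<exists>W c a. openin (Euclidean_space n) W \<and> x \<in> W \<and> W \<subseteq> U \<and> 
          (\<forall>y\<in>W. partial_deriv i F y = c + (\<Sum>i<n. a i * y i))"
        using W(1-3) by (intro exI[of _ W] exI[of _ "a i"] exI[of _ "\<lambda>_. 0"]) simp
    qed
    then show "Ck_on k n U (partial_deriv i F)" by (rule Suc.IH)
  qed
  then show ?case using Suc.prems by (simp add: affine_near_continuous)
qed

lemma affine_near_smooth: "affine_near n U F \<Longrightarrow> smooth_fun_on n U F"
  by (simp add: smooth_fun_on_def affine_near_Ck)

lemma smooth_fun_on_const:
  assumes "openin (Euclidean_space n) U" and "\<And>y. y \<in> U \<Longrightarrow> F y = c"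
  shows "smooth_fun_on n U F"
proof (rule affine_near_smooth)
  show "affine_near n U F" unfolding affine_near_def
    using assms by (auto intro!: exI[of _ U] exI[of _ c] exI[of _ "\<lambda>_. 0"])
qed

section \<open>The global coordinates of the five-dimensional covering space\<close>

lemma sum_5: "(\<Sum>i<5. f i) = f 0 + f 1 + f 2 + f 3 + f (4::nat)"
  by (simp add: eval_nat_numeral)

lemma less_5_cases: "(i::nat) < 5 \<longleftrightarrow> i = 0 \<or> i = 1 \<or> i = 2 \<or> i = 3 \<or> i = 4"
  by auto

lemma coords_nth [simp]:
  "coords p 0 = fst p $ 1" "coords p (Suc 0) = fst p $ 2" "coords p 2 = fst p $ 3" "coords p 3 = fst p $ 4" "coords p 4 = snd p"
  "5 \<le> i \<Longrightarrow> coords p i = 0"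
  by (simp_all add: coords_def)

definition uncoords :: "(nat \<Rightarrow> real) \<Rightarrow> (real^4) \<times> real"
  where "uncoords y = (vector [y 0, y 1, y 2, y 3], y 4)"

lemma uncoords_coords [simp]: "uncoords (coords p) = p"
  by (simp add: uncoords_def prod_eq_iff vec4_eq_iff vector_4)

lemma coords_uncoords: "y \<in> topspace (Euclidean_space 5) \<Longrightarrow> coords (uncoords y) = y"
proof
  fix i assume y: "y \<in> topspace (Euclidean_space 5)"
  show "coords (uncoords y) i = y i"
  proof (cases "i < 5")
    case True
    then show ?thesis unfolding less_5_cases by (auto simp: uncoords_def vector_4)
  next
    case False
    then show ?thesis using y by (simp add: topspace_Euclidean_space)
  qed
qed

lemma coords_in_topspace [simp]: "coords p \<in> topspace (Euclidean_space 5)"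
  by (simp add: topspace_Euclidean_space)

lemma coord_vector_simps:
  "coord_vector 0 = (axis 1 1, 0)" "coord_vector (Suc 0) = (axis 2 1, 0)" "coord_vector 2 = (axis 3 1, 0)"
  "coord_vector 3 = (axis 4 1, 0)" "coord_vector 4 = (0, 1)"
  by (simp_all add: coord_vector_def)

lemma uncoords_eq_sum: "uncoords y = (\<Sum>i<5. y i *\<^sub>R coord_vector i)"
  unfolding sum_5 by (simp add: coord_vector_simps uncoords_def prod_eq_iff vec4_eq_iff vector_4 axis_def)

lemma eq_sum_coords: "p = (\<Sum>i<5. coords p i *\<^sub>R coord_vector i)"
  using uncoords_eq_sum[of "coords p"] by simp

lemma coords_add: "coords (p + p') i = coords p i + coords p' i" and coords_scaleR: "coords (c *\<^sub>R p) i = c * coords p i"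
  by (simp_all add: coords_def)

lemma coords_sum: "coords (sum f I) i = (\<Sum>j\<in>I. coords (f j) i)"
  by (induction I rule: infinite_finite_induct) (simp_all add: coords_add, simp_all add: coords_def)

lemma coords_coord_vector: "i < 5 \<Longrightarrow> k < 5 \<Longrightarrow> coords (coord_vector i) k = (if i = k then 1 else 0)"
  unfolding less_5_cases by (elim disjE) (simp_all add: coord_vector_simps axis_def)

lemma continuous_map_coords: "continuous_map euclidean (Euclidean_space 5) coords"
proof -
  have c: "continuous_map euclidean euclideanreal (\<lambda>p. coords p i)" for i
  proof (cases "i < 5")
    case True
    then show ?thesis unfolding less_5_cases by (elim disjE) (auto simp: continuous_map_iff_continuous2 intro!: continuous_intros)
  qed (simp add: coords_def)
  have "coords = (\<lambda>p i. if i < 5 then coords p i else 0)" by (auto simp: fun_eq_iff)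
  then show ?thesis using c continuous_map_componentwise_Euclidean_space[of euclidean 5 coords] by metis
qed

lemma continuous_map_uncoords: "continuous_map (Euclidean_space 5) euclidean uncoords"
proof -
  have "continuous_map (Euclidean_space 5) euclideanreal (\<lambda>y. y i)" for i
    by (rule continuous_map_Euclidean_space_proj)
  then have "continuous_on (topspace (Euclidean_space 5)) (\<lambda>y. y i)" for i :: nat
    by (simp add: continuous_map_Euclidean_space_iff)
  then have "continuous_on (topspace (Euclidean_space 5)) uncoords"
    unfolding uncoords_eq_sum[abs_def] by (intro continuous_intros) 
  then show ?thesis by (simp add: continuous_map_Euclidean_space_iff)
qed

lemma openin_coords_image: "open V \<Longrightarrow> openin (Euclidean_space 5) (coords ` V)"
proof -
  assume "open V"
  then have "openin (Euclidean_space 5) {y \<in> topspace (Euclidean_space 5). uncoords y \<in> V}"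
    using openin_continuous_map_preimage[OF continuous_map_uncoords] by simp
  moreover have "{y \<in> topspace (Euclidean_space 5). uncoords y \<in> V} = coords ` V"
    using coords_uncoords by (force simp: image_iff)
  ultimately show ?thesis by simp
qed

lemma open_coords_preimage: "openin (Euclidean_space 5) W \<Longrightarrow> open {p. coords p \<in> W}"
  using openin_continuous_map_preimage[OF continuous_map_coords] by simp

lemma inj_coords: "inj_on coords S"
  by (metis inj_onI uncoords_coords)

section \<open>The metric on the quotient\<close>

text \<open>The differential of \<open>act k n\<close> at every point; it depends on
  \<open>k\<close> alone.\<close>

definition linpart :: "int \<Rightarrow> (real^4) \<times> real \<Rightarrow> (real^4) \<times> real"
  where "linpart k p = (Apow k (fst p), snd p)"

lemma linear_linpart: "linear (linpart k)"
  by (rule linearI) (simp_all add: linpart_def linear_add[OF linear_Apow] linear_scale[OF linear_Apow])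

lemma act_eq_linpart: "act k n p = act k n 0 + linpart k p"
  by (simp add: act_def linpart_def linear_0[OF linear_Apow])

lemma linpart_0 [simp]: "linpart 0 p = p"
  by (simp add: linpart_def)

lemma coords_act:
  "coords (act k n (uncoords y)) m = coords (act k n 0) m + (\<Sum>i<5. coords (linpart k (coord_vector i)) m * y i)"
proof -
  have "linpart k (uncoords y) = (\<Sum>i<5. y i *\<^sub>R linpart k (coord_vector i))"
    unfolding uncoords_eq_sum by (simp add: linear_sum[OF linear_linpart] linear_scale[OF linear_linpart])
  then have "coords (linpart k (uncoords y)) m = (\<Sum>i<5. coords (linpart k (coord_vector i)) m * y i)"
    by (simp add: coords_sum coords_scaleR mult.commute)
  then show ?thesis by (subst act_eq_linpart) (simp add: coords_add)
qed

text \<open>The common pattern of all maps that have to be examined: group elements, the projection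
  to the quotient, and chart changes of the quotient all look near a point like one affine map
  \<open>act k n\<close> in coordinates. Smoothness and pullbacks are settled once from this
  pattern.\<close>

definition act_rep ::
    "'a chart \<Rightarrow> 'b chart \<Rightarrow> ('a \<Rightarrow> 'b) \<Rightarrow> 'a \<Rightarrow> int \<Rightarrow> real^4 \<Rightarrow> bool"
  where "act_rep c d f x k n \<longleftrightarrow>
    (\<exists>W. openin (Euclidean_space 5) W \<and> snd c x \<in> W \<and> W \<subseteq> snd c ` {x \<in> fst c. f x \<in> fst d} \<and>
         (\<forall>y\<in>W. local_rep c d f y = coords (act k n (uncoords y))))"

lemma act_rep_smooth:
  assumes "\<And>x. x \<in> fst c \<Longrightarrow> f x \<in> fst d \<Longrightarrow> \<exists>k n. act_rep c d f x k n"
  shows "smooth_in_charts 5 5 c d f"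
  unfolding smooth_in_charts_def
proof (intro allI impI affine_near_smooth)
  fix m :: nat
  show "affine_near 5 (snd c ` {x \<in> fst c. f x \<in> fst d}) (\<lambda>y. local_rep c d f y m)"
    unfolding affine_near_def
  proof
    fix y assume "y \<in> snd c ` {x \<in> fst c. f x \<in> fst d}"
    then obtain x where x: "y = snd c x" "x \<in> fst c" "f x \<in> fst d" by blast
    obtain k n where "act_rep c d f x k n" using assms[OF x(2,3)] by blast
    then obtain W where W: "openin (Euclidean_space 5) W" "y \<in> W" "W \<subseteq> snd c ` {x \<in> fst c. f x \<in> fst d}"
      "\<forall>y\<in>W. local_rep c d f y = coords (act k n (uncoords y))"
      unfolding act_rep_def x(1) by (elim exE conjE)
    from W(4) have "\<forall>y\<in>W. local_rep c d f y m = coords (act k n 0) m + (\<Sum>i<5. coords (linpart k (coord_vector i)) m * y i)"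
      using coords_act by simp
    with W show "\<exists>W a b. openin (Euclidean_space 5) W \<and> y \<in> W \<and> W \<subseteq> snd c ` {x \<in> fst c. f x \<in> fst d} \<and>
       (\<forall>y\<in>W. local_rep c d f y m = a + (\<Sum>i<5. b i * y i))"
      by (intro exI[of _ W] exI[of _ "coords (act k n 0) m"] exI[of _ "\<lambda>i. coords (linpart k (coord_vector i)) m"] conjI)
  qed
qed

lemma act_rep_pullback:
  assumes "act_rep c d f x k n" and ij: "i < 5" "j < 5"
  shows "pullback_comp 5 c d f g x i j =
    (\<Sum>a<5. \<Sum>b<5. coords (linpart k (coord_vector i)) a * coords (linpart k (coord_vector j)) b * g d (f x) a b)"
proof -
  obtain W where W: "openin (Euclidean_space 5) W" "snd c x \<in> W" 
    "\<And>y. y \<in> W \<Longrightarrow> local_rep c d f y = coords (act k n (uncoords y))"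
    using assms(1) unfolding act_rep_def by blast
  have "partial_deriv i (\<lambda>y. local_rep c d f y a) (snd c x) = coords (linpart k (coord_vector i)) a" if "i < 5" for i a
    by (rule affine_partial_deriv[OF W(1,2) _ that]) (simp add: W(3) coords_act)
  then show ?thesis unfolding pullback_comp_def using ij by simp
qed

definition gB :: "(real^4 \<Rightarrow> real) \<Rightarrow> (real^4) \<times> real \<Rightarrow> (real^4) \<times> real \<Rightarrow> real"
  where "gB q v w = (gt_form q (v + w) - gt_form q v - gt_form q w) / 2"

lemma gt_eq_gB: "gt q c x i j = gB q (coord_vector i) (coord_vector j)"
  by (simp add: gt_def gB_def)

lemma gB_commute: "gB q v w = gB q w v"
  by (simp add: gB_def add.commute)

text \<open>The form \<open>q\<close> is prescribed by a bilinear form only on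
  \<open>planeH\<close>, but \<open>form_oplus_zero\<close> evaluates it only at values of
  \<open>projH\<close>, which lie there.\<close>

lemma invariant_form_bilinear:
  assumes "invariant_form q"
  obtains b where "bilinear b" "\<And>x y. b x y = b y x"
    "\<And>v w. gB q v w = b (projH (fst v)) (projH (fst w)) + snd v * snd w"
    "\<And>v. gt_form q v = b (projH (fst v)) (projH (fst v)) + (snd v)\<^sup>2"
    "\<And>h. h \<in> planeH \<Longrightarrow> h \<noteq> 0 \<Longrightarrow> 0 < b h h"
proof -
  obtain b where b: "bilinear b" "\<And>x y. b x y = b y x" "\<And>h. h \<in> planeH \<Longrightarrow> q h = b h h"
    using assms unfolding invariant_form_def quadratic_form_on_def by blast
  have gtf: "gt_form q v = b (projH (fst v)) (projH (fst v)) + (snd v)\<^sup>2" for v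
    by (simp add: gt_form_def form_oplus_zero_eq b(3))
  have "gB q v w = b (projH (fst v)) (projH (fst w)) + snd v * snd w" for v w
    using b(2)[of "projH (fst w)" "projH (fst v)"]
    by (simp add: gB_def gtf linear_add[OF linear_projH] bilinear_ladd[OF b(1)] bilinear_radd[OF b(1)] power2_eq_square algebra_simps)
  moreover have "0 < b h h" if "h \<in> planeH" "h \<noteq> 0" for h
    using assms that b(3) unfolding invariant_form_def by metis
  ultimately show ?thesis using that b(1,2) gtf by blast
qed

lemma bilinear_gB:
  assumes "invariant_form q"
  shows "bilinear (gB q)"
proof -
  obtain b where b: "bilinear b" "\<And>v w. gB q v w = b (projH (fst v)) (projH (fst w)) + snd v * snd w"
    using invariant_form_bilinear[OF assms] by metis
  show ?thesis unfolding bilinear_def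
    by (auto intro!: linearI simp: b(2) linear_add[OF linear_projH] linear_scale[OF linear_projH]
       bilinear_ladd[OF b(1)] bilinear_radd[OF b(1)] bilinear_lmul[OF b(1)] bilinear_rmul[OF b(1)] algebra_simps)
qed

lemma gB_self: "invariant_form q \<Longrightarrow> gB q v v = gt_form q v"
  by (elim invariant_form_bilinear) (simp add: power2_eq_square)

lemma gt_form_nonneg: "invariant_form q \<Longrightarrow> 0 \<le> gt_form q v"
proof (elim invariant_form_bilinear)
  fix b assume b: "bilinear b" "\<And>v. gt_form q v = b (projH (fst v)) (projH (fst v)) + (snd v)\<^sup>2"
    "\<And>h. h \<in> planeH \<Longrightarrow> h \<noteq> 0 \<Longrightarrow> 0 < b h h"
  have "0 \<le> b (projH (fst v)) (projH (fst v))"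
    using b(3)[OF projH_in_planeH[of "fst v"]] bilinear_lzero[OF b(1)] by (cases "projH (fst v) = 0") auto
  then show ?thesis by (simp add: b(2))
qed

lemma invariant_form_Apow:
  assumes "invariant_form q"
  shows "q (projH (Apow k x)) = q (projH x)"
proof -
  have A: "q (projH (matA *v x)) = q (projH x)" for x
    using assms by (simp add: invariant_form_def projH_A)
  show ?thesis
  proof (induction k rule: int_induct[of _ 0])
    case (step1 i)
    then show ?case by (simp add: Apow_succ A)
  next
    case (step2 i)
    then show ?case using A[of "Ainv (Apow i x)"] by (simp add: Apow_pred)
  qed simp
qed

lemma gB_linpart:
  assumes "invariant_form q"
  shows "gB q (linpart k v) (linpart k w) = gB q v w"
proof -
  have "gt_form q (linpart k v) = gt_form q v" for v
    using invariant_form_Apow[OF assms] by (simp add: gt_form_def form_oplus_zero_eq linpart_def)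
  then show ?thesis by (simp add: gB_def flip: linear_add[OF linear_linpart])
qed

lemma gB_eq_sum:
  assumes "invariant_form q"
  shows "gB q u w = (\<Sum>a<5. \<Sum>b<5. coords u a * coords w b * gB q (coord_vector a) (coord_vector b))"
proof -
  note bl = bilinear_gB[OF assms]
  have "gB q u w = gB q (\<Sum>i<5. coords u i *\<^sub>R coord_vector i) (\<Sum>i<5. coords w i *\<^sub>R coord_vector i)"
    using eq_sum_coords by metis
  also have "\<dots> = (\<Sum>a<5. \<Sum>b<5. gB q (coords u a *\<^sub>R coord_vector a) (coords w b *\<^sub>R coord_vector b))"
    by (subst bilinear_sum[OF bl]) (simp add: sum.cartesian_product)
  finally show ?thesis by (simp add: bilinear_lmul[OF bl] bilinear_rmul[OF bl] mult.assoc mult.left_commute)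
qed

text \<open>The linear part preserves \<open>gB\<close>, so a tensor with these constant components
  pulls back to one with the same components. This gives at once the invariance upstairs, the
  transformation law on the quotient and the relation between the two metrics.\<close>

lemma act_rep_pullback_gt:
  assumes "invariant_form q" "act_rep c d f x k n" "i < 5" "j < 5"
    and g: "\<And>a b. a < 5 \<Longrightarrow> b < 5 \<Longrightarrow> g d (f x) a b = gB q (coord_vector a) (coord_vector b)"
  shows "pullback_comp 5 c d f g x i j = gB q (coord_vector i) (coord_vector j)"
proof -
  have "pullback_comp 5 c d f g x i j = gB q (linpart k (coord_vector i)) (linpart k (coord_vector j))"
    unfolding act_rep_pullback[OF assms(2-4)] using g
    by (simp add: gB_eq_sum[OF assms(1), of "linpart k (coord_vector i)" "linpart k (coord_vector j)"])
  then show ?thesis by (simp add: gB_linpart[OF assms(1)])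
qed

text \<open>For exponent 0 the differential is the identity, so an arbitrary \<open>g\<close> can be
  read off from its pullback.\<close>

lemma act_rep_pullback_id:
  assumes "act_rep c d f x 0 n" and ij: "i < 5" "j < 5"
  shows "pullback_comp 5 c d f g x i j = g d (f x) i j"
proof -
  have "pullback_comp 5 c d f g x i j = (\<Sum>a<5. \<Sum>b<5. (if i = a then 1 else 0) * (if j = b then 1 else 0) * g d (f x) a b)"
    unfolding act_rep_pullback[OF assms] using ij by (simp add: coords_coord_vector)
  also have "\<dots> = (\<Sum>a<5. if i = a then g d (f x) a j else 0)"
    using ij by (intro sum.cong) (auto simp: if_distrib[of "\<lambda>z. z * _"] cong: if_cong)
  also have "\<dots> = g d (f x) i j" using ij by simp
  finally show ?thesis .
qed

section \<open>Charts of the quotient and their transition maps\<close>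

lemma range_coords: "range coords = topspace (Euclidean_space 5)"
proof
  show "topspace (Euclidean_space 5) \<subseteq> range coords"
    using coords_uncoords by (metis rangeI subsetI)
qed auto

lemma inv_coords: "y \<in> topspace (Euclidean_space 5) \<Longrightarrow> inv_into UNIV coords y = uncoords y"
  by (metis coords_uncoords inj_coords inv_into_f_f UNIV_I)

lemma act_rep_Mt: "act_rep (UNIV, coords) (UNIV, coords) (act k n) x k n"
  unfolding act_rep_def
  by (rule exI[of _ "topspace (Euclidean_space 5)"]) (simp add: range_coords local_rep_def inv_coords)

text \<open>As \<open>Mt\<close> has one global chart, a chart in the atlas of the quotient is
  determined by the set \<open>V\<close> alone.\<close>

definition qchart :: "((real^4) \<times> real) set \<Rightarrow> ((real^4) \<times> real) set chart"
  where "qchart V = (orb \<Gamma> ` V, \<lambda>w. coords (inv_into V (orb \<Gamma>) w))"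

lemma atlas_Mquot: "atlas Mquot = {qchart V |V. open V \<and> inj_on (orb \<Gamma>) V}"
  by (auto simp: Mquot_def quotient_mfd_def Mt_def qchart_def)

lemma mdim_Mquot [simp]: "mdim Mquot = 5"
  by (simp add: Mquot_def quotient_mfd_def Mt_def)

lemma mdim_Mt [simp]: "mdim Mt = 5" and atlas_Mt [simp]: "atlas Mt = {(UNIV, coords)}"
  by (simp_all add: Mt_def)

lemma qchart_orb: "inj_on (orb \<Gamma>) V \<Longrightarrow> p \<in> V \<Longrightarrow> snd (qchart V) (orb \<Gamma> p) = coords p"
  by (simp add: qchart_def)

lemma qchart_image: "inj_on (orb \<Gamma>) V \<Longrightarrow> snd (qchart V) ` fst (qchart V) = coords ` V"
  by (force simp: qchart_def)

lemma inj_qchart: "inj_on (orb \<Gamma>) V \<Longrightarrow> inj_on (snd (qchart V)) (fst (qchart V))"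
  by (auto simp: qchart_def intro!: inj_onI dest!: inj_coords[of UNIV, THEN inj_onD])

lemma qchart_inv: "inj_on (orb \<Gamma>) V \<Longrightarrow> p \<in> V \<Longrightarrow> inv_into (fst (qchart V)) (snd (qchart V)) (coords p) = orb \<Gamma> p"
  using inv_into_f_f[OF inj_qchart, of V "orb \<Gamma> p"] qchart_orb by (simp add: qchart_def)

lemma act_rep_Mt_Mquot:
  assumes V: "open V" "inj_on (orb \<Gamma>) V" and n: "n \<in> Zlat" and p: "act k n p \<in> V"
  shows "act_rep (UNIV, coords) (qchart V) (orb \<Gamma>) p k n"
  unfolding act_rep_def
proof (intro exI[of _ "coords ` {p. act k n p \<in> V}"] conjI ballI)
  note g = act_in_\<Gamma>[OF n, of k]
  show "openin (Euclidean_space 5) (coords ` {p. act k n p \<in> V})"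
    by (intro openin_coords_image open_vimage_\<Gamma> g V)
  show "snd (UNIV, coords) p \<in> coords ` {p. act k n p \<in> V}" using p by simp
  have *: "orb \<Gamma> r = orb \<Gamma> (act k n r)" for r using orb_\<Gamma>[OF g] by simp
  show "coords ` {p. act k n p \<in> V} \<subseteq> snd (UNIV, coords) ` {x \<in> fst (UNIV, coords). orb \<Gamma> x \<in> fst (qchart V)}"
    using * by (force simp: qchart_def)
  fix y assume "y \<in> coords ` {p. act k n p \<in> V}"
  then obtain r where r: "y = coords r" "act k n r \<in> V" by blast
  have "snd (qchart V) (orb \<Gamma> r) = coords (act k n r)" using qchart_orb[OF V(2) r(2)] *[of r] by simp
  then show "local_rep (UNIV, coords) (qchart V) (orb \<Gamma>) y = coords (act k n (uncoords y))"
    by (simp add: local_rep_def r inv_coords)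
qed

text \<open>The two charts read off coordinates of two representatives of the same orbit. These are
  related by one group element, which continues to relate them at nearby points by injectivity of
  the projection on \<open>V\<close> and \<open>V'\<close>.\<close>

lemma act_rep_Mquot:
  assumes V: "open V" "inj_on (orb \<Gamma>) V" and V': "open V'" "inj_on (orb \<Gamma>) V'"
    and n: "n \<in> Zlat" and p: "p \<in> V" "act k n p \<in> V'"
  shows "act_rep (qchart V) (qchart V') (\<lambda>x. x) (orb \<Gamma> p) k n"
  unfolding act_rep_def
proof (intro exI[of _ "coords ` (V \<inter> {p. act k n p \<in> V'})"] conjI ballI)
  note g = act_in_\<Gamma>[OF n, of k]
  show "openin (Euclidean_space 5) (coords ` (V \<inter> {p. act k n p \<in> V'}))"
    by (intro openin_coords_image open_Int open_vimage_\<Gamma> g V V')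
  show "snd (qchart V) (orb \<Gamma> p) \<in> coords ` (V \<inter> {p. act k n p \<in> V'})" using p V by (simp add: qchart_orb)
  have *: "orb \<Gamma> r = orb \<Gamma> (act k n r)" for r using orb_\<Gamma>[OF g] by simp
  show "coords ` (V \<inter> {p. act k n p \<in> V'}) \<subseteq> snd (qchart V) ` {x \<in> fst (qchart V). x \<in> fst (qchart V')}"
  proof
    fix y assume "y \<in> coords ` (V \<inter> {p. act k n p \<in> V'})"
    then obtain r where r: "y = coords r" "r \<in> V" "act k n r \<in> V'" by blast
    then have "orb \<Gamma> r \<in> fst (qchart V)" "orb \<Gamma> r \<in> fst (qchart V')" using *[of r] by (auto simp: qchart_def)
    then show "y \<in> snd (qchart V) ` {x \<in> fst (qchart V). x \<in> fst (qchart V')}"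
      using r qchart_orb[OF V(2) r(2)] by (intro image_eqI[of _ _ "orb \<Gamma> r"]) simp_all
  qed
  fix y assume "y \<in> coords ` (V \<inter> {p. act k n p \<in> V'})"
  then obtain r where r: "y = coords r" "r \<in> V" "act k n r \<in> V'" by blast
  have "snd (qchart V') (orb \<Gamma> r) = coords (act k n r)" using qchart_orb[OF V'(2) r(3)] *[of r] by simp
  then show "local_rep (qchart V) (qchart V') (\<lambda>x. x) y = coords (act k n (uncoords y))"
    by (simp add: local_rep_def r qchart_inv[OF V(2)])
qed

lemma act_rep_Mquot_ex:
  assumes V: "open V" "inj_on (orb \<Gamma>) V" and V': "open V'" "inj_on (orb \<Gamma>) V'"
    and x: "x \<in> fst (qchart V)" "x \<in> fst (qchart V')"
  shows "\<exists>k n. act_rep (qchart V) (qchart V') (\<lambda>x. x) x k n"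
proof -
  obtain p p' where p: "p \<in> V" "p' \<in> V'" "x = orb \<Gamma> p" "orb \<Gamma> p = orb \<Gamma> p'" using x by (auto simp: qchart_def)
  obtain \<gamma> where "\<gamma> \<in> \<Gamma>" "p' = \<gamma> p" using orb_eqD p(4) by blast
  then obtain k n where "n \<in> Zlat" "p' = act k n p" by (metis \<Gamma>_cases)
  then show ?thesis using act_rep_Mquot[OF V V'] p by blast
qed

lemma is_chart_coords: "is_chart 5 euclidean (UNIV, coords)"
  unfolding is_chart_def
proof (intro conjI)
  have "homeomorphic_maps euclidean (Euclidean_space 5) coords uncoords"
    using continuous_map_coords continuous_map_uncoords coords_uncoords by (simp add: homeomorphic_maps_def)
  then show "homeomorphic_map (subtopology euclidean (fst (UNIV, coords)))
     (subtopology (Euclidean_space 5) (snd (UNIV, coords) ` fst (UNIV, coords))) (snd (UNIV, coords))"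
    by (auto simp: range_coords homeomorphic_map_maps)
qed (simp_all add: range_coords)

lemma is_chart_qchart:
  assumes V: "open V" "inj_on (orb \<Gamma>) V"
  shows "is_chart 5 (mtop Mquot) (qchart V)"
  unfolding is_chart_def
proof (intro conjI)
  have fst: "fst (qchart V) = orb \<Gamma> ` V" by (simp add: qchart_def)
  show oV: "openin (mtop Mquot) (fst (qchart V))" unfolding fst by (rule openin_orb_image[OF V(1)])
  show oc: "openin (Euclidean_space 5) (snd (qchart V) ` fst (qchart V))"
    unfolding qchart_image[OF V(2)] by (rule openin_coords_image[OF V(1)])
  have ts: "topspace (subtopology (mtop Mquot) (orb \<Gamma> ` V)) = orb \<Gamma> ` V" using openin_subset[OF oV] fst by auto
  have tc: "topspace (subtopology (Euclidean_space 5) (coords ` V)) = coords ` V" by auto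
  have "continuous_map (subtopology (mtop Mquot) (orb \<Gamma> ` V)) (Euclidean_space 5) (snd (qchart V))"
    unfolding continuous_map_def ts
  proof (intro conjI allI impI)
    show "snd (qchart V) \<in> orb \<Gamma> ` V \<rightarrow> topspace (Euclidean_space 5)" by (simp add: qchart_def)
    fix U assume U: "openin (Euclidean_space 5) U"
    have "{x \<in> orb \<Gamma> ` V. snd (qchart V) x \<in> U} = orb \<Gamma> ` (V \<inter> {p. coords p \<in> U})"
      using qchart_orb[OF V(2)] by auto
    moreover have "openin (mtop Mquot) \<dots>"
      by (intro openin_orb_image open_Int V open_coords_preimage U)
    moreover have "orb \<Gamma> ` (V \<inter> {p. coords p \<in> U}) = orb \<Gamma> ` (V \<inter> {p. coords p \<in> U}) \<inter> orb \<Gamma> ` V" by auto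
    ultimately show "openin (subtopology (mtop Mquot) (orb \<Gamma> ` V)) {x \<in> orb \<Gamma> ` V. snd (qchart V) x \<in> U}"
      unfolding openin_subtopology by (intro exI[of _ "orb \<Gamma> ` (V \<inter> {p. coords p \<in> U})"] conjI) simp_all
  qed
  moreover have "snd (qchart V) ` (orb \<Gamma> ` V) \<subseteq> coords ` V" using qchart_image[OF V(2)] fst by simp
  ultimately have c1: "continuous_map (subtopology (mtop Mquot) (orb \<Gamma> ` V)) (subtopology (Euclidean_space 5) (coords ` V)) (snd (qchart V))"
    unfolding continuous_map_in_subtopology ts image_subset_iff_funcset by blast
  have "continuous_map (subtopology (Euclidean_space 5) (coords ` V)) (mtop Mquot) (orb \<Gamma> \<circ> uncoords)"
    by (rule continuous_map_compose[OF continuous_map_from_subtopology[OF continuous_map_uncoords] continuous_map_orb_\<Gamma>])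
  then have c2: "continuous_map (subtopology (Euclidean_space 5) (coords ` V)) (subtopology (mtop Mquot) (orb \<Gamma> ` V)) (orb \<Gamma> \<circ> uncoords)"
    by (auto simp: continuous_map_in_subtopology)
  have "homeomorphic_maps (subtopology (mtop Mquot) (orb \<Gamma> ` V)) (subtopology (Euclidean_space 5) (coords ` V)) (snd (qchart V)) (orb \<Gamma> \<circ> uncoords)"
    unfolding homeomorphic_maps_def ts tc using c1 c2 qchart_orb[OF V(2)] by auto
  then show "homeomorphic_map (subtopology (mtop Mquot) (fst (qchart V)))
     (subtopology (Euclidean_space 5) (snd (qchart V) ` fst (qchart V))) (snd (qchart V))"
    unfolding qchart_image[OF V(2)] unfolding fst homeomorphic_map_maps by (rule exI[of _ "orb \<Gamma> \<circ> uncoords"])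
qed

lemma inj_on_orb_ball: "inj_on (orb \<Gamma>) (ball p (1/2))"
proof (rule inj_onI)
  fix x y assume xy: "x \<in> ball p (1/2)" "y \<in> ball p (1/2)" "orb \<Gamma> x = orb \<Gamma> y"
  then obtain \<gamma> where g: "\<gamma> \<in> \<Gamma>" "y = \<gamma> x" using orb_eqD by blast
  have "dist x y < 1" using xy dist_triangle_half_r[of p x 1 y] by auto
  then have "\<gamma> = (\<lambda>p. p)" using \<Gamma>_small_displacement g by blast
  then show "x = y" using g by simp
qed

lemma atlas_Mquot_cover: "(\<Union>c\<in>atlas Mquot. fst c) = mcarrier Mquot"
proof -
  have "orb \<Gamma> p \<in> (\<Union>c\<in>atlas Mquot. fst c)" for p
  proof
    show "qchart (ball p (1/2)) \<in> atlas Mquot" unfolding atlas_Mquot using inj_on_orb_ball by blast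
    show "orb \<Gamma> p \<in> fst (qchart (ball p (1/2)))" by (simp add: qchart_def)
  qed
  then show ?thesis by (auto simp: topspace_Mquot atlas_Mquot qchart_def)
qed

lemma Mquot_transition_smooth:
  assumes "c \<in> atlas Mquot" "d \<in> atlas Mquot"
  shows "smooth_in_charts 5 5 c d (\<lambda>x. x)"
proof (rule act_rep_smooth)
  fix x assume "x \<in> fst c" "x \<in> fst d"
  then show "\<exists>k n. act_rep c d (\<lambda>x. x) x k n"
    using assms act_rep_Mquot_ex unfolding atlas_Mquot by blast
qed

lemma smooth_manifold_Mquot: "smooth_manifold Mquot"
  unfolding smooth_manifold_def
  using Hausdorff_Mquot second_countable_Mquot atlas_Mquot_cover Mquot_transition_smooth is_chart_qchart
  by (auto simp: atlas_Mquot)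

lemma closed_manifold_Mquot: "closed_manifold Mquot"
  by (simp add: closed_manifold_def smooth_manifold_Mquot compact_Mquot)

lemma atlas_subset_charts_Mquot: "atlas Mquot \<subseteq> charts Mquot"
proof
  fix c assume c: "c \<in> atlas Mquot"
  then have "is_chart 5 (mtop Mquot) c" using is_chart_qchart by (auto simp: atlas_Mquot)
  then show "c \<in> charts Mquot" using Mquot_transition_smooth c by (simp add: charts_def)
qed

lemma smooth_in_charts_\<Gamma>: "\<gamma> \<in> \<Gamma> \<Longrightarrow> smooth_in_charts 5 5 (UNIV, coords) (UNIV, coords) \<gamma>"
  by (elim \<Gamma>_cases) (use act_rep_Mt in \<open>blast intro: act_rep_smooth\<close>)

lemma smooth_manifold_Mt: "smooth_manifold Mt"
  unfolding smooth_manifold_def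
  using second_countable_euclidean is_chart_coords smooth_in_charts_\<Gamma>[OF \<Gamma>_id]
  by (auto simp: Mt_def)

lemma diffeomorphism_\<Gamma>: "\<gamma> \<in> \<Gamma> \<Longrightarrow> diffeomorphism Mt Mt \<gamma>"
proof -
  assume g: "\<gamma> \<in> \<Gamma>"
  then obtain \<delta> where d: "\<delta> \<in> \<Gamma>" "\<And>p. \<gamma> (\<delta> p) = p" "\<And>p. \<delta> (\<gamma> p) = p" using \<Gamma>_inverse by metis
  have "smooth_map Mt Mt \<sigma>" if "\<sigma> \<in> \<Gamma>" for \<sigma>
    using smooth_in_charts_\<Gamma>[OF that] continuous_on_\<Gamma>[OF that, of UNIV] by (simp add: smooth_map_def Mt_def)
  then show ?thesis unfolding diffeomorphism_def using g d by blast
qed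

lemma is_pullback_\<Gamma>:
  assumes "invariant_form q" "\<gamma> \<in> \<Gamma>"
  shows "is_pullback Mt Mt \<gamma> (gt q) (gt q)"
proof -
  obtain k n where g: "\<gamma> = act k n" using assms(2) by (rule \<Gamma>_cases)
  show ?thesis unfolding is_pullback_def g
    using act_rep_pullback_gt[OF assms(1) act_rep_Mt[of k n]] by (simp add: gt_eq_gB)
qed

lemma gB_sum_nonneg:
  assumes "invariant_form q"
  shows "0 \<le> (\<Sum>i<5. \<Sum>j<5. gB q (coord_vector i) (coord_vector j) * v i * v j)"
proof -
  \<comment> \<open>An arbitrary sequence is cut off after five entries, as \<open>coords\<close>
    inverts \<open>uncoords\<close> only on sequences that vanish from there on.\<close>
  let ?w = "uncoords (\<lambda>i. if i < 5 then v i else 0)"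
  have w: "coords ?w i = v i" if "i < 5" for i
    using that by (subst coords_uncoords) (auto simp: topspace_Euclidean_space)
  have "0 \<le> gB q ?w ?w" using gt_form_nonneg[OF assms] gB_self[OF assms] by simp
  also have "gB q ?w ?w = (\<Sum>i<5. \<Sum>j<5. gB q (coord_vector i) (coord_vector j) * v i * v j)"
    by (subst gB_eq_sum[OF assms]) (intro sum.cong refl, simp add: w algebra_simps)
  finally show ?thesis .
qed

lemma nonneg_metric_Mt:
  assumes "invariant_form q"
  shows "nonneg_metric Mt (gt q)"
  unfolding nonneg_metric_def sym_tensor_def nonneg_tensor_def
proof (intro conjI ballI allI impI)
  show "is_pullback Mt Mt (\<lambda>x. x) (gt q) (gt q)" using is_pullback_\<Gamma>[OF assms \<Gamma>_id] .
  fix c :: "((real^4) \<times> real) chart" and i j x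
  show "gt q c x i j = gt q c x j i" by (simp add: gt_eq_gB gB_commute)
  assume "c \<in> atlas Mt"
  then have c: "c = (UNIV, coords)" by simp
  show "smooth_fun_on (mdim Mt) (snd c ` fst c) (\<lambda>y. gt q c (inv_into (fst c) (snd c) y) i j)"
    by (rule smooth_fun_on_const) (simp_all add: c range_coords gt_eq_gB)
  show "0 \<le> (\<Sum>i<mdim Mt. \<Sum>j<mdim Mt. gt q c x i j * v i * v j)" for v
    using gB_sum_nonneg[OF assms] by (simp add: gt_eq_gB)
qed

lemma is_pullbackD:
  "is_pullback M N f g h \<Longrightarrow> c \<in> atlas M \<Longrightarrow> d \<in> atlas N \<Longrightarrow> x \<in> fst c \<Longrightarrow> f x \<in> fst d \<Longrightarrow>
    i < mdim M \<Longrightarrow> j < mdim M \<Longrightarrow> h c x i j = pullback_comp (mdim N) c d f g x i j"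
  unfolding is_pullback_def by blast

text \<open>The relation to the metric upstairs determines \<open>g\<close>: representing the point
  inside \<open>V\<close> makes the exponent 0, so nothing is transformed. Hence the claims can be
  proved for every such \<open>g\<close>, not just for a constructed one.\<close>

lemma metric_Mquot_components:
  assumes "is_pullback Mt Mquot (orb \<Gamma>) g (gt q)" and V: "open V" "inj_on (orb \<Gamma>) V" and x: "x \<in> fst (qchart V)"
    and ij: "i < 5" "j < 5"
  shows "g (qchart V) x i j = gB q (coord_vector i) (coord_vector j)"
proof -
  obtain p where p: "p \<in> V" "x = orb \<Gamma> p" using x by (auto simp: qchart_def)
  have "qchart V \<in> atlas Mquot" unfolding atlas_Mquot using V by blast
  then have "gt q (UNIV, coords) p i j = pullback_comp 5 (UNIV, coords) (qchart V) (orb \<Gamma>) g p i j"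
    using is_pullbackD[OF assms(1), of "(UNIV, coords)" "qchart V" p i j] x ij p by simp
  also have "\<dots> = g (qchart V) x i j"
    using act_rep_pullback_id[OF act_rep_Mt_Mquot[OF V, of 0 0 p]] p ij by simp
  finally show ?thesis by (simp add: gt_eq_gB)
qed

lemma ex_metric_Mquot:
  assumes "invariant_form q"
  shows "\<exists>g. sym_tensor Mquot g \<and> is_pullback Mt Mquot (orb \<Gamma>) g (gt q)"
proof (intro exI conjI)
  define g :: "((real^4) \<times> real) set tensor2" where "g c x i j = gB q (coord_vector i) (coord_vector j)" for c x i j
  show "sym_tensor Mquot g" unfolding sym_tensor_def
  proof (intro conjI ballI allI impI)
    show "is_pullback Mquot Mquot (\<lambda>x. x) g g"
      unfolding is_pullback_def
    proof (intro ballI allI impI)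
      fix c d x i j assume "c \<in> atlas Mquot" "d \<in> atlas Mquot" "x \<in> fst c" "x \<in> fst d" and ij: "i < mdim Mquot" "j < mdim Mquot"
      then obtain k n where "act_rep c d (\<lambda>x. x) x k n" using act_rep_Mquot_ex unfolding atlas_Mquot by blast
      then show "g c x i j = pullback_comp (mdim Mquot) c d (\<lambda>x. x) g x i j"
        using act_rep_pullback_gt[OF assms, of c d "\<lambda>x. x" x k n i j g] ij by (simp add: g_def)
    qed
    fix c i j x assume c: "c \<in> atlas Mquot"
    show "g c x i j = g c x j i" by (simp add: g_def gB_commute)
    have "is_chart 5 (mtop Mquot) c" using c is_chart_qchart by (auto simp: atlas_Mquot)
    then show "smooth_fun_on (mdim Mquot) (snd c ` fst c) (\<lambda>y. g c (inv_into (fst c) (snd c) y) i j)"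
      by (intro smooth_fun_on_const) (simp_all add: g_def is_chart_def)
  qed
  show "is_pullback Mt Mquot (orb \<Gamma>) g (gt q)"
    unfolding is_pullback_def
  proof (intro ballI allI impI)
    fix c d p i j assume c: "c \<in> atlas Mt" and d: "d \<in> atlas Mquot" "orb \<Gamma> p \<in> fst d" and ij: "i < mdim Mt" "j < mdim Mt"
    obtain V where V: "d = qchart V" "open V" "inj_on (orb \<Gamma>) V" using d by (auto simp: atlas_Mquot)
    obtain p' where "p' \<in> V" "orb \<Gamma> p = orb \<Gamma> p'" using d(2) by (auto simp: V(1) qchart_def)
    then obtain \<gamma> where "\<gamma> \<in> \<Gamma>" "\<gamma> p \<in> V" using orb_eqD by blast
    then obtain k n where "n \<in> Zlat" "act k n p \<in> V" by (metis \<Gamma>_cases)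
    then have "act_rep (UNIV, coords) d (orb \<Gamma>) p k n" using act_rep_Mt_Mquot[OF V(2,3)] V(1) by simp
    then show "gt q c p i j = pullback_comp (mdim Mquot) c d (orb \<Gamma>) g p i j"
      using act_rep_pullback_gt[OF assms, of c d "orb \<Gamma>" p k n i j g] ij c by (simp add: g_def gt_eq_gB)
  qed
qed

lemma metric_Mquot_nonneg_flat:
  assumes q: "invariant_form q" and g: "sym_tensor Mquot g" "is_pullback Mt Mquot (orb \<Gamma>) g (gt q)"
  shows "nonneg_metric Mquot g" "flat_metric Mquot g"
proof -
  have g_eq: "g c x i j = gB q (coord_vector i) (coord_vector j)" if "c \<in> atlas Mquot" "x \<in> fst c" "i < 5" "j < 5" for c x i j
    using that metric_Mquot_components[OF g(2)] by (auto simp: atlas_Mquot)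
  show "nonneg_metric Mquot g"
    unfolding nonneg_metric_def nonneg_tensor_def
  proof (intro conjI ballI allI g)
    fix c x and v :: "nat \<Rightarrow> real" assume "c \<in> atlas Mquot" "x \<in> fst c"
    then show "0 \<le> (\<Sum>i<mdim Mquot. \<Sum>j<mdim Mquot. g c x i j * v i * v j)"
      using gB_sum_nonneg[OF q, of v] by (simp add: g_eq)
  qed
  show "flat_metric Mquot g"
    unfolding flat_metric_def
  proof
    fix p assume "p \<in> mcarrier Mquot"
    then obtain c where c: "c \<in> atlas Mquot" "p \<in> fst c" using atlas_Mquot_cover by blast
    \<comment> \<open>A chart of the atlas itself serves as flat coordinates. By the transformation
      law contained in \<open>sym_tensor\<close>, its components computed through any other chart
      \<open>d\<close> are the components in \<open>c\<close>, which are constant.\<close>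
    have "pullback_comp (mdim Mquot) c d (\<lambda>x. x) g x i j = gB q (coord_vector i) (coord_vector j)"
      if "d \<in> atlas Mquot" "x \<in> fst c \<inter> fst d" "i < mdim Mquot" "j < mdim Mquot" for d x i j
    proof -
      have "is_pullback Mquot Mquot (\<lambda>x. x) g g" using g(1) by (simp add: sym_tensor_def)
      from is_pullbackD[OF this c(1) that(1), of x i j] show ?thesis using that g_eq[OF c(1), of x i j] by simp
    qed
    then show "\<exists>c\<in>charts Mquot. p \<in> fst c \<and>
       (\<exists>K::nat \<Rightarrow> nat \<Rightarrow> real. \<forall>d\<in>atlas Mquot. \<forall>x\<in>fst c \<inter> fst d. \<forall>i<mdim Mquot. \<forall>j<mdim Mquot.
          pullback_comp (mdim Mquot) c d (\<lambda>x. x) g x i j = K i j)"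
      using c atlas_subset_charts_Mquot 
      by (intro bexI[of _ c] conjI exI[of _ "\<lambda>i j. gB q (coord_vector i) (coord_vector j)"]) auto
  qed
qed

section \<open>The rank\<close>

lemma vector_space_fun: "vector_space (\<lambda>(a::real) (v::nat \<Rightarrow> real) j. a * v j)"
  by unfold_locales (simp_all add: fun_eq_iff algebra_simps)

lemma projH_idem: "h \<in> planeH \<Longrightarrow> projH h = h"
  using projH_unique[of h h] subspace_0[OF subspace_planeE] by simp

lemma dim_planeH_Times: "dim (planeH \<times> (UNIV :: real set)) = 3"
  using dim_Times[OF subspace_planeH subspace_UNIV[where 'a = real]] by (simp add: dim_planeH)

text \<open>The rows of the matrix are the images of the basis vectors under \<open>L\<close>, the
  map that pairs a vector with the basis through \<open>gB\<close>. The row space is the image of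
  \<open>L\<close>, which is already attained on \<open>planeH\<close> times the line; there the
  form is definite, so \<open>L\<close> is injective and the rank is 2 + 1.\<close>

lemma mat_rank_gB:
  assumes q: "invariant_form q" and B: "\<And>i j. i < 5 \<Longrightarrow> j < 5 \<Longrightarrow> B i j = gB q (coord_vector i) (coord_vector j)"
  shows "mat_rank 5 B = 3"
proof -
  let ?sc = "\<lambda>(a::real) (v::nat \<Rightarrow> real) j. a * v j"
  interpret F: vector_space ?sc by (rule vector_space_fun)
  interpret vp: vector_space_pair "scaleR :: real \<Rightarrow> (real^4) \<times> real \<Rightarrow> _" ?sc by unfold_locales
  obtain b where b: "bilinear b" "\<And>v w. gB q v w = b (projH (fst v)) (projH (fst w)) + snd v * snd w"
    "\<And>v. gt_form q v = b (projH (fst v)) (projH (fst v)) + (snd v)\<^sup>2"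
    "\<And>h. h \<in> planeH \<Longrightarrow> h \<noteq> 0 \<Longrightarrow> 0 < b h h"
    by (rule invariant_form_bilinear[OF q]) blast
  note bl = bilinear_gB[OF q]
  define L where "L v j = (if j < 5 then gB q v (coord_vector j) else 0)" for v and j :: nat
  have lin: "Vector_Spaces.linear scaleR ?sc L"
    by unfold_locales (auto simp: L_def fun_eq_iff bilinear_ladd[OF bl] bilinear_lmul[OF bl])
  define S where "S = planeH \<times> (UNIV :: real set)"
  have subS: "subspace S" unfolding S_def by (intro subspace_Times subspace_planeH subspace_UNIV)
  obtain T where T: "T \<subseteq> S" "independent T" "S \<subseteq> span T" "card T = 3"
    using basis_exists[of S] dim_planeH_Times by (metis S_def)
  have spanT: "span T = S" using T subS by (simp add: span_minimal subset_antisym)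
  \<comment> \<open>A vector in the kernel of \<open>L\<close> pairs to zero with every vector, in
    particular with itself, and definiteness applies.\<close>
  have L0: "v = 0" if "v \<in> S" "L v = 0" for v
  proof -
    have "gB q v (coord_vector j) = 0" if "j < 5" for j
      using fun_cong[OF \<open>L v = 0\<close>, of j] that by (simp add: L_def)
    moreover have "gB q v v = (\<Sum>j<5. coords v j * gB q v (coord_vector j))"
    proof -
      have "gB q v v = gB q v (\<Sum>j<5. coords v j *\<^sub>R coord_vector j)" by (simp flip: eq_sum_coords)
      also have "\<dots> = (\<Sum>j<5. coords v j * gB q v (coord_vector j))"
      proof -
        have lr: "linear (gB q v)" using bl unfolding bilinear_def by blast
        show ?thesis by (simp add: linear_sum[OF lr] linear_scale[OF lr])
      qed
      finally show ?thesis .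
    qed
    ultimately have "gt_form q v = 0" using gB_self[OF q] by simp
    moreover have h: "fst v \<in> planeH" using that by (auto simp: S_def)
    ultimately have z: "b (fst v) (fst v) + (snd v)\<^sup>2 = 0" by (simp add: b(3) projH_idem)
    have "fst v = 0"
    proof (rule ccontr)
      assume "fst v \<noteq> 0"
      then show False using b(4)[OF h] z zero_le_power2[of "snd v"] by linarith
    qed
    then show ?thesis using z bilinear_lzero[OF b(1)] by (simp add: prod_eq_iff)
  qed
  have injS: "inj_on L (span T)"
    unfolding spanT vp.linear_inj_on_iff_eq_0[OF lin subS[unfolded subspace_raw_def]] using L0 by (intro ballI impI)
  have ind: "F.independent (L ` T)"
    by (rule vp.linear_independent_injective_image[OF lin T(2)[unfolded dependent_raw_def] injS[unfolded span_raw_def]])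
  have card: "card (L ` T) = 3" using card_image[OF inj_on_subset[OF injS span_superset]] T(4) by simp
  \<comment> \<open>The component in \<open>planeE\<close> lies in the radical of the form, so
    dropping it does not change the image.\<close>
  have LS: "L v \<in> L ` S" for v
  proof
    show "(projH (fst v), snd v) \<in> S" by (simp add: S_def)
    show "L v = L (projH (fst v), snd v)" by (simp add: L_def fun_eq_iff b(2) projH_idem)
  qed
  let ?rows = "(\<lambda>i j. if j < 5 then B i j else 0) ` {..<5}"
  have rows: "?rows = L ` coord_vector ` {..<5}"
    unfolding image_image by (intro image_cong refl) (auto simp: L_def B fun_eq_iff)
  have "v \<in> span (coord_vector ` {..<5})" for v
  proof -
    have "(\<Sum>i<5. coords v i *\<^sub>R coord_vector i) \<in> span (coord_vector ` {..<5})"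
      by (intro span_sum span_scale span_base) auto
    then show ?thesis by (simp flip: eq_sum_coords)
  qed
  then have spanU: "span (coord_vector ` {..<5}) = UNIV" by blast
  have "F.span ?rows = L ` span (coord_vector ` {..<5})"
    unfolding rows span_raw_def by (rule vp.linear_span_image[OF lin])
  also have "\<dots> = L ` S" using LS unfolding spanU by blast
  also have "\<dots> = F.span (L ` T)"
    unfolding spanT[symmetric] span_raw_def by (rule vp.linear_span_image[OF lin, symmetric])
  finally have "F.dim ?rows = card (L ` T)" using F.dim_eq_card[OF _ ind] by metis
  then show ?thesis using card by (simp add: mat_rank_def)
qed

lemma constant_rank_Mquot:
  assumes q: "invariant_form q" and g: "is_pullback Mt Mquot (orb \<Gamma>) g (gt q)"
  shows "constant_rank Mquot g 3"
  unfolding constant_rank_def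
proof (intro ballI)
  fix c x assume "c \<in> atlas Mquot" "x \<in> fst c"
  then show "mat_rank (mdim Mquot) (g c x) = 3"
    using metric_Mquot_components[OF g] by (auto simp: atlas_Mquot intro!: mat_rank_gB[OF q])
qed

section \<open>Open maps to the torus\<close>

lemma diffeomorphism_homeomorphic_map:
  assumes "diffeomorphism M N f"
  shows "homeomorphic_map (mtop M) (mtop N) f"
proof -
  obtain f' where "smooth_map M N f" "smooth_map N M f'" "\<forall>x\<in>mcarrier M. f' (f x) = x" "\<forall>y\<in>mcarrier N. f (f' y) = y"
    using assms unfolding diffeomorphism_def by blast
  then have "homeomorphic_maps (mtop M) (mtop N) f f'" by (simp add: homeomorphic_maps_def smooth_map_def)
  then show ?thesis using homeomorphic_map_maps by blast
qed

lemma mtop_open_submfd [simp]: "mtop (open_submfd M U) = subtopology (mtop M) U"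
  by (simp add: open_submfd_def)

lemma smooth_covering_covers:
  assumes "smooth_covering M' M p"
  shows "covers (mtop M') (mtop M) p"
  unfolding covers_def
proof (intro conjI ballI)
  show "continuous_map (mtop M') (mtop M) p" using assms by (simp add: smooth_covering_def smooth_map_def)
  fix x assume "x \<in> mcarrier M"
  then obtain U \<V> where U: "openin (mtop M) U" "x \<in> U" "\<Union>\<V> = {y \<in> mcarrier M'. p y \<in> U}" "pairwise disjnt \<V>"
    "\<forall>V\<in>\<V>. openin (mtop M') V \<and> diffeomorphism (open_submfd M' V) (open_submfd M U) p"
    using assms unfolding smooth_covering_def by meson
  have "openin (mtop M') V \<and> homeomorphic_map (subtopology (mtop M') V) (subtopology (mtop M) U) p" if "V \<in> \<V>" for V
    using U(5) that diffeomorphism_homeomorphic_map[of "open_submfd M' V" "open_submfd M U" p] by simp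
  then show "\<exists>U. openin (mtop M) U \<and> x \<in> U \<and>
       (\<exists>\<V>. \<Union>\<V> = {y \<in> mcarrier M'. p y \<in> U} \<and> pairwise disjnt \<V> \<and>
            (\<forall>V\<in>\<V>. openin (mtop M') V \<and> homeomorphic_map (subtopology (mtop M') V) (subtopology (mtop M) U) p))"
    using U(1-4) by (intro exI[of _ U] conjI exI[of _ \<V>] ballI) simp_all
qed

text \<open>Locally the projection is a homeomorphism followed by the first projection of a product,
  which is open.\<close>

lemma fiber_bundle_open_map:
  assumes "fiber_bundle N B F \<pi>"
  shows "open_map (mtop N) (mtop B) \<pi>"
  unfolding open_map_def
proof (intro allI impI)
  fix Q assume Q: "openin (mtop N) Q"
  have cont: "continuous_map (mtop N) (mtop B) \<pi>" using assms by (simp add: fiber_bundle_def smooth_map_def)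
  show "openin (mtop B) (\<pi> ` Q)"
  proof (subst openin_subopen, intro ballI)
    fix b assume "b \<in> \<pi> ` Q"
    then obtain y where y: "y \<in> Q" "b = \<pi> y" by blast
    have yN: "y \<in> mcarrier N" using y Q openin_subset by blast
    then have "b \<in> mcarrier B" using y continuous_map_funspace[OF cont] by blast
    then obtain U \<Phi> where U: "openin (mtop B) U" "b \<in> U"
      "diffeomorphism (open_submfd N {y \<in> mcarrier N. \<pi> y \<in> U}) (prod_mfd (open_submfd B U) F) \<Phi>"
      "\<forall>y\<in>mcarrier N. \<pi> y \<in> U \<longrightarrow> fst (\<Phi> y) = \<pi> y"
      using assms unfolding fiber_bundle_def by meson
    let ?P = "{y \<in> mcarrier N. \<pi> y \<in> U}"
    have "homeomorphic_map (subtopology (mtop N) ?P) (prod_topology (subtopology (mtop B) U) (mtop F)) \<Phi>"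
      using diffeomorphism_homeomorphic_map[OF U(3)] by (simp add: prod_mfd_def)
    then have "open_map (subtopology (mtop N) ?P) (prod_topology (subtopology (mtop B) U) (mtop F)) \<Phi>"
      by (rule homeomorphic_imp_open_map)
    moreover have "openin (subtopology (mtop N) ?P) (Q \<inter> ?P)" using Q by (auto simp: openin_subtopology)
    ultimately have "openin (prod_topology (subtopology (mtop B) U) (mtop F)) (\<Phi> ` (Q \<inter> ?P))"
      by (simp add: open_map_def)
    then have "openin (subtopology (mtop B) U) (fst ` \<Phi> ` (Q \<inter> ?P))"
      using open_map_fst unfolding open_map_def by blast
    moreover have "fst ` \<Phi> ` (Q \<inter> ?P) = \<pi> ` (Q \<inter> ?P)"
      unfolding image_image by (rule image_cong) (use U(4) in auto)
    ultimately have "openin (mtop B) (\<pi> ` (Q \<inter> ?P))" using openin_open_subtopology[OF U(1)] by simp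
    moreover have "b \<in> \<pi> ` (Q \<inter> ?P)" using y yN U(2) by auto
    ultimately show "\<exists>T. openin (mtop B) T \<and> b \<in> T \<and> T \<subseteq> \<pi> ` Q" by blast
  qed
qed

section \<open>Circle-valued coordinates on the torus\<close>

definition int_translations :: "nat \<Rightarrow> ((nat \<Rightarrow> real) \<Rightarrow> nat \<Rightarrow> real) set"
  where "int_translations m = {(\<lambda>x i. x i + n i) |n. (\<forall>i. n i \<in> \<int>) \<and> (\<forall>i\<ge>m. n i = 0)}"

abbreviation torb :: "nat \<Rightarrow> (nat \<Rightarrow> real) \<Rightarrow> (nat \<Rightarrow> real) set"
  where "torb m \<equiv> orb (int_translations m)"

lemma torus_eq: "torus m = quotient_mfd (euclidean_mfd m) (int_translations m)"
  by (simp add: torus_def int_translations_def)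

lemma mem_torb: "y \<in> torb m x \<longleftrightarrow> (\<forall>i. y i - x i \<in> \<int>) \<and> (\<forall>i\<ge>m. y i = x i)"
proof
  assume "y \<in> torb m x"
  then show "(\<forall>i. y i - x i \<in> \<int>) \<and> (\<forall>i\<ge>m. y i = x i)" by (auto simp: orb_def int_translations_def)
next
  assume a: "(\<forall>i. y i - x i \<in> \<int>) \<and> (\<forall>i\<ge>m. y i = x i)"
  have "(\<lambda>x' i. x' i + (y i - x i)) \<in> int_translations m" unfolding int_translations_def using a by fastforce
  then show "y \<in> torb m x" unfolding orb_def by (rule rev_image_eqI) simp
qed

lemma torb_eq_iff: "torb m x = torb m y \<longleftrightarrow> (\<forall>i. y i - x i \<in> \<int>) \<and> (\<forall>i\<ge>m. y i = x i)"
proof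
  assume "torb m x = torb m y"
  moreover have "y \<in> torb m y" by (simp add: mem_torb)
  ultimately show "(\<forall>i. y i - x i \<in> \<int>) \<and> (\<forall>i\<ge>m. y i = x i)" by (simp flip: mem_torb)
next
  assume a: "(\<forall>i. y i - x i \<in> \<int>) \<and> (\<forall>i\<ge>m. y i = x i)"
  have "z i - x i \<in> \<int> \<longleftrightarrow> z i - y i \<in> \<int>" for z :: "nat \<Rightarrow> real" and i
  proof -
    have "z i - x i = (z i - y i) + (y i - x i)" "z i - y i = (z i - x i) - (y i - x i)" by simp_all
    then show ?thesis using a by (metis Ints_add Ints_diff)
  qed
  then show "torb m x = torb m y" using a by (auto simp: mem_torb set_eq_iff)
qed

lemma topspace_torus: "mcarrier (torus m) = torb m ` topspace (Euclidean_space m)"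
  by (simp add: torus_eq topspace_quotient_mfd euclidean_mfd_def)

lemma openin_torus:
  "openin (mtop (torus m)) W \<longleftrightarrow> W \<subseteq> torb m ` topspace (Euclidean_space m) \<and>
     openin (Euclidean_space m) {x \<in> topspace (Euclidean_space m). torb m x \<in> W}"
  by (simp add: torus_eq openin_quotient_mfd euclidean_mfd_def)

text \<open>The representative chosen by \<open>inv_into\<close> is arbitrary, but
  \<open>cis\<close> after multiplication by 2 pi forgets integer differences.\<close>

definition circle_coord :: "nat \<Rightarrow> nat \<Rightarrow> (nat \<Rightarrow> real) set \<Rightarrow> complex"
  where "circle_coord m i w = cis (2 * pi * inv_into (topspace (Euclidean_space m)) (torb m) w i)"

lemma cis_2pi_eq_iff: "cis (2 * pi * a) = cis (2 * pi * b) \<longleftrightarrow> a - b \<in> \<int>"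
proof -
  have "cis (2 * pi * a) = cis (2 * pi * b) \<longleftrightarrow> sin (2 * pi * a) = sin (2 * pi * b) \<and> cos (2 * pi * a) = cos (2 * pi * b)"
    by (auto simp: complex_eq_iff)
  also have "\<dots> \<longleftrightarrow> (\<exists>n::int. 2 * pi * a = 2 * pi * b + 2 * pi * n)" by (simp add: sin_cos_eq_iff)
  also have "\<dots> \<longleftrightarrow> (\<exists>n::int. a - b = n)"
  proof -
    have "2 * pi * a = 2 * pi * b + 2 * pi * n \<longleftrightarrow> a - b = n" for n
    proof -
      have "2 * pi * a = 2 * pi * b + 2 * pi * n \<longleftrightarrow> (2 * pi) * a = (2 * pi) * (b + n)" by (simp add: distrib_left)
      also have "\<dots> \<longleftrightarrow> a = b + n" by (subst mult_cancel_left) simp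
      finally show ?thesis by auto
    qed
    then show ?thesis by simp
  qed
  finally show ?thesis by (auto simp: Ints_def)
qed

lemma circle_coord_torb:
  assumes "x \<in> topspace (Euclidean_space m)"
  shows "circle_coord m i (torb m x) = cis (2 * pi * x i)"
proof -
  let ?y = "inv_into (topspace (Euclidean_space m)) (torb m) (torb m x)"
  have "torb m ?y = torb m x" 
    by (rule f_inv_into_f[of "torb m x" "torb m" "topspace (Euclidean_space m)"]) (use assms in blast)
  then have "x i - ?y i \<in> \<int>" by (simp add: torb_eq_iff)
  then show ?thesis unfolding circle_coord_def by (simp add: cis_2pi_eq_iff[of "x i" "?y i", THEN iffD2])
qed

lemma continuous_map_circle_coord: "continuous_map (mtop (torus m)) euclidean (circle_coord m i)"
  unfolding continuous_map_def
proof (intro conjI allI impI)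
  fix U :: "complex set" assume "openin euclidean U"
  then have U: "open U" by simp
  let ?W = "{w \<in> mcarrier (torus m). circle_coord m i w \<in> U}"
  have "{x \<in> topspace (Euclidean_space m). torb m x \<in> ?W} = {x \<in> topspace (Euclidean_space m). cis (2 * pi * x i) \<in> U}"
    by (auto simp: topspace_torus circle_coord_torb)
  moreover have "openin (Euclidean_space m) {x \<in> topspace (Euclidean_space m). cis (2 * pi * x i) \<in> U}"
  proof -
    have "continuous_map euclideanreal euclidean (\<lambda>t. cis (2 * pi * t))"
      by (simp add: continuous_map_iff_continuous2) (intro continuous_intros)
    from continuous_map_compose[OF continuous_map_Euclidean_space_proj this]
    have "continuous_map (Euclidean_space m) euclidean (\<lambda>x. cis (2 * pi * x i))" by (simp add: comp_def)
    then show ?thesis by (rule openin_continuous_map_preimage) (simp add: U)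
  qed
  ultimately show "openin (mtop (torus m)) ?W" unfolding openin_torus by (auto simp: topspace_torus)
qed simp

text \<open>Convexity of the domain provides a continuous logarithm; as the values have modulus 1,
  its imaginary part divided by 2 pi is the angle.\<close>

lemma torus_map_angle:
  fixes G :: "'a::real_normed_vector \<Rightarrow> (nat \<Rightarrow> real) set"
  assumes G: "continuous_map euclidean (mtop (torus m)) G"
  obtains \<phi> :: "'a \<Rightarrow> real" where "continuous_on UNIV \<phi>" "\<And>x. circle_coord m i (G x) = cis (2 * pi * \<phi> x)"
proof -
  let ?f = "\<lambda>x. circle_coord m i (G x)"
  have c: "continuous_on UNIV ?f"
    using continuous_map_compose[OF G continuous_map_circle_coord[of m i]] by (simp add: comp_def)
  have n1: "norm (?f x) = 1" for x by (simp add: circle_coord_def)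
  then have nz: "?f x \<noteq> 0" if "x \<in> UNIV" for x by (metis norm_zero zero_neq_one)
  obtain g where g: "continuous_on UNIV g" "\<forall>x\<in>UNIV. ?f x = exp (g x)"
    by (rule continuous_logarithm_on_contractible[OF c convex_imp_contractible[OF convex_UNIV] nz]) auto
  have "?f x = cis (2 * pi * (Im (g x) / (2 * pi)))" for x
  proof -
    have "exp (Re (g x)) = 1" using n1[of x] by (simp add: g(2) norm_exp_eq_Re)
    then show ?thesis by (simp add: g(2) exp_eq_polar)
  qed
  moreover have "continuous_on UNIV (\<lambda>x. Im (g x) / (2 * pi))" by (intro continuous_intros g) simp
  ultimately show ?thesis using that by blast
qed

text \<open>Openness allows the point \<open>G a\<close> to be moved a little in the direction (l0,
  l1) of the first two torus coordinates while staying in the image of a small neighbourhood of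
  \<open>a\<close>. The combination of angles then grows.\<close>

lemma torus_open_map_no_max:
  fixes G :: "'a::real_normed_vector \<Rightarrow> (nat \<Rightarrow> real) set"
  assumes G: "continuous_map euclidean (mtop (torus 3)) G" "open_map euclidean (mtop (torus 3)) G"
    and \<phi>: "continuous_on UNIV \<phi>0" "continuous_on UNIV \<phi>1"
      "\<And>x. circle_coord 3 0 (G x) = cis (2 * pi * \<phi>0 x)" "\<And>x. circle_coord 3 1 (G x) = cis (2 * pi * \<phi>1 x)"
    and l: "l0 \<noteq> 0 \<or> l1 \<noteq> 0"
  shows "\<exists>x. l0 * \<phi>0 x + l1 * \<phi>1 x > l0 * \<phi>0 a + l1 * \<phi>1 a"
proof -
  let ?E = "topspace (Euclidean_space 3)"
  \<comment> \<open>The radius 1/4 excludes integer jumps: together with a motion of less than 1/4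
    in the torus, the real angle found is off by less than 1 from the intended one, so their integer
    difference is zero.\<close>
  define Q where "Q = {x. \<bar>\<phi>0 x - \<phi>0 a\<bar> < 1/4} \<inter> {x. \<bar>\<phi>1 x - \<phi>1 a\<bar> < 1/4}"
  have "open Q" unfolding Q_def
    by (intro open_Int open_Collect_less continuous_intros \<phi>)
  then have "openin (mtop (torus 3)) (G ` Q)" using G(2) by (simp add: open_map_def)
  then have op: "openin (Euclidean_space 3) {x \<in> ?E. torb 3 x \<in> G ` Q}" by (simp add: openin_torus)
  have "G a \<in> mcarrier (torus 3)" using continuous_map_funspace[OF G(1)] by auto
  then obtain z where z: "z \<in> ?E" "G a = torb 3 z" by (auto simp: topspace_torus)
  have zi: "z 0 - \<phi>0 a \<in> \<int>" "z 1 - \<phi>1 a \<in> \<int>"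
    using \<phi>(3,4)[of a] z circle_coord_torb[OF z(1)] by (simp_all add: cis_2pi_eq_iff)
  \<comment> \<open>A straight path in the cover of the torus. It starts at the angles of
    \<open>a\<close>, which represent the same torus point as \<open>z\<close> since the first two
    coordinates differ by integers; the third is kept from \<open>z\<close>.\<close>
  define y where "y t i = (if i < 3 then (if i = 0 then \<phi>0 a + t * l0 else if i = 1 then \<phi>1 a + t * l1 else z i) else 0)" for t :: real and i :: nat
  have yE: "y t \<in> ?E" for t by (simp add: topspace_Euclidean_space y_def)
  have cy: "continuous_map euclideanreal (Euclidean_space 3) y"
    unfolding y_def[abs_def] continuous_map_componentwise_Euclidean_space
  proof (intro allI impI)
    fix i :: nat
    consider "i = 0" | "i = 1" | "i \<noteq> 0" "i \<noteq> 1" by blast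
    then show "continuous_map euclideanreal euclideanreal
        (\<lambda>t. if i = 0 then \<phi>0 a + t * l0 else if i = 1 then \<phi>1 a + t * l1 else z i)"
      by cases (auto simp: continuous_map_iff_continuous2 intro!: continuous_intros)
  qed
  have "torb 3 (y 0) = torb 3 z"
    unfolding torb_eq_iff using zi z(1) by (auto simp: y_def topspace_Euclidean_space)
  moreover have "a \<in> Q" by (simp add: Q_def)
  ultimately have "torb 3 (y 0) \<in> G ` Q" using z(2) by (metis imageI)
  moreover have "open {t. y t \<in> {x \<in> ?E. torb 3 x \<in> G ` Q}}"
    using openin_continuous_map_preimage[OF cy op] by simp
  ultimately obtain e where "e > 0" "ball 0 e \<subseteq> {t. y t \<in> {x \<in> ?E. torb 3 x \<in> G ` Q}}"
    using yE[of 0] by (metis (mono_tags, lifting) mem_Collect_eq openE)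
  then have e: "e > 0" "torb 3 (y t) \<in> G ` Q" if "\<bar>t\<bar> < e" for t
    using that by (auto simp: subset_iff)
  define d where "d = \<bar>l0\<bar> + \<bar>l1\<bar>"
  have d: "d > 0" using l by (auto simp: d_def)
  define t where "t = min (e / 2) (1 / (8 * d))"
  have t: "t > 0" "t < e" "t * d < 1/4"
  proof -
    show "t > 0" "t < e" using \<open>e > 0\<close> d by (auto simp: t_def)
    have "t * d \<le> 1 / (8 * d) * d" using d by (intro mult_right_mono) (auto simp: t_def)
    then show "t * d < 1/4" using d by simp
  qed
  have tl: "\<bar>t * l0\<bar> < 1/4" "\<bar>t * l1\<bar> < 1/4"
  proof -
    have "t * \<bar>l0\<bar> \<le> t * d" "t * \<bar>l1\<bar> \<le> t * d" using t by (auto simp: d_def intro!: mult_left_mono)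
    moreover have "\<bar>t * l0\<bar> = t * \<bar>l0\<bar>" "\<bar>t * l1\<bar> = t * \<bar>l1\<bar>" using t(1) by (simp_all add: abs_mult)
    ultimately show "\<bar>t * l0\<bar> < 1/4" "\<bar>t * l1\<bar> < 1/4" using t(3) by linarith+
  qed
  obtain x where x: "x \<in> Q" "torb 3 (y t) = G x" using e(2)[of t] t by auto
  have "y t 0 - \<phi>0 x \<in> \<int>" "y t 1 - \<phi>1 x \<in> \<int>"
    using \<phi>(3,4)[of x] x(2)[symmetric] circle_coord_torb[OF yE[of t]] by (simp_all add: cis_2pi_eq_iff)
  moreover have "\<bar>y t 0 - \<phi>0 x\<bar> < 1" "\<bar>y t 1 - \<phi>1 x\<bar> < 1" 
  proof -
    have "\<bar>\<phi>0 x - \<phi>0 a\<bar> < 1/4" "\<bar>\<phi>1 x - \<phi>1 a\<bar> < 1/4" using x(1) by (simp_all add: Q_def)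
    moreover have "y t 0 = \<phi>0 a + t * l0" "y t 1 = \<phi>1 a + t * l1" by (simp_all add: y_def)
    ultimately show "\<bar>y t 0 - \<phi>0 x\<bar> < 1" "\<bar>y t 1 - \<phi>1 x\<bar> < 1" using tl by linarith+
  qed
  ultimately have "y t 0 - \<phi>0 x = 0" "y t 1 - \<phi>1 x = 0" by (metis Ints_nonzero_abs_less1)+
  then have "\<phi>0 x = \<phi>0 a + t * l0" "\<phi>1 x = \<phi>1 a + t * l1" by (simp_all add: y_def)
  then have "l0 * \<phi>0 x + l1 * \<phi>1 x = l0 * \<phi>0 a + l1 * \<phi>1 a + t * (l0 * l0 + l1 * l1)" by (simp add: algebra_simps)
  moreover have "t * (l0 * l0 + l1 * l1) > 0" using t(1) l by (intro mult_pos_pos) (auto simp: sum_squares_gt_zero_iff)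
  ultimately show ?thesis by (intro exI[of _ x]) linarith
qed

lemma continuous_int_valued_constant:
  fixes f :: "'a::real_normed_vector \<Rightarrow> real"
  assumes "continuous_on UNIV f" "\<And>x. f x \<in> \<int>"
  shows "f x = f y"
proof -
  have "f constant_on UNIV"
  proof (rule continuous_discrete_range_constant[OF connected_UNIV assms(1)])
    fix x :: 'a
    show "\<exists>e>0. \<forall>y. y \<in> UNIV \<and> f y \<noteq> f x \<longrightarrow> e \<le> norm (f y - f x)"
    proof (intro exI[of _ 1] conjI allI impI)
      fix y assume "y \<in> UNIV \<and> f y \<noteq> f x"
      moreover have "f y - f x \<in> \<int>" using assms(2) by simp
      ultimately show "1 \<le> norm (f y - f x)" using Ints_nonzero_abs_ge1[of "f y - f x"] by simp
    qed simp
  qed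
  then show ?thesis by (auto simp: constant_on_def)
qed

section \<open>Periods\<close>

lemma irrational_sqrt3: "sqrt 3 \<notin> \<rat>"
proof
  assume "sqrt 3 \<in> \<rat>"
  then obtain m n :: nat where n: "n \<noteq> 0" "\<bar>sqrt 3\<bar> = real m / real n" "coprime m n"
    by (rule Rats_abs_nat_div_natE)
  then have "real m = sqrt 3 * real n" by (simp add: field_simps)
  then have "(real m)\<^sup>2 = 3 * (real n)\<^sup>2" by (simp add: power_mult_distrib)
  then have eq: "m\<^sup>2 = 3 * n\<^sup>2" by (metis of_nat_eq_iff of_nat_mult of_nat_numeral of_nat_power)
  have p3: "prime (3::nat)" by simp
  have "3 dvd m\<^sup>2" unfolding eq by simp
  then have m3: "3 dvd m" using p3 prime_dvd_power by blast
  then obtain k where "m = 3 * k" by (rule dvdE)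
  then have "n\<^sup>2 = 3 * k\<^sup>2" using eq by (simp add: power2_eq_square)
  then have "3 dvd n\<^sup>2" by simp
  then have "3 dvd n" using p3 prime_dvd_power by blast
  then show False using m3 n(3) by (metis coprime_common_divisor_nat numeral_eq_one_iff semiring_norm(86))
qed

text \<open>A maximum principle: where the absolute value of a periodic solution is largest, r times
  this maximum is at most the sum of two neighbouring absolute values, hence at most twice the
  maximum, which is impossible for r > 2 unless it is zero.\<close>

lemma periodic_recurrence_zero:
  fixes b :: "nat \<Rightarrow> real"
  assumes rec: "\<And>n. b (n + 2) = r * b (n + 1) - b n" and r: "r > 2"
    and K: "K > 0" "\<And>n. b (n + K) = b n"
  shows "b n = 0"
proof -
  have per: "b (n + K * j) = b n" for n j
  proof (induction j)
    case (Suc j)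
    then show ?case using K(2)[of "n + K * j"] by (simp add: algebra_simps)
  qed simp
  have modK: "b n = b (n mod K)" for n using per[of "n mod K" "n div K"] by simp
  define A where "A = (\<lambda>n. \<bar>b n\<bar>) ` {..<K}"
  have finA: "finite A" "A \<noteq> {}" using K(1) by (auto simp: A_def)
  have le: "\<bar>b n\<bar> \<le> Max A" for n
    using K(1) by (subst modK) (intro Max_ge finA, auto simp: A_def)
  obtain N where N: "\<bar>b N\<bar> = Max A" using Max_in[OF finA] by (auto simp: A_def)
  \<comment> \<open>The maximum may sit at index 0, which has no left neighbour; one period further
    it has one.\<close>
  have "\<exists>M. N + K = M + 1" using K(1) by (intro exI[of _ "N + K - 1"]) simp
  then obtain M where M: "N + K = M + 1" by blast
  have bM: "b (M + 1) = b N" using K(2)[of N] M by simp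
  have "r * b (M + 1) = b (M + 2) + b M" using rec[of M] by simp
  then have "r * \<bar>b N\<bar> = \<bar>b (M + 2) + b M\<bar>" using r bM by (metis abs_mult abs_of_pos less_trans zero_less_numeral)
  also have "\<dots> \<le> 2 * Max A" using le[of "M + 2"] le[of M] by linarith
  finally have "(r - 2) * Max A \<le> 0" using N by (simp add: algebra_simps)
  then have "Max A \<le> 0" using r by (simp add: mult_le_0_iff)
  then show ?thesis using le[of n] by simp
qed

lemma periodic_integer_recurrence_zero:
  fixes a :: "nat \<Rightarrow> real"
  assumes int: "\<And>n. a n \<in> \<int>" and rec: "\<And>n. a (n + 4) = 2 * a (n + 3) + 2 * a (n + 1) - a n"
    and K: "K > 0" "\<And>n. a (n + K) = a n"
  shows "a n = 0"
proof -
  \<comment> \<open>Applying the factor with non-real roots leaves a recurrence whose characteristic roots are real,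
    positive and different from \<open>1\<close>.\<close>
  define b where "b n = a (n + 2) + (sqrt 3 - 1) * a (n + 1) + a n" for n
  have s: "sqrt 3 * sqrt 3 = 3" "sqrt 3 * (sqrt 3 * y) = 3 * y" for y by (simp_all flip: mult.assoc)
  have b0: "b n = 0" for n
  \<comment> \<open>The two real roots have product 1 and sum \<open>sqrt 3 + 1\<close>, which
    supplies \<open>r\<close>.\<close>
  proof (rule periodic_recurrence_zero[where r = "sqrt 3 + 1" and K = K])
    show "b (n + 2) = (sqrt 3 + 1) * b (n + 1) - b n" for n
    proof -
      have "a (n + 2 + 2) = 2 * a (n + 3) + 2 * a (n + 1) - a n" "a (n + 2 + 1) = a (n + 3)" "a (n + 1 + 2) = a (n + 3)" "a (n + 1 + 1) = a (n + 2)"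
        using rec[of n] by (simp_all add: numeral_eq_Suc)
      then show ?thesis unfolding b_def by (simp add: algebra_simps s)
    qed
    show "sqrt 3 + 1 > 2" using real_sqrt_less_mono[of 1 3] by simp
    show "b (n + K) = b n" for n
      using K(2)[of n] K(2)[of "n + 1"] K(2)[of "n + 2"] unfolding b_def by (simp add: algebra_simps)
  qed (rule K)
  \<comment> \<open>With integer values, \<open>b n = 0\<close> is a relation between 1 and
    \<open>sqrt 3\<close> over the integers, so the coefficient of \<open>sqrt 3\<close>, which is
    \<open>a (n + 1)\<close>, must vanish.\<close>
  have a1: "a (n + 1) = 0" for n
  proof (rule ccontr)
    assume nz: "a (n + 1) \<noteq> 0"
    have "sqrt 3 * a (n + 1) = a (n + 1) - a (n + 2) - a n" using b0[of n] by (simp add: b_def algebra_simps)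
    then have "sqrt 3 = (a (n + 1) - a (n + 2) - a n) / a (n + 1)" using nz by (simp add: field_simps)
    moreover have "\<dots> \<in> \<rat>" using int Ints_subset_Rats by (intro Rats_divide Rats_diff) auto
    ultimately show False using irrational_sqrt3 by simp
  qed
  \<comment> \<open>The previous step does not reach index 0 directly; periodicity does.\<close>
  show ?thesis using a1[of "n + K - 1"] K by simp
qed

text \<open>The scale \<open>c\<close> allows two uses: 1 for the kernel of the period map and a
  common multiple \<open>m\<close> for the translations that fix the lift.\<close>

lemma Zlat_generated:
  assumes S: "0 \<in> S" "\<And>u v. u \<in> S \<Longrightarrow> v \<in> S \<Longrightarrow> u + v \<in> S" "\<And>u. u \<in> S \<Longrightarrow> - u \<in> S"
    and e: "\<And>i. c *\<^sub>R axis i 1 \<in> S" and n: "n \<in> Zlat"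
  shows "c *\<^sub>R n \<in> S"
proof -
  have mult: "real_of_int k *\<^sub>R u \<in> S" if "u \<in> S" for k u
  proof (induction k rule: int_induct[of _ 0])
    case (step1 i)
    then show ?case using S(2)[OF step1(2) that] by (simp add: algebra_simps)
  next
    case (step2 i)
    then show ?case using S(2)[OF step2(2) S(3)[OF that]] by (simp add: algebra_simps)
  qed (simp add: S)
  have "(n $ i) *\<^sub>R (c *\<^sub>R axis i 1) \<in> S" for i
  proof -
    obtain k where "n $ i = of_int k" using n by (auto simp: Zlat_def elim: Ints_cases)
    then show ?thesis using mult[OF e] by simp
  qed
  then have "(n $ 1) *\<^sub>R (c *\<^sub>R axis 1 1) + (n $ 2) *\<^sub>R (c *\<^sub>R axis 2 1) + (n $ 3) *\<^sub>R (c *\<^sub>R axis 3 1) + (n $ 4) *\<^sub>R (c *\<^sub>R axis 4 1) \<in> S"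
    (is "?x \<in> S") by (intro S(2))
  moreover have "?x = c *\<^sub>R n" by (simp add: vec4_eq_iff axis_def)
  ultimately show ?thesis by simp
qed

text \<open>Cayley-Hamilton for the companion polynomial. Multiples are written as repeated sums so
  that a merely additive map can be applied to both sides.\<close>

lemma Apow_recurrence: "Apow (k + 4) x + Apow k x = (Apow (k + 3) x + Apow (k + 3) x) + (Apow (k + 1) x + Apow (k + 1) x)"
proof -
  have e: "k + 4 = ((k + 1) + 1 + 1) + 1" "k + 3 = (k + 1) + 1 + 1" by simp_all
  show ?thesis unfolding e Apow_succ by (simp add: vec4_eq_iff matA_nth)
qed

text \<open>For a companion matrix the first basis vector is cyclic, so the values of an additive
  map along its orbit determine that map on the lattice.\<close>

lemma Apow_axis: "Apow 0 (axis 1 1) = axis 1 1" "Apow 1 (axis 1 1) = axis 2 1" "Apow 2 (axis 1 1) = axis 3 1" "Apow 3 (axis 1 1) = axis 4 1"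
proof -
  have e: "2 = (1::int) + 1" "3 = ((1::int) + 1) + 1" by simp_all
  show "Apow 0 (axis 1 1) = axis 1 1" "Apow 1 (axis 1 1) = axis 2 1" by (simp_all add: vec4_eq_iff matA_nth axis_def)
  show "Apow 2 (axis 1 1) = axis 3 1" "Apow 3 (axis 1 1) = axis 4 1" unfolding e Apow_succ by (simp_all add: vec4_eq_iff matA_nth axis_def)
qed

lemma axis_in_Zlat [simp]: "axis i 1 \<in> Zlat"
  by (simp add: Zlat_def axis_def)

text \<open>
  Along the orbit of the first basis vector, \<open>\<rho>\<close> is a periodic integer sequence that satisfies the
  recurrence given by the characteristic polynomial of \<open>A\<close>.
\<close>

lemma period_hom_zero:
  fixes \<rho> :: "real^4 \<Rightarrow> real"
  assumes int: "\<And>n. n \<in> Zlat \<Longrightarrow> \<rho> n \<in> \<int>"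
    and add: "\<And>m n. m \<in> Zlat \<Longrightarrow> n \<in> Zlat \<Longrightarrow> \<rho> (m + n) = \<rho> m + \<rho> n"
    and K: "K > 0" "\<And>n. n \<in> Zlat \<Longrightarrow> \<rho> (Apow (int K) n) = \<rho> n" and n: "n \<in> Zlat"
  shows "\<rho> n = 0"
proof -
  define a where "a j = \<rho> (Apow (int j) (axis 1 1))" for j :: nat
  have Z: "Apow k (axis 1 1) \<in> Zlat" for k by (simp add: Apow_Zlat)
  have a0: "a j = 0" for j
  proof (rule periodic_integer_recurrence_zero[where K = K])
    show "a n \<in> \<int>" for n using int Z by (simp add: a_def)
    show "a (n + 4) = 2 * a (n + 3) + 2 * a (n + 1) - a n" for n
    proof -
      have "\<rho> (Apow (int n + 4) (axis 1 1)) + \<rho> (Apow (int n) (axis 1 1)) =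
          \<rho> (Apow (int n + 3) (axis 1 1)) + \<rho> (Apow (int n + 3) (axis 1 1)) + (\<rho> (Apow (int n + 1) (axis 1 1)) + \<rho> (Apow (int n + 1) (axis 1 1)))"
        using arg_cong[OF Apow_recurrence[of "int n" "axis 1 1"], of \<rho>] by (simp only: add Z Zlat_simps(3))
      then show ?thesis by (simp add: a_def add.commute)
    qed
    show "a (n + K) = a n" for n
      using K(2)[OF Z[of "int n"]] by (simp add: a_def add.commute Apow_add)
  qed (rule K)
  have "\<rho> 0 = 0" using add[of 0 0] by simp
  moreover have "\<rho> (- u) = 0" if "\<rho> u = 0" "u \<in> Zlat" for u using add[of u "- u"] that \<open>\<rho> 0 = 0\<close> by simp
  moreover have "\<rho> (axis i 1) = 0" for i :: 4
    using a0[of 0] a0[of 1] a0[of 2] a0[of 3] Apow_axis exhaust_4[of i] unfolding a_def by auto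
  ultimately have "1 *\<^sub>R n \<in> {n \<in> Zlat. \<rho> n = 0}"
    by (intro Zlat_generated[OF _ _ _ _ n]) (simp_all add: add)
  then show ?thesis by simp
qed

section \<open>Invariance of the lift under a subgroup and the contradiction to openness\<close>

lemma no_open_map_to_torus:
  assumes cov: "covers X (mtop Mquot) p" and fin: "\<And>x. x \<in> mcarrier Mquot \<Longrightarrow> finite {y \<in> topspace X. p y = x}"
    and ne: "topspace X \<noteq> {}"
    and G0: "continuous_map X (mtop (torus 3)) G0" "open_map X (mtop (torus 3)) G0"
  shows False
proof -
  obtain y0 where y0: "y0 \<in> topspace X" using ne by blast
  have "p y0 \<in> mcarrier Mquot" using cov y0 continuous_map_funspace unfolding covers_def by blast
  then obtain z where z: "p y0 = orb \<Gamma> z" by (auto simp: topspace_Mquot)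
  \<comment> \<open>Lifts are available with prescribed value at the origin, so the projection is
    recentred at \<open>z\<close>; the shift is undone in \<open>s\<close>.\<close>
  have "continuous_map euclidean (mtop Mquot) (\<lambda>x. orb \<Gamma> (x + z))"
    using continuous_map_compose[OF _ continuous_map_orb_\<Gamma>, of euclidean "\<lambda>x. x + z"]
    by (simp add: comp_def continuous_map_iff_continuous2 continuous_intros)
  from covers_lift[OF cov this y0] z
  obtain s' where s': "continuous_map euclidean X s'" "\<And>x. p (s' x) = orb \<Gamma> (x + z)" by (metis add_0)
  define s where "s x = s' (x - z)" for x
  have s: "continuous_map euclidean X s" "\<And>x. p (s x) = orb \<Gamma> x"
    using continuous_map_compose[OF _ s'(1), of euclidean "\<lambda>x. x - z"] s'(2)
    by (simp_all add: s_def[abs_def] comp_def continuous_map_iff_continuous2 continuous_intros)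
  have sX: "s x \<in> topspace X" for x using continuous_map_funspace[OF s(1)] by auto
  have s_open: "open_map euclidean X s" by (rule covers_lift_open_map[OF cov open_map_orb_\<Gamma> s])
  have pow\<Gamma>: "\<gamma> ^^ j \<in> \<Gamma>" if "\<gamma> \<in> \<Gamma>" for \<gamma> j
  proof (induction j)
    case 0
    then show ?case using \<Gamma>_id by (simp add: id_def)
  next
    case (Suc j)
    then show ?case using \<Gamma>_comp[OF that Suc] by (simp add: comp_def)
  qed
  \<comment> \<open>Pigeonhole in a finite fibre: two of the points above the orbit of the origin
    coincide. The lift and its composition with a power of \<gamma> then agree at one point, and
    uniqueness of lifts makes them equal everywhere.\<close>
  have periodic: "\<exists>j>0. \<forall>x. s ((\<gamma> ^^ j) x) = s x" if g: "\<gamma> \<in> \<Gamma>" for \<gamma>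
  proof -
    have "range (\<lambda>i. s ((\<gamma> ^^ i) 0)) \<subseteq> {y \<in> topspace X. p y = orb \<Gamma> 0}"
    proof (rule image_subsetI)
      fix i
      have "p (s ((\<gamma> ^^ i) 0)) = orb \<Gamma> 0" by (simp only: s(2) orb_\<Gamma>[OF pow\<Gamma>[OF g]])
      then show "s ((\<gamma> ^^ i) 0) \<in> {y \<in> topspace X. p y = orb \<Gamma> 0}" using sX[of "(\<gamma> ^^ i) 0"] by simp
    qed
    moreover have "finite {y \<in> topspace X. p y = orb \<Gamma> 0}" by (rule fin) (simp add: topspace_Mquot)
    ultimately have "finite (range (\<lambda>i. s ((\<gamma> ^^ i) 0)))" by (rule finite_subset)
    then have "\<not> inj (\<lambda>i. s ((\<gamma> ^^ i) 0))" using finite_imageD by fastforce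
    then obtain i j where ij: "i < j" "s ((\<gamma> ^^ i) 0) = s ((\<gamma> ^^ j) 0)"
      unfolding inj_def by (metis linorder_neqE_nat)
    define l where "l = j - i"
    have l: "l > 0" "(\<gamma> ^^ j) 0 = (\<gamma> ^^ l) ((\<gamma> ^^ i) 0)"
      using ij(1) by (simp_all add: l_def flip: funpow_add[THEN fun_cong, unfolded comp_def])
    have "s ((\<gamma> ^^ l) x) = s x" for x
    proof (rule covers_lift_unique[OF cov connected_UNIV, where ?z0.0 = "(\<gamma> ^^ i) 0"])
      have "continuous_map euclidean euclidean (\<gamma> ^^ l)"
        using continuous_on_\<Gamma>[OF pow\<Gamma>[OF g]] by (simp add: continuous_map_iff_continuous2)
      from continuous_map_compose[OF this s(1)]
      show "continuous_map (top_of_set UNIV) X (\<lambda>x. s ((\<gamma> ^^ l) x))" by (simp add: comp_def)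
      show "continuous_map (top_of_set UNIV) X s" using s(1) by simp
      show "p (s ((\<gamma> ^^ l) x)) = p (s x)" for x by (simp only: s(2) orb_\<Gamma>[OF pow\<Gamma>[OF g]])
      show "s ((\<gamma> ^^ l) ((\<gamma> ^^ i) 0)) = s ((\<gamma> ^^ i) 0)" using ij l by simp
    qed simp_all
    then show ?thesis using l by blast
  qed
  define Lam where "Lam = {n \<in> Zlat. \<forall>x. s (act 0 n x) = s x}"
  have LamI: "n \<in> Lam" if "n \<in> Zlat" "\<And>x. s (act 0 n x) = s x" for n unfolding Lam_def using that by blast
  have LamD: "n \<in> Zlat" "s (act 0 n x) = s x" if "n \<in> Lam" for n x using that unfolding Lam_def by blast+
  have zLam: "0 \<in> Lam" by (rule LamI) simp_all
  have Lam_add: "u + v \<in> Lam" if "u \<in> Lam" "v \<in> Lam" for u v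
  proof (rule LamI)
    show "u + v \<in> Zlat" using LamD(1) that by simp
    have "act 0 (u + v) x = act 0 u (act 0 v x)" for x by (simp add: act_act)
    then show "s (act 0 (u + v) x) = s x" for x by (simp only: LamD(2)[OF that(1)] LamD(2)[OF that(2)])
  qed
  have Lam_neg: "- u \<in> Lam" if "u \<in> Lam" for u
  proof (rule LamI)
    show "- u \<in> Zlat" using LamD(1) that by simp
    have "act 0 u (act 0 (- u) x) = x" for x by (simp add: act_act)
    then show "s (act 0 (- u) x) = s x" for x using LamD(2)[OF that, of "act 0 (- u) x"] by simp
  qed
  have trans: "act 0 n ^^ j = act 0 (real j *\<^sub>R n)" for n j
    by (induction j) (simp_all add: fun_eq_iff act_act algebra_simps)
  have "\<exists>j>0. real j *\<^sub>R axis i 1 \<in> Lam" for i :: 4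
  proof -
    obtain j where "j > 0" "\<forall>x. s ((act 0 (axis i 1) ^^ j) x) = s x"
      using periodic[OF act_in_\<Gamma>[OF axis_in_Zlat[of i], of 0]] by blast
    moreover have "real j *\<^sub>R axis i 1 \<in> Zlat" by (simp add: Zlat_def axis_def)
    ultimately show ?thesis unfolding trans using LamI by blast
  qed
  then obtain f where f: "\<And>i :: 4. f i > 0" "\<And>i. real (f i) *\<^sub>R axis i 1 \<in> Lam" by metis
  \<comment> \<open>The periods found along the four axes may differ; their product is a common
    multiple.\<close>
  define m where "m = (\<Prod>i\<in>UNIV. f i)"
  have m: "m > 0" using f(1) by (simp add: m_def prod_pos)
  have "real m *\<^sub>R axis i 1 \<in> Lam" for i
  proof -
    have mult: "real j *\<^sub>R u \<in> Lam" if "u \<in> Lam" for j u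
    proof (induction j)
      case (Suc j)
      then show ?case using Lam_add[OF that Suc] by (simp add: algebra_simps)
    qed (simp add: zLam)
    have "f i dvd m" unfolding m_def by (rule dvd_prodI) simp_all
    then obtain j where "m = f i * j" by (rule dvdE)
    then show ?thesis using mult[OF f(2)[of i], of j] by (simp add: mult.commute)
  qed
  then have mLam: "real m *\<^sub>R n \<in> Lam" if "n \<in> Zlat" for n
    using Zlat_generated[OF zLam Lam_add Lam_neg _ that] by blast
  have pw: "act 1 0 ^^ j = act (int j) 0" for j
    by (induction j) (simp_all add: fun_eq_iff act_act algebra_simps)
  obtain K where K: "K > 0" "\<And>x. s (act (int K) 0 x) = s x"
    using periodic[OF act_in_\<Gamma>[OF Zlat_simps(1), of 1]] unfolding pw by blast
  let ?G = "G0 \<circ> s"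
  have G: "continuous_map euclidean (mtop (torus 3)) ?G" "open_map euclidean (mtop (torus 3)) ?G"
    using continuous_map_compose[OF s(1) G0(1)] open_map_compose[OF s_open G0(2)] by simp_all
  have angle: "\<exists>\<phi> c. continuous_on UNIV \<phi> \<and> (\<forall>x. circle_coord 3 i (?G x) = cis (2 * pi * \<phi> x)) \<and>
      (\<forall>n\<in>Zlat. \<forall>x. \<phi> (act 0 (real m *\<^sub>R n) x) = \<phi> x) \<and> (\<forall>x. \<phi> (act (int K) 0 x) = \<phi> x + c)" for i
  proof -
    obtain \<phi> :: "(real^4) \<times> real \<Rightarrow> real" where \<phi>: "continuous_on UNIV \<phi>" "\<And>x. circle_coord 3 i (?G x) = cis (2 * pi * \<phi> x)"
      using torus_map_angle[OF G(1)] by blast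
    have Zdiff: "\<phi> (\<gamma> x) - \<phi> x \<in> \<int>" if "\<And>x. s (\<gamma> x) = s x" for \<gamma> x
    proof -
      have "cis (2 * pi * \<phi> (\<gamma> x)) = cis (2 * pi * \<phi> x)"
        unfolding \<phi>(2)[symmetric] by (simp add: that)
      then show ?thesis by (simp add: cis_2pi_eq_iff)
    qed
    \<comment> \<open>If \<gamma> fixes the lift, the angle changes by an integer at every point; by
      continuity this integer is the same everywhere and is a period.\<close>
    have const: "\<phi> (\<gamma> x) - \<phi> x = \<phi> (\<gamma> 0) - \<phi> 0" if "\<gamma> \<in> \<Gamma>" "\<And>x. s (\<gamma> x) = s x" for \<gamma> x
    proof (rule continuous_int_valued_constant[of "\<lambda>x. \<phi> (\<gamma> x) - \<phi> x"])
      show "continuous_on UNIV (\<lambda>x. \<phi> (\<gamma> x) - \<phi> x)"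
        by (intro continuous_intros \<phi> continuous_on_compose2[OF \<phi>(1) continuous_on_\<Gamma>[OF that(1)]]) simp
    qed (rule Zdiff[OF that(2)])
    define \<rho> where "\<rho> n = \<phi> (act 0 (real m *\<^sub>R n) 0) - \<phi> 0" for n
    define c where "c = \<phi> (act (int K) 0 0) - \<phi> 0"
    have c: "\<phi> (act (int K) 0 x) = \<phi> x + c" for x
      using const[OF act_in_\<Gamma> K(2), of x] by (simp add: c_def)
    have \<rho>: "\<phi> (act 0 (real m *\<^sub>R n) x) = \<phi> x + \<rho> n" if "n \<in> Zlat" for n x
    proof -
      have "real m *\<^sub>R n \<in> Zlat" "\<And>x. s (act 0 (real m *\<^sub>R n) x) = s x" using LamD[OF mLam[OF that]] by blast+
      then show ?thesis using const[OF act_in_\<Gamma>, of "real m *\<^sub>R n" 0 x] by (simp add: \<rho>_def)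
    qed
    have \<rho>0: "\<rho> n = 0" if "n \<in> Zlat" for n
    proof (rule period_hom_zero[OF _ _ K(1) _ that])
      fix n assume n: "n \<in> Zlat"
      have "\<And>x. s (act 0 (real m *\<^sub>R n) x) = s x" using LamD[OF mLam[OF n]] by blast
      then show "\<rho> n \<in> \<int>" unfolding \<rho>_def by (rule Zdiff)
      \<comment> \<open>The power of the monodromy conjugates the translation by a lattice vector
        into the translation by its image. Computing the change of angle in both orders, the
        contribution \<open>c\<close> cancels and the invariance of \<rho> remains.\<close>
      have "act (int K) 0 (act 0 (real m *\<^sub>R n) 0) = act 0 (real m *\<^sub>R Apow (int K) n) (act (int K) 0 0)"
        by (simp add: act_act linear_scale[OF linear_Apow])
      then show "\<rho> (Apow (int K) n) = \<rho> n"
        using c[of "act 0 (real m *\<^sub>R n) 0"] c[of 0] \<rho>[OF n, of 0] \<rho>[OF Apow_Zlat[OF n], of "int K" "act (int K) 0 0"] by simp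
      fix n' assume n': "n' \<in> Zlat"
      have "act 0 (real m *\<^sub>R (n' + n)) 0 = act 0 (real m *\<^sub>R n') (act 0 (real m *\<^sub>R n) 0)"
        by (simp add: act_act algebra_simps)
      then show "\<rho> (n' + n) = \<rho> n' + \<rho> n"
        using \<rho>[OF n', of "act 0 (real m *\<^sub>R n) 0"] \<rho>[OF n, of 0] \<rho>[of "n' + n" 0] n n' by simp
    qed
    show ?thesis
      by (intro exI[of _ \<phi>] exI[of _ c] conjI allI ballI \<phi> c) (simp add: \<rho> \<rho>0)
  qed
  obtain \<phi>0 c0 where \<phi>0: "continuous_on UNIV \<phi>0" "\<And>x. circle_coord 3 0 (?G x) = cis (2 * pi * \<phi>0 x)"
      "\<And>n x. n \<in> Zlat \<Longrightarrow> \<phi>0 (act 0 (real m *\<^sub>R n) x) = \<phi>0 x" "\<And>x. \<phi>0 (act (int K) 0 x) = \<phi>0 x + c0"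
    using angle[of 0] by blast
  obtain \<phi>1 c1 where \<phi>1: "continuous_on UNIV \<phi>1" "\<And>x. circle_coord 3 1 (?G x) = cis (2 * pi * \<phi>1 x)"
      "\<And>n x. n \<in> Zlat \<Longrightarrow> \<phi>1 (act 0 (real m *\<^sub>R n) x) = \<phi>1 x" "\<And>x. \<phi>1 (act (int K) 0 x) = \<phi>1 x + c1"
    using angle[of 1] by blast
  \<comment> \<open>Only the \<open>t\<close>-direction contributes periods, so two coordinates of the torus suffice to cancel them.\<close>
  obtain l0 l1 :: real where l: "l0 \<noteq> 0 \<or> l1 \<noteq> 0" "l0 * c0 + l1 * c1 = 0"
  proof (cases "c0 = 0")
    case True
    then show ?thesis using that[of 1 0] by simp
  next
    case False
    then show ?thesis using that[of c1 "- c0"] by simp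
  qed
  define \<psi> where "\<psi> x = l0 * \<phi>0 x + l1 * \<phi>1 x" for x
  have \<psi>m: "\<psi> (act 0 (real m *\<^sub>R n) x) = \<psi> x" if "n \<in> Zlat" for n x by (simp add: \<psi>_def \<phi>0(3)[OF that] \<phi>1(3)[OF that])
  have \<psi>K: "\<psi> (act (int K) 0 x) = \<psi> x" for x
  proof -
    have "\<psi> (act (int K) 0 x) = \<psi> x + (l0 * c0 + l1 * c1)" by (simp add: \<psi>_def \<phi>0(4) \<phi>1(4) algebra_simps)
    then show ?thesis using l by simp
  qed
  have \<psi>Kj: "\<psi> (act (int K * j) 0 x) = \<psi> x" for j x
  proof (induction j arbitrary: x rule: int_induct[of _ 0])
    case (step1 i)
    have "act (int K * (i + 1)) 0 x = act (int K) 0 (act (int K * i) 0 x)" by (simp add: act_act algebra_simps linear_0[OF linear_Apow])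
    then show ?case by (simp only: \<psi>K step1(2))
  next
    case (step2 i)
    have "act (int K * i) 0 x = act (int K) 0 (act (int K * (i - 1)) 0 x)" by (simp add: act_act algebra_simps linear_0[OF linear_Apow])
    then have "\<psi> (act (int K * i) 0 x) = \<psi> (act (int K * (i - 1)) 0 x)" by (simp only: \<psi>K)
    then show ?case by (simp only: step2(2))
  qed simp
  \<comment> \<open>A compact region that meets every orbit of the group generated by the
    translations in m times the lattice and the K-th power of the monodromy, so a maximum on it is
    global.\<close>
  define D :: "((real^4) \<times> real) set" where "D = cbox 0 (\<chi> i. real m) \<times> {0..real K}"
  have "compact D" unfolding D_def by (intro compact_Times compact_cbox compact_Icc)
  moreover have "0 \<in> D" by (simp add: D_def mem_box_cart zero_prod_def)
  moreover have "continuous_on D \<psi>" unfolding \<psi>_def[abs_def]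
    by (intro continuous_intros continuous_on_subset[OF \<phi>0(1)] continuous_on_subset[OF \<phi>1(1)]) simp_all
  ultimately obtain a where a: "\<forall>x\<in>D. \<psi> x \<le> \<psi> a" using continuous_attains_sup[of D \<psi>] by blast
  have "\<psi> x \<le> \<psi> a" for x
  proof -
    define j where "j = \<lfloor>snd x / real K\<rfloor>"
    define x' where "x' = act (int K * (- j)) 0 x"
    define n :: "real^4" where "n = (\<chi> i. of_int (- \<lfloor>fst x' $ i / real m\<rfloor>))"
    have n: "n \<in> Zlat" by (simp add: n_def Zlat_def)
    have fl: "0 \<le> t - r * \<lfloor>t / r\<rfloor>" "t - r * \<lfloor>t / r\<rfloor> \<le> r" if "r > 0" for t r :: real
    proof -
      have "r * of_int \<lfloor>t / r\<rfloor> \<le> r * (t / r)" "r * (t / r) \<le> r * (of_int \<lfloor>t / r\<rfloor> + 1)"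
        by (rule mult_left_mono; use that in linarith)+
      moreover have "r * (t / r) = t" using that by simp
      ultimately show "0 \<le> t - r * \<lfloor>t / r\<rfloor>" "t - r * \<lfloor>t / r\<rfloor> \<le> r" by (simp_all add: algebra_simps)
    qed
    have "act 0 (real m *\<^sub>R n) x' \<in> D"
    proof -
      have "snd x' = snd x - real K * \<lfloor>snd x / real K\<rfloor>" by (simp add: x'_def act_def j_def)
      then have "snd x' \<in> {0..real K}" using fl[of "real K" "snd x"] K(1) by simp
      moreover have "fst x' + real m *\<^sub>R n \<in> cbox 0 (\<chi> i. real m)"
      proof -
        have "(fst x' + real m *\<^sub>R n) $ i = fst x' $ i - real m * \<lfloor>fst x' $ i / real m\<rfloor>" for i by (simp add: n_def)
        then show ?thesis using fl[of "real m"] m by (simp add: mem_box_cart)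
      qed
      ultimately show ?thesis by (simp add: D_def act_def)
    qed
    then have "\<psi> (act 0 (real m *\<^sub>R n) x') \<le> \<psi> a" using a by blast
    moreover have "\<psi> (act 0 (real m *\<^sub>R n) x') = \<psi> x" unfolding \<psi>m[OF n] unfolding x'_def by (rule \<psi>Kj)
    ultimately show ?thesis by simp
  qed
  moreover have "\<exists>x. \<psi> x > \<psi> a"
    unfolding \<psi>_def by (rule torus_open_map_no_max[OF G \<phi>0(1) \<phi>1(1) \<phi>0(2) \<phi>1(2) l(1)])
  ultimately show False by (meson not_less)
qed

text \<open>The bundle lives on a diffeomorphic copy of the covering manifold, so its projection is
  transported back along \<open>f\<close>.\<close>

lemma no_finite_cover_fibres_over_torus:
  fixes M' :: "'b mfd" and N :: "'c mfd" and F :: "'d mfd"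
  assumes "mcarrier M' \<noteq> {}" "finite_covering M' Mquot p" "fiber_bundle N (torus 3) F \<pi>" "diffeomorphism M' N f"
  shows False
proof (rule no_open_map_to_torus)
  show "covers (mtop M') (mtop Mquot) p" using assms(2) by (simp add: finite_covering_def smooth_covering_covers)
  show "finite {y \<in> mcarrier M'. p y = x}" if "x \<in> mcarrier Mquot" for x
    using assms(2) that by (simp add: finite_covering_def)
  have h: "homeomorphic_map (mtop M') (mtop N) f" by (rule diffeomorphism_homeomorphic_map[OF assms(4)])
  have "continuous_map (mtop N) (mtop (torus 3)) \<pi>" using assms(3) by (simp add: fiber_bundle_def smooth_map_def)
  then show "continuous_map (mtop M') (mtop (torus 3)) (\<pi> \<circ> f)"
    using continuous_map_compose[OF homeomorphic_imp_continuous_map[OF h]] by blast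
  show "open_map (mtop M') (mtop (torus 3)) (\<pi> \<circ> f)"
    using open_map_compose[OF homeomorphic_imp_open_map[OF h] fiber_bundle_open_map[OF assms(3)]] .
qed (rule assms(1))

theorem mainTheorem1:
  shows
    "invertible matAZ \<and> is_companion_matrix matAZ [:1, -2, 0, -2, 1:] \<and>
     subspace planeH \<and> subspace planeE \<and> dim planeH = 2 \<and> planeH \<inter> planeE = {0} \<and> {h + e |h e. h \<in> planeH \<and> e \<in> planeE} = UNIV \<and>
     smooth_manifold Mt \<and> (\<forall>\<gamma>\<in>\<Gamma>. diffeomorphism Mt Mt \<gamma>) \<and>
     (\<exists>q. invariant_form q) \<and>
     (\<forall>q. invariant_form q \<longrightarrow>
        nonneg_metric Mt (gt q) \<and>
        acts_freely (mtop Mt) \<Gamma> \<and> properly_discontinuous (mtop Mt) \<Gamma> \<and> cocompact (mtop Mt) \<Gamma> \<and>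
        (\<forall>\<gamma>\<in>\<Gamma>. is_pullback Mt Mt \<gamma> (gt q) (gt q)) \<and>
        closed_manifold Mquot \<and> mdim Mquot = 5 \<and>
        (\<exists>g. sym_tensor Mquot g \<and> is_pullback Mt Mquot (orb \<Gamma>) g (gt q)) \<and>
        (\<forall>g. sym_tensor Mquot g \<and> is_pullback Mt Mquot (orb \<Gamma>) g (gt q) \<longrightarrow>
           nonneg_metric Mquot g \<and> flat_metric Mquot g \<and> constant_rank Mquot g 3)) \<and>
     \<not> (\<exists>(M' :: 'b mfd) p (N :: 'c mfd) (F :: 'd mfd) \<pi> f.
          smooth_manifold M' \<and> mcarrier M' \<noteq> {} \<and> finite_covering M' Mquot p \<and>
          fiber_bundle N (torus 3) F \<pi> \<and> diffeomorphism M' N f) \<and>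
     \<not> (\<forall>(X :: ((real^4) \<times> real) set mfd) g m.
          closed_manifold X \<and> nonneg_metric X g \<and> flat_metric X g \<and> constant_rank X g m \<longrightarrow>
          (\<exists>(M' :: 'b mfd) p (N :: 'c mfd) (F :: 'd mfd) \<pi> f.
             smooth_manifold M' \<and> finite_covering M' X p \<and> p ` mcarrier M' = mcarrier X \<and>
             fiber_bundle N (torus m) F \<pi> \<and> diffeomorphism M' N f))"
    (is "_ \<and> _ \<and> _ \<and> _ \<and> _ \<and> _ \<and> _ \<and> _ \<and> _ \<and> _ \<and> ?metric \<and> \<not> ?cover \<and> \<not> ?conj")
proof (intro conjI invertible_matAZ is_companion_matAZ subspace_planeH subspace_planeE dim_planeH
    planeH_inter_planeE planeH_plus_planeE smooth_manifold_Mt ballI diffeomorphism_\<Gamma> ex_invariant_form)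
  show ?metric
    using nonneg_metric_Mt acts_freely_\<Gamma> properly_discontinuous_\<Gamma> cocompact_\<Gamma> is_pullback_\<Gamma>
      closed_manifold_Mquot mdim_Mquot ex_metric_Mquot metric_Mquot_nonneg_flat constant_rank_Mquot
    by (intro allI impI conjI ballI) auto
  show "\<not> ?cover"
    by (intro notI, elim exE conjE) (rule no_finite_cover_fibres_over_torus)
  show "\<not> ?conj"
  proof
    assume conj: ?conj
    obtain q where q: "invariant_form q" using ex_invariant_form by blast
    obtain g where g: "sym_tensor Mquot g" "is_pullback Mt Mquot (orb \<Gamma>) g (gt q)"
      using ex_metric_Mquot[OF q] by blast
    have "closed_manifold Mquot \<and> nonneg_metric Mquot g \<and> flat_metric Mquot g \<and> constant_rank Mquot g 3"
      using closed_manifold_Mquot metric_Mquot_nonneg_flat[OF q g] constant_rank_Mquot[OF q g(2)] by blast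
    with conj have "\<exists>(M' :: 'b mfd) p (N :: 'c mfd) (F :: 'd mfd) \<pi> f.
        smooth_manifold M' \<and> finite_covering M' Mquot p \<and> p ` mcarrier M' = mcarrier Mquot \<and>
        fiber_bundle N (torus 3) F \<pi> \<and> diffeomorphism M' N f" by (elim allE impE)
    then obtain M' :: "'b mfd" and p and N :: "'c mfd" and F :: "'d mfd" and \<pi> f
      where M': "finite_covering M' Mquot p" "p ` mcarrier M' = mcarrier Mquot"
        "fiber_bundle N (torus 3) F \<pi>" "diffeomorphism M' N f" by (elim exE conjE)
    \<comment> \<open>In the general assertion the covering is required to be onto, and the quotient
      has points.\<close>
    have "mcarrier M' \<noteq> {}" using M'(2) topspace_Mquot by auto
    then show False by (rule no_finite_cover_fibres_over_torus[OF _ M'(1,3,4)])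
  qed
qed

end
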